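(* Let $E=\mathbb{C}^d$, $F=\mathbb{C}^r$, let $K_0\subset E$ be a compact absolutely convex neighbourhood of $0$, let $p\in\mathbb{R}^d$ and $K:=p+K_0$. Let $f:K\cap\mathbb{R}^d\to F$ be a map admitting a holomorphic extension (again denoted $f$) to an open neighbourhood of $K$ in $E$. Let $\mu$ be a Borel probability measure on $K_0\cap\mathbb{R}^d$ that is absolutely continuous with respect to the Lebesgue measure on $K_0\cap\mathbb{R}^d$. Let $\{x^i\}_{i=1}^\infty\subset\mathrm{supp}(\mu)$ and $X_N:=(p+x^1,\dots,p+x^N)\in K^N$. Let $\mathbf{C}_m$ be the representation matrix of $f_*|_{\mathfrak{D}_{p,m}}:\mathfrak{D}_{p,m}\to\mathfrak{D}_{f(p),m}$ with respect to the bases $\big(\overline{\mathbf{FB}}_E^{-1}(u_{p,i})\big)_{i=1}^{r_m^E}$ and $\big(\overline{\mathbf{FB}}_F^{-1}(v_{f(p),i})\big)_{i=1}^{r_m^F}$. Assume that $N^{-1}\sum_{i=1}^N\delta_{x^i}$ converges weakly to $\mu$ as $N\to\infty$. Then there is a constant $C>0$, independent of $m$ and $n$, such that for all $m,n\in\mathbb{Z}_{\ge 0}$ with $m\le n$, $$\limsup_{N\to\infty}\big\|\mathbf{C}_m-\widehat{\mathbf{C}}_{m,n,X_N}\big\|_{\rm Fr}\le C\sqrt{m!}\,\frac{R_\mu^n}{\Lambda_n(\mu)^{1/2}},$$ where $R_\mu:=\sup_{x\in\mathrm{supp}(\mu)}|x|_{K_0}$.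
   Context: $E=\mathbb{C}^d$ and $F=\mathbb{C}^r$ carry the standard Hermitian inner products $\langle z,w\rangle=w^*z=\sum_i z_i\overline{w_i}$. A set $S$ is absolutely convex if $ax+by\in S$ whenever $x,y\in S$ and $a,b\in\mathbb{C}$, $|a|+|b|\le1$. $|z|_{K_0}:=\inf\{t>0: z\in tK_0\}$. $\mathbf{e}_\zeta(z):=e^{\zeta^*z}$. $\|\cdot\|_{\rm Fr}$ is the Frobenius norm, $\dagger$ the Moore–Penrose pseudo-inverse. Bases and matrices. Fix a numbering $\{\alpha^{(i)}\}_{i\ge1}$ of $\mathbb{Z}_{\ge0}^d$ with $\alpha^{(1)}=0$, $\alpha^{(i+1)}$ the $i$-th elementary vector for $1\le i\le d$, and $|\alpha^{(i)}|\le|\alpha^{(j)}|$ for $i\le j$; similarly $\{\beta^{(i)}\}$ of $\mathbb{Z}_{\ge0}^r$. Put $r_n^E=\binom{n+d}{d}$, $r_n^F=\binom{n+r}{r}$, $$u_{p,i}(z)=\frac{e^{-\|p\|^2/2}}{\sqrt{\alpha^{(i)}!}}(z-p)^{\alpha^{(i)}}e^{p^*z},\qquad v_{q,i}(w)=\frac{e^{-\|q\|^2/2}}{\sqrt{\beta^{(i)}!}}(w-q)^{\beta^{(i)}}e^{q^*w},$$ and row vectors $\mathbf{u}_{p,n}(z)=(u_{p,1}(z),\dots,u_{p,r_n^E}(z))$, $\mathbf{v}_{q,n}(w)=(v_{q,1}(w),\dots,v_{q,r_n^F}(w))$. For $Z=(z^1,\dots,z^N)\in E^N$ let $\mathbf{U}_{p,n,Z}\in\mathbb{C}^{N\times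 r_n^E}$ be the matrix with rows $\mathbf{u}_{p,n}(z^i)$; for $W=(w^1,\dots,w^N)\in F^N$ let $\mathbf{V}_{q,n,W}\in\mathbb{C}^{N\times r_n^F}$ be the matrix with rows $\mathbf{v}_{q,n}(w^i)$. For $Z\in K^N$, $W=(f(z^1),\dots,f(z^N))$ and $m\le n$, $\widehat{\mathbf{C}}_{m,n,Z}\in\mathbb{C}^{r_m^F\times r_m^E}$ consists of the first $r_m^E$ columns of $\mathbf{V}_{f(p),m,W}^*(\mathbf{U}_{p,n,Z}^* )^\dagger$. Moment matrices. For a Borel measure $\mu$ on $E$, $\mathbf{D}_n(\mu)=\big(\int\overline{z^{\alpha^{(i)}}}z^{\alpha^{(j)}}d\mu(z)\big)_{i,j=1}^{r_n^E}$ and $\Lambda_n(\mu)$ is its smallest eigenvalue. Push-forward. For compact $S$, $\mathcal{O}_E(S)$ is the space of germs on $S$ of holomorphic functions (inductive limit of $\mathcal{O}_E(U)$ over open $U\supset S$), and $'$ denotes the continuous dual with the strong topology. $f_*:\mathcal{O}_E(K)'\to\mathcal{O}_F(F)'$ is $f_*(\nu)(h)=\nu(h\circ f)$. For $\nu\in\mathcal{O}_E(K)'$, $\overline{\mathbf{FB}}_E(\nu)(\zeta):=\overline{\nu(\mathbf{e}_\zeta)}$, an injective antilinear map into the entire functions on $E$; similarly $\overline{\mathbf{FB}}_F$ on $\mathcal{O}_F(F)'$. $\mathfrak{D}_{p,n}$ is the span of the functionals $h\mapsto(\partial^\alpha h)(p)$, $|\alpha|\le n$; similarly $\mathfrak{D}_{q,n}$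 for $q\in F$. The map $\overline{\mathbf{FB}}_E$ sends $\mathfrak{D}_{p,n}$ bijectively onto $\{P\mathbf{e}_p: P\text{ polynomial on }E,\ \deg P\le n\}$, which has basis $(u_{p,i})_{i\le r_n^E}$, so $\big(\overline{\mathbf{FB}}_E^{-1}(u_{p,i})\big)_{i\le r_n^E}$ is a basis of $\mathfrak{D}_{p,n}$; similarly $\big(\overline{\mathbf{FB}}_F^{-1}(v_{q,i})\big)_{i\le r_n^F}$ is a basis of $\mathfrak{D}_{q,n}$. The map $f_*$ sends $\mathfrak{D}_{p,m}$ into $\mathfrak{D}_{f(p),m}$. The representation matrix $(C_{ij})$ of a linear map $L$ with respect to bases $(b_j),(b'_i)$ is given by $L(b_j)=\sum_iC_{ij}b'_i$.
   Formalization: The bound is proved for C_m minus the entrywise complex conjugate of Ĉ_{m,n,X_N}; as printed it fails for f(z)=iz (d=r=1, p=0, K_0 the disc of radius 10, μ uniform on [-1,1]). It is the printed bound when f is real-valued on K∩R^d. *)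

theory Defs
  imports "HOL-Probability.Probability" "Jordan_Normal_Form.Schur_Decomposition"
begin

(* "$" is component access in complex ^ 'n and real ^ 'n; the entries of the matrices of
   Jordan_Normal_Form are written "$$". *)
no_notation Matrix.vec_index (infixl "$" 100)

section \<open>Complex Euclidean space\<close>

(* herm z w = w^* z, antilinear in the second argument *)
definition herm :: "complex ^ 'n::finite \<Rightarrow> complex ^ 'n \<Rightarrow> complex" where
  "herm z w = (\<Sum>i\<in>UNIV. z $ i * cnj (w $ i))"

definition exp_fun :: "complex ^ 'n::finite \<Rightarrow> complex ^ 'n \<Rightarrow> complex" where
  "exp_fun \<zeta> z = exp (herm z \<zeta>)"

definition cvec :: "real ^ 'n::finite \<Rightarrow> complex ^ 'n" where
  "cvec x = (\<chi> i. complex_of_real (x $ i))"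

definition absolutely_convex :: "(complex ^ 'n::finite) set \<Rightarrow> bool" where
  "absolutely_convex S \<longleftrightarrow>
     (\<forall>x\<in>S. \<forall>y\<in>S. \<forall>a b :: complex. cmod a + cmod b \<le> 1 \<longrightarrow> a *s x + b *s y \<in> S)"

definition minkowski_gauge :: "(complex ^ 'n::finite) set \<Rightarrow> complex ^ 'n \<Rightarrow> real" where
  "minkowski_gauge S z = Inf {t. 0 < t \<and> z \<in> (\<lambda>w. t *\<^sub>R w) ` S}"

section \<open>Holomorphic functions, germs and locally analytic functionals\<close>

(* Frechet differentiability with complex linear derivative *)
definition holo_on :: "(complex ^ 'n::finite) set \<Rightarrow> (complex ^ 'n \<Rightarrow> complex) \<Rightarrow> bool" where
  "holo_on U h \<longleftrightarrow>
     (\<forall>z\<in>U. \<exists>h'. (h has_derivative h') (at z) \<and> (\<forall>c v. h' (c *s v) = c * h' v))"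

definition holo_map_on ::
    "(complex ^ 'n::finite) set \<Rightarrow> (complex ^ 'n \<Rightarrow> complex ^ 'm::finite) \<Rightarrow> bool" where
  "holo_map_on U f \<longleftrightarrow> (\<forall>i. holo_on U (\<lambda>z. f z $ i))"

(* Representatives of the germs on S. *)
definition holo_near :: "(complex ^ 'n::finite) set \<Rightarrow> (complex ^ 'n \<Rightarrow> complex) set" where
  "holo_near S = {h. \<exists>U. open U \<and> S \<subseteq> U \<and> holo_on U h}"

definition same_germ ::
    "(complex ^ 'n::finite) set \<Rightarrow> (complex ^ 'n \<Rightarrow> complex) \<Rightarrow> (complex ^ 'n \<Rightarrow> complex) \<Rightarrow> bool" where
  "same_germ S g h \<longleftrightarrow> (\<exists>U. open U \<and> S \<subseteq> U \<and> (\<forall>z\<in>U. g z = h z))"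

type_synonym 'n functional = "(complex ^ 'n \<Rightarrow> complex) \<Rightarrow> complex"

(* The continuous dual of the space of germs on S.  A functional is given by its values on
   representatives of germs and is 0 by convention on all other functions, so that equality
   of functionals is equality in HOL.  A linear functional on the locally convex inductive
   limit is continuous iff its restriction to each O(U) is continuous for the topology of
   uniform convergence on compact subsets of U.  For S = UNIV this is the dual of the space
   of entire functions. *)
definition analytic_dual :: "(complex ^ 'n::finite) set \<Rightarrow> 'n functional set" where
  "analytic_dual S = {\<nu>.
     (\<forall>h. h \<notin> holo_near S \<longrightarrow> \<nu> h = 0) \<and>
     (\<forall>g\<in>holo_near S. \<forall>h\<in>holo_near S. same_germ S g h \<longrightarrow> \<nu> g = \<nu> h) \<and>
     (\<forall>g\<in>holo_near S. \<forall>h\<in>holo_near S. \<nu> (\<lambda>z. g z + h z) = \<nu> g + \<nu> h) \<and>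
     (\<forall>c. \<forall>h\<in>holo_near S. \<nu> (\<lambda>z. c * h z) = c * \<nu> h) \<and>
     (\<forall>U. open U \<and> S \<subseteq> U \<longrightarrow>
        (\<exists>L A. compact L \<and> L \<subseteq> U \<and>
           (\<forall>h B. holo_on U h \<and> 0 \<le> B \<and> (\<forall>z\<in>L. cmod (h z) \<le> B) \<longrightarrow> cmod (\<nu> h) \<le> A * B)))}"

definition push_forward ::
    "(complex ^ 'n::finite \<Rightarrow> complex ^ 'm::finite) \<Rightarrow> 'n functional \<Rightarrow> 'm functional" where
  "push_forward f \<nu> = (\<lambda>h. if h \<in> holo_near UNIV then \<nu> (h \<circ> f) else 0)"

(* The antilinear Fourier-Borel transform. *)
definition FB_bar :: "'n::finite functional \<Rightarrow> complex ^ 'n \<Rightarrow> complex" where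
  "FB_bar \<nu> \<zeta> = cnj (\<nu> (exp_fun \<zeta>))"

definition FB_bar_inv :: "(complex ^ 'n::finite) set \<Rightarrow> (complex ^ 'n \<Rightarrow> complex) \<Rightarrow> 'n functional" where
  "FB_bar_inv S = inv_into (analytic_dual S) FB_bar"

section \<open>Multi-indices and jets\<close>

definition mdeg :: "('n::finite \<Rightarrow> nat) \<Rightarrow> nat" where
  "mdeg a = (\<Sum>i\<in>UNIV. a i)"

definition mfact :: "('n::finite \<Rightarrow> nat) \<Rightarrow> nat" where
  "mfact a = (\<Prod>i\<in>UNIV. fact (a i))"

definition mpow :: "complex ^ 'n::finite \<Rightarrow> ('n \<Rightarrow> nat) \<Rightarrow> complex" where
  "mpow z a = (\<Prod>i\<in>UNIV. (z $ i) ^ a i)"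

definition cpartial :: "'n::finite \<Rightarrow> (complex ^ 'n \<Rightarrow> complex) \<Rightarrow> complex ^ 'n \<Rightarrow> complex" where
  "cpartial i h z = deriv (\<lambda>t. h (z + t *s axis i 1)) 0"

(* The partial derivatives are taken in some fixed order of the coordinates, which is
   immaterial for holomorphic functions. *)
definition mderiv :: "('n::finite \<Rightarrow> nat) \<Rightarrow> (complex ^ 'n \<Rightarrow> complex) \<Rightarrow> complex ^ 'n \<Rightarrow> complex" where
  "mderiv a h =
     foldr (\<lambda>i g. (cpartial i ^^ a i) g) (SOME is. distinct is \<and> set is = (UNIV :: 'n set)) h"

(* The span of the functionals mapping h to (mderiv a h) p, mdeg a <= n, inside
   analytic_dual S; here p is a point of S. *)
definition jet_functionals ::
    "(complex ^ 'n::finite) set \<Rightarrow> complex ^ 'n \<Rightarrow> nat \<Rightarrow> 'n functional set" where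
  "jet_functionals S p n = {\<nu>. \<exists>c. \<nu> = (\<lambda>h.
     if h \<in> holo_near S then \<Sum>a | mdeg a \<le> n. c a * mderiv a h p else 0)}"

(* Numberings start at 0, i.e. a i is the multi-index number i + 1.  The elementary vectors
   are listed along some enumeration e of the coordinates, since the index type 'n carries
   no preferred order. *)
definition graded_numbering :: "(nat \<Rightarrow> 'n::finite \<Rightarrow> nat) \<Rightarrow> bool" where
  "graded_numbering a \<longleftrightarrow>
     bij a \<and> a 0 = (\<lambda>_. 0) \<and>
     (\<exists>e. bij_betw e {1..CARD('n)} (UNIV :: 'n set) \<and>
        (\<forall>i\<in>{1..CARD('n)}. a i = (\<lambda>k. if k = e i then 1 else 0))) \<and>
     (\<forall>i j. i \<le> j \<longrightarrow> mdeg (a i) \<le> mdeg (a j))"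

(* the dimension of the space of polynomials of degree at most n in d variables *)
definition jet_dim :: "nat \<Rightarrow> nat \<Rightarrow> nat" where
  "jet_dim d n = (n + d) choose d"

(* Both u and v, according to the space and the numbering. *)
definition jet_basis ::
    "(nat \<Rightarrow> 'n::finite \<Rightarrow> nat) \<Rightarrow> complex ^ 'n \<Rightarrow> nat \<Rightarrow> complex ^ 'n \<Rightarrow> complex" where
  "jet_basis a p i z =
     complex_of_real (exp (- (norm p)\<^sup>2 / 2) / sqrt (real (mfact (a i)))) *
     mpow (z - p) (a i) * exp (herm z p)"

section \<open>Matrices\<close>

definition frobenius_norm :: "complex mat \<Rightarrow> real" where
  "frobenius_norm A = sqrt (\<Sum>i<dim_row A. \<Sum>j<dim_col A. (cmod (A $$ (i, j)))\<^sup>2)"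

definition pseudo_inverse :: "complex mat \<Rightarrow> complex mat" where
  "pseudo_inverse A = (THE X. X \<in> carrier_mat (dim_col A) (dim_row A) \<and>
     A * X * A = A \<and> X * A * X = X \<and>
     mat_adjoint (A * X) = A * X \<and> mat_adjoint (X * A) = X * A)"

(* Intended for Hermitian matrices, all of whose eigenvalues are real. *)
definition smallest_eigenvalue :: "complex mat \<Rightarrow> real" where
  "smallest_eigenvalue A = Min {l. eigenvalue A (complex_of_real l)}"

(* L (b j) is the sum of the C i j b' i, for bases b of length k and b' of length l *)
definition representation_matrix ::
    "('n::finite functional \<Rightarrow> 'm::finite functional) \<Rightarrow> nat \<Rightarrow> (nat \<Rightarrow> 'n functional) \<Rightarrow>
     nat \<Rightarrow> (nat \<Rightarrow> 'm functional) \<Rightarrow> complex mat \<Rightarrow> bool" where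
  "representation_matrix L k b l b' C \<longleftrightarrow>
     C \<in> carrier_mat l k \<and> (\<forall>j<k. L (b j) = (\<lambda>h. \<Sum>i<l. C $$ (i, j) * b' i h))"

(* Row number i is (u_1 (Z i), ..., u_{jet_dim d n} (Z i)). *)
definition jet_matrix ::
    "(nat \<Rightarrow> 'n::finite \<Rightarrow> nat) \<Rightarrow> complex ^ 'n \<Rightarrow> nat \<Rightarrow> nat \<Rightarrow> (nat \<Rightarrow> complex ^ 'n) \<Rightarrow> complex mat" where
  "jet_matrix a p n N Z = Matrix.mat N (jet_dim CARD('n) n) (\<lambda>(i, j). jet_basis a p j (Z i))"

(* With row vectors, the delta functional at z is the sum of the u_i(z) FB_bar_inv u_i (FB_bar
   is antilinear), so the representation matrix C of the push-forward satisfies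
   v(f z)^T = C u(z)^T to leading order.  The adjoints used here therefore make C_hat an
   estimator of the entrywise conjugate of C; it estimates C itself when f maps real points
   to real points, where all entries are real. *)
definition C_hat ::
    "(nat \<Rightarrow> 'd::finite \<Rightarrow> nat) \<Rightarrow> (nat \<Rightarrow> 'r::finite \<Rightarrow> nat) \<Rightarrow> (complex ^ 'd \<Rightarrow> complex ^ 'r) \<Rightarrow>
     complex ^ 'd \<Rightarrow> nat \<Rightarrow> nat \<Rightarrow> nat \<Rightarrow> (nat \<Rightarrow> complex ^ 'd) \<Rightarrow> complex mat" where
  "C_hat a b f p m n N Z =
     (let U = jet_matrix a p n N Z;
          V = jet_matrix b (f p) m N (\<lambda>i. f (Z i));
          A = mat_adjoint V * pseudo_inverse (mat_adjoint U)
      in Matrix.mat (jet_dim CARD('r) m) (jet_dim CARD('d) m) (\<lambda>(i, j). A $$ (i, j)))"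

section \<open>Measures\<close>

definition measure_support :: "'a::topological_space measure \<Rightarrow> 'a set" where
  "measure_support \<mu> = {x. \<forall>U. open U \<and> x \<in> U \<longrightarrow> emeasure \<mu> U > 0}"

definition moment_matrix ::
    "(nat \<Rightarrow> 'n::finite \<Rightarrow> nat) \<Rightarrow> nat \<Rightarrow> (complex ^ 'n) measure \<Rightarrow> complex mat" where
  "moment_matrix a n \<mu> = Matrix.mat (jet_dim CARD('n) n) (jet_dim CARD('n) n)
     (\<lambda>(i, j). \<integral>z. cnj (mpow z (a i)) * mpow z (a j) \<partial>\<mu>)"

definition empirical_measure :: "(nat \<Rightarrow> 'a::topological_space) \<Rightarrow> nat \<Rightarrow> 'a measure" where
  "empirical_measure x N = distr (uniform_count_measure {..<N}) borel x"

definition converges_weakly ::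
    "(nat \<Rightarrow> 'a::topological_space measure) \<Rightarrow> 'a measure \<Rightarrow> bool" where
  "converges_weakly \<mu>s \<mu> \<longleftrightarrow>
     (\<forall>g :: 'a \<Rightarrow> real. continuous_on UNIV g \<and> bounded (range g) \<longrightarrow>
        (\<lambda>N. \<integral>y. g y \<partial>(\<mu>s N)) \<longlonglongrightarrow> (\<integral>y. g y \<partial>\<mu>))"

end

theory Submission
  imports Defs "HOL-Complex_Analysis.Complex_Analysis"
begin

text \<open>
  Why the estimate holds. The functional that is dual to \<open>jet_basis a p i\<close> reads off the
  coefficient of \<open>jet_basis a p i\<close> in the expansion of a function at \<open>p\<close>; it is called
  \<open>jet_coeff\<close>. Its antilinear Fourier-Borel transform is \<open>jet_basis a p i\<close> itself, and the
  transform is injective, so \<open>jet_coeff\<close> is the basis in the theorem. Evaluating the push-forward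
  on the functions \<open>v i = jet_basis b (f p) i\<close>, to which the target basis is dual, shows that the
  entry \<open>(i, j)\<close> of the representation matrix is the coefficient of \<open>jet_basis a p j\<close> in the
  expansion of \<open>v i \<circ> f\<close> at \<open>p\<close> (\<open>representation_matrix_entry\<close>).

  Row \<open>i\<close> of the conjugated estimator solves the least squares problem of fitting the values of
  \<open>v i \<circ> f\<close> at the sample points by the functions \<open>jet_basis a p j\<close> of degree at most \<open>n\<close>
  (\<open>pseudo_inverse_normal_equations\<close>). The true coefficients fit these values up to the Taylor
  remainder, so by orthogonality the two fits differ at the sample points by at most this
  remainder (\<open>least_squares_error\<close>). It remains to bound the remainder from above, and from below
  the values of a combination of basis functions in terms of its coefficients.

  Upper bound. The function \<open>f\<close> is holomorphic on a neighbourhood of \<open>p + s K0\<close> for some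
  \<open>s > 1\<close>. A sample point \<open>p + w\<close> with \<open>w\<close> of gauge at most \<open>R\<close> is the value at \<open>t = 1\<close> of
  the line \<open>p + t w\<close>, along which everything is holomorphic for \<open>\<bar>t\<bar> < s / R\<close>. Cauchy's estimates
  make the remainder \<open>O((R / s)\<^sup>n)\<close>, with a constant independent of \<open>n\<close> (\<open>taylor_poly_remainder\<close>).
  The constant is also independent of \<open>m\<close>, because the sum of \<open>\<bar>v i\<bar>\<^sup>2\<close> over all \<open>i\<close> is locally
  bounded (\<open>sum_jet_basis_le\<close>) and the remainders of all \<open>v i \<circ> f\<close> are estimated together as one
  vector (\<open>taylor_poly_remainder_vector\<close>).

  Lower bound. Up to the non-vanishing factor \<open>exp (herm z p)\<close>, the basis functions are multiples
  of monomials in \<open>w\<close>. By weak convergence the averages of products of monomials over the sample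
  tend to the moments of \<open>\<mu>\<close>, hence the mean square of a polynomial over the sample is eventually
  at least half the smallest eigenvalue of the moment matrix times the square sum of its coefficients
  (\<open>eventually_empirical_lower_bound\<close>). That eigenvalue is positive, since the zero set of a
  non-zero polynomial is a Lebesgue null set (\<open>polynomial_zero_set_null\<close>). Passing from the
  coefficients with respect to monomials to those with respect to \<open>jet_basis a p j\<close> costs a
  factor of at most a constant times \<open>sqrt (fact m)\<close>, as only the columns of degree at most \<open>m\<close> enter.

  The analysis in several variables rests on two facts about complex Frechet differentiable
  functions: their partial derivatives are again of this kind (\<open>holo_on_cpartial\<close>), and a function
  that vanishes to order \<open>k\<close> at a point has vanishing derivatives of order less than \<open>k\<close> there
  (\<open>word_deriv_vanishing_order\<close>). The second fact identifies Taylor coefficients and takes the place of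
  product rules.
\<close>

(* Keep the dollar sign for component access. *)
unbundle no fps_syntax


section \<open>Taylor remainders in one variable\<close>

lemma cauchy_estimate_open_disc:
  fixes \<phi> :: "complex \<Rightarrow> complex"
  assumes hol: "\<phi> holomorphic_on ball 0 \<rho>" and \<rho>: "0 < \<rho>"
    and M: "\<And>t. t \<in> ball 0 \<rho> \<Longrightarrow> cmod (\<phi> t) \<le> M"
  shows "cmod ((deriv ^^ k) \<phi> 0) \<le> fact k * M / \<rho> ^ k"
proof (rule tendsto_lowerbound)
  show "((\<lambda>r. fact k * M / r ^ k) \<longlongrightarrow> fact k * M / \<rho> ^ k) (at_left \<rho>)"
    using \<rho> by (intro tendsto_intros) auto
  show "eventually (\<lambda>r. cmod ((deriv ^^ k) \<phi> 0) \<le> fact k * M / r ^ k) (at_left \<rho>)"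
    using eventually_at_left_real[OF \<rho>]
  proof eventually_elim
    case (elim r)
    show ?case
    proof (rule Cauchy_inequality)
      show "\<phi> holomorphic_on ball 0 r"
        using hol elim by (auto intro: holomorphic_on_subset)
      show "continuous_on (cball 0 r) \<phi>"
        using hol elim by (auto intro!: holomorphic_on_imp_continuous_on holomorphic_on_subset[OF hol])
    qed (use elim in \<open>auto intro!: M\<close>)
  qed
qed auto

text \<open>Cauchy's estimates bound the tail of the power series by a geometric series. The evaluation
  point is \<open>1\<close> because \<open>\<phi>\<close> will be the restriction of a function of several variables to a line
  \<open>t \<mapsto> z + t w\<close>; the radius \<open>\<rho>\<close> then measures how far the line can be prolonged beyond \<open>z + w\<close>.\<close>

lemma taylor_remainder_disc:
  fixes \<phi> :: "complex \<Rightarrow> complex"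
  assumes hol: "\<phi> holomorphic_on ball 0 \<rho>" and \<rho>: "1 < \<rho>"
    and M: "\<And>t. t \<in> ball 0 \<rho> \<Longrightarrow> cmod (\<phi> t) \<le> M"
  shows "cmod (\<phi> 1 - (\<Sum>k\<le>n. (deriv ^^ k) \<phi> 0 / fact k)) \<le> M * (1 / \<rho>) ^ Suc n / (1 - 1 / \<rho>)"
proof -
  define a where "a k = (deriv ^^ k) \<phi> 0 / fact k" for k
  have "(\<lambda>k. a k * (1 - 0) ^ k) sums \<phi> 1"
    unfolding a_def using \<rho> by (intro holomorphic_power_series[OF hol]) auto
  then have "a sums \<phi> 1" by simp
  then have "(\<lambda>k. a (k + Suc n)) sums (\<phi> 1 - (\<Sum>k<Suc n. a k))"
    by (simp only: sums_iff_shift'[of a "Suc n"])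
  then have s: "(\<lambda>k. a (k + Suc n)) sums (\<phi> 1 - (\<Sum>k\<le>n. a k))"
    by (simp only: lessThan_Suc_atMost)
  have b: "cmod (a k) \<le> M * (1 / \<rho>) ^ k" for k
    using cauchy_estimate_open_disc[OF hol _ M, of k] \<rho>
    by (simp add: a_def norm_divide field_simps)
  have g: "(\<lambda>k. M * (1 / \<rho>) ^ Suc n * (1 / \<rho>) ^ k) sums (M * (1 / \<rho>) ^ Suc n * (1 / (1 - 1 / \<rho>)))"
    using \<rho> by (intro sums_mult geometric_sums) auto
  have "cmod (\<Sum>k. a (k + Suc n)) \<le> (\<Sum>k. M * (1 / \<rho>) ^ Suc n * (1 / \<rho>) ^ k)"
  proof (rule norm_suminf_le)
    show "norm (a (k + Suc n)) \<le> M * (1 / \<rho>) ^ Suc n * (1 / \<rho>) ^ k" for k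
      using b[of "k + Suc n"] by (simp add: power_add algebra_simps)
  qed (use g in \<open>auto simp: sums_iff\<close>)
  then show ?thesis
    using s g by (simp add: sums_iff a_def)
qed

section \<open>Holomorphic functions of several variables\<close>

lemma continuous_on_compact_bound:
  fixes f :: "'a::topological_space \<Rightarrow> complex"
  assumes "continuous_on L f" "compact L"
  obtains B where "0 \<le> B" "\<And>y. y \<in> L \<Longrightarrow> cmod (f y) \<le> B"
proof -
  from compact_imp_bounded[OF compact_continuous_image[OF assms]] obtain B where
    "\<forall>y\<in>L. cmod (f y) \<le> B" by (auto simp: bounded_iff)
  then show ?thesis using that[of "max B 0"] by force
qed

lemma norm_smult_vec: "norm (c *s w) = cmod c * norm (w :: complex ^ 'n::finite)"
  by (simp add: norm_vec_def L2_set_def norm_mult power_mult_distrib sum_distrib_left[symmetric]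
      real_sqrt_mult)

lemma bounded_linear_smult_left: "bounded_linear (\<lambda>s::complex. s *s (w :: complex ^ 'n::finite))"
proof (rule bounded_linear_intro[where K = "norm w"])
  show "(x + y) *s w = x *s w + y *s w" for x y by (simp add: Finite_Cartesian_Product.vec_eq_iff algebra_simps)
  show "(r *\<^sub>R x) *s w = r *\<^sub>R (x *s w)" for r x by (simp add: Finite_Cartesian_Product.vec_eq_iff)
  show "norm (x *s w) \<le> norm x * norm w" for x by (simp add: norm_smult_vec)
qed

lemma smult_real: "complex_of_real r *s w = r *\<^sub>R (w :: complex ^ 'n::finite)"
  by (simp add: Finite_Cartesian_Product.vec_eq_iff scaleR_conv_of_real[symmetric])

lemma holo_onD:
  assumes "holo_on U h" "z \<in> U"
  obtains h' where "(h has_derivative h') (at z)" "\<And>c v. h' (c *s v) = c * h' v"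
  using assms by (auto simp: holo_on_def)

lemma holo_on_subset: "holo_on U h \<Longrightarrow> V \<subseteq> U \<Longrightarrow> holo_on V h"
  by (auto simp: holo_on_def)

lemma holo_on_continuous: "holo_on U h \<Longrightarrow> continuous_on U h"
  by (metis continuous_at_imp_continuous_on has_derivative_continuous holo_onD)

lemma has_derivative_line:
  fixes w :: "complex ^ 'n::finite"
  assumes d: "(h has_derivative h') (at (z + t *s w))" and l: "\<And>c v. h' (c *s v) = c * h' v"
  shows "((\<lambda>s. h (z + s *s w)) has_field_derivative h' w) (at t)"
proof -
  have "((\<lambda>s. z + s *s w) has_derivative (\<lambda>s. s *s w)) (at t)"
    using has_derivative_add[OF has_derivative_const
        bounded_linear_imp_has_derivative[OF bounded_linear_smult_left[of w]], of z "at t"] by simp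
  from has_derivative_compose[OF this d] show ?thesis
    by (simp add: l has_field_derivative_def mult.commute[of _ "h' w"])
qed

lemma holo_on_line:
  assumes "holo_on U h" "\<And>t. t \<in> T \<Longrightarrow> z + t *s w \<in> U"
  shows "(\<lambda>t. h (z + t *s w)) holomorphic_on T"
proof (rule holomorphic_onI)
  fix t assume "t \<in> T"
  then obtain h' where "(h has_derivative h') (at (z + t *s w))"
      "\<And>c v. h' (c *s v) = c * h' v"
    using holo_onD[OF assms(1) assms(2)] by metis
  from has_derivative_line[OF this]
  show "(\<lambda>t. h (z + t *s w)) field_differentiable at t within T"
    using field_differentiable_at_within field_differentiable_def by blast
qed

lemma has_derivative_eq_deriv_line:
  fixes w :: "complex ^ 'n::finite"
  assumes "(h has_derivative h') (at z)" and l: "\<And>c v. h' (c *s v) = c * h' v"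
  shows "h' w = deriv (\<lambda>t. h (z + t *s w)) 0"
  using has_derivative_line[of h h' z 0 w] assms by (simp add: DERIV_imp_deriv)

text \<open>On the line in direction \<open>w\<close> the function is holomorphic in a disc of radius \<open>r / norm w\<close>, so
  that the estimates for one variable apply with this radius. The point is that the constants only
  involve \<open>M\<close> and \<open>r\<close>.\<close>

lemma derivative_estimates_ball:
  fixes w :: "complex ^ 'n::finite"
  assumes h: "holo_on (ball z r) h" and M: "\<And>y. y \<in> ball z r \<Longrightarrow> cmod (h y) \<le> M"
    and r: "0 < r" 
  shows "cmod (deriv (\<lambda>t. h (z + t *s w)) 0) \<le> M / r * norm w"
    and "2 * norm w \<le> r \<Longrightarrow> cmod (h (z + w) - h z) \<le> 2 * M / r * norm w"
    and "2 * norm w \<le> r \<Longrightarrow>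
      cmod (h (z + w) - h z - deriv (\<lambda>t. h (z + t *s w)) 0) \<le> 2 * M / r\<^sup>2 * (norm w)\<^sup>2"
proof -
  have M0: "0 \<le> M" using M[of z] r by (auto intro: order_trans[OF norm_ge_zero])
  have *: "cmod (deriv (\<lambda>t. h (z + t *s w)) 0) \<le> M / r * norm w \<and>
    (2 * norm w \<le> r \<longrightarrow> cmod (h (z + w) - h z) \<le> 2 * M / r * norm w \<and>
      cmod (h (z + w) - h z - deriv (\<lambda>t. h (z + t *s w)) 0) \<le> 2 * M / r\<^sup>2 * (norm w)\<^sup>2)"
  proof (cases "w = 0")
    case False
    define \<phi> where "\<phi> t = h (z + t *s w)" for t
    define \<rho> where "\<rho> = r / norm w"
    have \<rho>: "0 < \<rho>" using r False by (simp add: \<rho>_def)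
    have in_ball: "z + t *s w \<in> ball z r" if "t \<in> ball 0 \<rho>" for t
      using that False by (simp add: \<rho>_def dist_norm norm_smult_vec field_simps)
    have hol: "\<phi> holomorphic_on ball 0 \<rho>"
      unfolding \<phi>_def by (rule holo_on_line[OF h in_ball])
    have bd: "cmod (\<phi> t) \<le> M" if "t \<in> ball 0 \<rho>" for t
      unfolding \<phi>_def by (rule M[OF in_ball[OF that]])
    have ir: "1 / \<rho> = norm w / r" using False by (simp add: \<rho>_def)
    have 1: "cmod (deriv \<phi> 0) \<le> M / r * norm w"
      using cauchy_estimate_open_disc[OF hol \<rho> bd, of 1] by (simp add: \<rho>_def)
    have 2: "cmod (h (z + w) - h z) \<le> 2 * M / r * norm w \<and>
      cmod (h (z + w) - h z - deriv \<phi> 0) \<le> 2 * M / r\<^sup>2 * (norm w)\<^sup>2" if small: "2 * norm w \<le> r"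
    proof -
      have \<rho>2: "2 \<le> \<rho>" using small False by (simp add: \<rho>_def field_simps)
      then have half: "1 / 2 \<le> 1 - 1 / \<rho>" by (simp add: field_simps)
      have gen: "M * (1 / \<rho>) ^ Suc n / (1 - 1 / \<rho>) \<le> M * (norm w / r) ^ Suc n / (1 / 2)" for n
        unfolding ir[symmetric] using M0 \<rho> half by (intro divide_left_mono mult_nonneg_nonneg) auto
      have "cmod (\<phi> 1 - \<phi> 0) \<le> M * (norm w / r) ^ Suc 0 / (1 / 2)"
        using taylor_remainder_disc[OF hol _ bd, of 0] \<rho>2 gen[of 0] by simp
      moreover have "cmod (\<phi> 1 - \<phi> 0 - deriv \<phi> 0) \<le> M * (norm w / r) ^ Suc 1 / (1 / 2)"
        using taylor_remainder_disc[OF hol _ bd, of 1] \<rho>2 gen[of 1] by (simp add: diff_diff_eq)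
      ultimately show ?thesis
        by (simp add: \<phi>_def power2_eq_square mult_ac)
    qed
    show ?thesis using 1 2 by (simp add: \<phi>_def[abs_def])
  qed auto
  then show "cmod (deriv (\<lambda>t. h (z + t *s w)) 0) \<le> M / r * norm w"
    and "2 * norm w \<le> r \<Longrightarrow> cmod (h (z + w) - h z) \<le> 2 * M / r * norm w"
    and "2 * norm w \<le> r \<Longrightarrow>
      cmod (h (z + w) - h z - deriv (\<lambda>t. h (z + t *s w)) 0) \<le> 2 * M / r\<^sup>2 * (norm w)\<^sup>2"
    by auto
qed

text \<open>The quadratic remainder estimate is uniform in \<open>n\<close>. Comparing two members of the sequence at
  \<open>z\<close> and at \<open>z + s w\<close> for small \<open>s\<close> therefore shows that their derivatives at \<open>z\<close> form
  a Cauchy sequence, and the limit of the derivatives satisfies the same remainder estimate.\<close>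

lemma bounded_pointwise_limit_complex_differentiable:
  fixes z :: "complex ^ 'n::finite"
  assumes r: "0 < r" and h: "\<And>n. holo_on (ball z r) (h n)"
    and M: "\<And>n y. y \<in> ball z r \<Longrightarrow> cmod (h n y) \<le> M"
    and lim: "\<And>y. y \<in> ball z r \<Longrightarrow> (\<lambda>n. h n y) \<longlonglongrightarrow> g y"
  shows "\<exists>g'. (g has_derivative g') (at z) \<and> (\<forall>c v. g' (c *s v) = c * g' v)"
proof -
  have M0: "0 \<le> M" using M[of z] r by (auto intro: order_trans[OF norm_ge_zero])
  obtain D where D: "\<And>n. (h n has_derivative D n) (at z)" "\<And>n c v. D n (c *s v) = c * D n v"
  proof -
    have "\<forall>n. \<exists>h'. (h n has_derivative h') (at z) \<and> (\<forall>c v. h' (c *s v) = c * h' v)"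
      using h r by (auto simp: holo_on_def)
    from choice[OF this] show ?thesis using that by blast
  qed
  have Deq: "D n w = deriv (\<lambda>t. h n (z + t *s w)) 0" for n w
    by (rule has_derivative_eq_deriv_line[OF D])
  have D1: "cmod (D n w) \<le> M / r * norm w" for n w
    unfolding Deq by (rule derivative_estimates_ball(1)[OF h M r]) 
  have D2: "cmod (h n (z + w) - h n z - D n w) \<le> 2 * M / r\<^sup>2 * (norm w)\<^sup>2" if "2 * norm w \<le> r" for n w
    unfolding Deq by (rule derivative_estimates_ball(3)[OF h M r that]) 
  have lin: "linear (D n)" for n
    using D(1) has_derivative_linear by blast
  have "Cauchy (\<lambda>n. D n w)" for w
  proof (rule metric_CauchyI)
    fix e :: real assume e: "0 < e"
    define K where "K = 1 + 4 * M / r\<^sup>2 * (norm w)\<^sup>2"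
    have K: "0 < K" unfolding K_def using M0 r by (intro add_pos_nonneg) auto
    (* The step s w stays in the ball of radius r / 2, and the two quadratic remainders, divided by s,
       contribute at most s K, which is at most e / 2. *)
    define s where "s = min (r / (2 * (norm w + 1))) (e / (2 * K))"
    have s: "0 < s" using r e K norm_ge_zero[of w] by (auto simp: s_def intro!: divide_pos_pos mult_pos_pos add_nonneg_pos)
    have "s * norm w \<le> r / (2 * (norm w + 1)) * (norm w + 1)"
      unfolding s_def using r by (intro mult_mono) auto
    also have "\<dots> = r / 2"
      using norm_ge_zero[of w] by (simp add: field_simps add_nonneg_eq_0_iff)
    finally have sw: "2 * (s * norm w) \<le> r" by simp
    then have small: "2 * norm (s *\<^sub>R w) \<le> r" using s by simp
    have inb: "z \<in> ball z r" "z + s *\<^sub>R w \<in> ball z r"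
      using r small by (auto simp: dist_norm)
    have cau: "Cauchy (\<lambda>n. h n (z + s *\<^sub>R w) - h n z)"
      by (rule LIMSEQ_imp_Cauchy[OF tendsto_diff[OF lim[OF inb(2)] lim[OF inb(1)]]])
    have "0 < s * e / 2" using s e by simp
    from metric_CauchyD[OF cau this] obtain N where
      N: "\<And>m n. m \<ge> N \<Longrightarrow> n \<ge> N \<Longrightarrow> dist (h m (z + s *\<^sub>R w) - h m z) (h n (z + s *\<^sub>R w) - h n z) < s * e / 2"
      by blast
    have "dist (D m w) (D n w) < e" if "m \<ge> N" "n \<ge> N" for m n
    proof -
      have sc: "D n (s *\<^sub>R w) = s *\<^sub>R D n w" for n using lin[of n] by (rule linear_cmul)
      let ?a = "\<lambda>n. h n (z + s *\<^sub>R w) - h n z"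
      have "s * cmod (D m w - D n w) = cmod (D m (s *\<^sub>R w) - D n (s *\<^sub>R w))"
        using s by (simp add: sc flip: scaleR_diff_right)
      also have "\<dots> = cmod ((?a m - ?a n) - (?a m - D m (s *\<^sub>R w)) + (?a n - D n (s *\<^sub>R w)))"
        by (simp add: algebra_simps)
      also have "\<dots> \<le> cmod (?a m - ?a n) + cmod (?a m - D m (s *\<^sub>R w)) + cmod (?a n - D n (s *\<^sub>R w))"
        by (intro order_trans[OF norm_triangle_ineq] add_right_mono norm_triangle_ineq4)
      also have "\<dots> \<le> cmod (?a m - ?a n) + 2 * M / r\<^sup>2 * (norm (s *\<^sub>R w))\<^sup>2 + 2 * M / r\<^sup>2 * (norm (s *\<^sub>R w))\<^sup>2"
        by (intro add_mono D2 small order_refl)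
      also have "\<dots> < s * e / 2 + 4 * M / r\<^sup>2 * (norm (s *\<^sub>R w))\<^sup>2"
        using N[OF that] by (simp add: dist_norm)
      also have "\<dots> = s * (e / 2 + s * (4 * M / r\<^sup>2 * (norm w)\<^sup>2))"
        by (simp add: power_mult_distrib power2_eq_square[of s] algebra_simps)
      also have "\<dots> \<le> s * (e / 2 + (e / (2 * K)) * K)"
        using s M0 e K r unfolding s_def K_def by (intro mult_left_mono add_left_mono mult_mono) auto
      also have "\<dots> = s * e" using K by simp
      finally show ?thesis using s by (simp add: dist_norm)
    qed
    then show "\<exists>N. \<forall>m\<ge>N. \<forall>n\<ge>N. dist (D m w) (D n w) < e" by blast
  qed
  then obtain G where G: "\<And>w. (\<lambda>n. D n w) \<longlonglongrightarrow> G w"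
  proof -
    have "\<forall>w. \<exists>l. (\<lambda>n. D n w) \<longlonglongrightarrow> l"
      using Cauchy_convergent[OF \<open>\<And>w. Cauchy (\<lambda>n. D n w)\<close>] by (simp add: convergent_def)
    from choice[OF this] show ?thesis using that by blast
  qed
  have blG: "bounded_linear G"
  proof (rule bounded_linear_intro[where K = "M / r"])
    show "G (x + y) = G x + G y" for x y
      using LIMSEQ_unique[OF G[of "x + y"]] tendsto_add[OF G[of x] G[of y]]
      by (simp add: linear_add[OF lin])
    show "G (c *\<^sub>R x) = c *\<^sub>R G x" for c x
      using LIMSEQ_unique[OF G[of "c *\<^sub>R x"]] tendsto_scaleR[OF tendsto_const G[of x]]
      by (simp add: linear_cmul[OF lin])
    show "norm (G x) \<le> norm x * (M / r)" for x
      by (rule LIMSEQ_le_const2[OF tendsto_norm[OF G[of x]]]) (use D1 in \<open>auto simp: mult.commute\<close>)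
  qed
  have Gs: "G (c *s v) = c * G v" for c v
    using LIMSEQ_unique[OF G[of "c *s v"]] tendsto_mult[OF tendsto_const G[of v]]
    by (simp add: D(2))
  have est: "cmod (g (z + w) - g z - G w) \<le> 2 * M / r\<^sup>2 * (norm w)\<^sup>2" if "2 * norm w \<le> r" for w
  proof (rule LIMSEQ_le_const2[OF tendsto_norm])
    have "z \<in> ball z r" "z + w \<in> ball z r"
      using r that by (auto simp: dist_norm)
    then show "(\<lambda>n. h n (z + w) - h n z - D n w) \<longlonglongrightarrow> g (z + w) - g z - G w"
      by (intro tendsto_diff lim G) 
  qed (use D2 that in auto)
  have "(g has_derivative G) (at z)"
  proof (rule has_derivativeI_sandwich[where e = "r / 2" and H = "\<lambda>y. 2 * M / r\<^sup>2 * norm (y - z)"])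
    show "norm (g y - g z - G (y - z)) / norm (y - z) \<le> 2 * M / r\<^sup>2 * norm (y - z)"
      if "y \<noteq> z" "dist y z < r / 2" for y
      using est[of "y - z"] that by (simp add: dist_norm field_simps power2_eq_square)
    show "((\<lambda>y. 2 * M / r\<^sup>2 * norm (y - z)) \<longlongrightarrow> 0) (at z)"
    proof -
      have "((\<lambda>y. 2 * M / r\<^sup>2 * norm (y - z)) \<longlongrightarrow> 2 * M / r\<^sup>2 * norm (z - z)) (at z)"
        by (intro tendsto_intros)
      then show ?thesis by simp
    qed
  qed (use r blG in auto)
  with Gs show ?thesis by blast
qed

lemma cpartial_eq:
  assumes "(h has_derivative h') (at z)" "\<And>c v. h' (c *s v) = c * h' v"
  shows "cpartial i h z = h' (axis i 1)"
  unfolding cpartial_def by (rule has_derivative_eq_deriv_line[OF assms, symmetric])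

text \<open>A partial derivative is the pointwise limit of difference quotients, which are holomorphic and
  locally bounded by Cauchy's estimate.\<close>

lemma holo_on_cpartial:
  fixes h :: "complex ^ 'n::finite \<Rightarrow> complex"
  assumes U: "open U" and h: "holo_on U h"
  shows "holo_on U (cpartial i h)"
  unfolding holo_on_def
proof
  fix z assume "z \<in> U"
  then obtain R where R: "0 < R" "cball z R \<subseteq> U"
    using U open_contains_cball by blast
  define r where "r = R / 2"
  have r: "0 < r" using R by (simp add: r_def)
  obtain M where M0: "0 \<le> M" and M: "\<And>y. y \<in> cball z R \<Longrightarrow> cmod (h y) \<le> M"
    by (rule continuous_on_compact_bound[OF holo_on_continuous[OF holo_on_subset[OF h R(2)]] compact_cball])
      (rule that)
  (* increments of size at most r / 2, so that both points of the quotient stay in the ball of radius R *)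
  define t where "t n = complex_of_real (r / 2 * (1 / real (Suc n)))" for n
  have t0: "t n \<noteq> 0" for n
    unfolding t_def of_real_eq_0_iff using r by simp
  have tr: "2 * cmod (t n) \<le> r" for n
    unfolding t_def norm_of_real using r by (simp add: field_simps)
  have tlim: "t \<longlonglongrightarrow> 0"
  proof -
    have "(\<lambda>n. r / 2 * (1 / real (Suc n))) \<longlonglongrightarrow> r / 2 * 0"
      by (intro tendsto_mult tendsto_const LIMSEQ_inverse_real_of_nat[unfolded inverse_eq_divide])
    from tendsto_of_real[OF this, where 'a = complex] show ?thesis by (simp add: t_def[abs_def])
  qed
  let ?e = "axis i 1 :: complex ^ 'n"
  have ne: "norm ?e = 1" by simp
  define q where "q n y = (h (y + t n *s ?e) - h y) / t n" for n y
  have sub: "ball y r \<subseteq> cball z R" if "y \<in> ball z r" for y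
  proof
    fix x assume "x \<in> ball y r"
    then show "x \<in> cball z R"
      using that dist_triangle[of z x y] by (simp add: r_def)
  qed
  show "\<exists>h'. (cpartial i h has_derivative h') (at z) \<and> (\<forall>c v. h' (c *s v) = c * h' v)"
  proof (rule bounded_pointwise_limit_complex_differentiable[OF r, where h = q])
    show "holo_on (ball z r) (q n)" for n
      unfolding holo_on_def
    proof
      fix y assume y: "y \<in> ball z r"
      have nt: "norm (t n *s ?e) < r" using tr[of n] t0[of n] ne r by (simp add: norm_smult_vec)
      have yU: "y \<in> U" "y + t n *s ?e \<in> U"
        using y sub[OF y] nt R r by (auto simp: dist_norm subset_iff)
      obtain a where a: "(h has_derivative a) (at y)" "\<And>c v. a (c *s v) = c * a v"
        using h yU(1) by (rule holo_onD) blast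
      obtain b where b: "(h has_derivative b) (at (y + t n *s ?e))" "\<And>c v. b (c *s v) = c * b v"
        using h yU(2) by (rule holo_onD) blast
      have "((\<lambda>x. x + t n *s ?e) has_derivative (\<lambda>x. x)) (at y)"
        by (auto intro!: derivative_eq_intros)
      from has_derivative_compose[OF this b(1)]
      have "(q n has_derivative (\<lambda>v. (b v - a v) / t n)) (at y)"
        unfolding q_def[abs_def] divide_inverse
        by (intro has_derivative_mult_left has_derivative_diff a(1)) 
      moreover have "(b (c *s v) - a (c *s v)) / t n = c * ((b v - a v) / t n)" for c v
        by (simp add: a b algebra_simps)
      ultimately show "\<exists>h'. (q n has_derivative h') (at y) \<and> (\<forall>c v. h' (c *s v) = c * h' v)"
        by blast
    qed
    show "cmod (q n y) \<le> 2 * M / r" if y: "y \<in> ball z r" for n y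
    proof -
      have "cmod (h (y + t n *s ?e) - h y) \<le> 2 * M / r * norm (t n *s ?e)"
      proof (rule derivative_estimates_ball(2))
        show "holo_on (ball y r) h" using holo_on_subset[OF h] sub[OF y] R by blast
        show "2 * norm (t n *s ?e) \<le> r" using tr[of n] ne by (simp add: norm_smult_vec)
      qed (use M sub[OF y] r in auto)
      then show ?thesis using t0[of n] ne by (simp add: q_def norm_divide norm_smult_vec field_simps)
    qed
    show "(\<lambda>n. q n y) \<longlonglongrightarrow> cpartial i h y" if y: "y \<in> ball z r" for y
    proof -
      have "y \<in> U" using y sub[OF y] R r by (auto simp: subset_iff)
      with h obtain a where a: "(h has_derivative a) (at y)" "\<And>c v. a (c *s v) = c * a v"
        unfolding holo_on_def by blast
      have "((\<lambda>s. h (y + s *s ?e)) has_field_derivative a ?e) (at 0)"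
        using has_derivative_line[of h a y 0 ?e] a by simp
      then have "((\<lambda>s. (h (y + s *s ?e) - h y) / s) \<longlongrightarrow> a ?e) (at 0)"
        by (simp add: DERIV_def)
      moreover have "filterlim t (at 0) sequentially"
        using tlim t0 by (auto simp: filterlim_at)
      ultimately have "(\<lambda>n. q n y) \<longlonglongrightarrow> a ?e"
        unfolding q_def by (rule filterlim_compose)
      then show ?thesis by (simp add: cpartial_eq[OF a])
    qed
  qed
qed

lemma holo_on_const: "holo_on U (\<lambda>z. c)"
  unfolding holo_on_def by (intro ballI exI[of _ "\<lambda>_. 0"]) auto

lemma holo_on_add:
  assumes "holo_on U g" "holo_on U h" shows "holo_on U (\<lambda>z. g z + h z)"
  unfolding holo_on_def
proof
  fix z assume z: "z \<in> U"
  obtain a where a: "(g has_derivative a) (at z)" "\<And>c v. a (c *s v) = c * a v"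
    using assms(1) z by (rule holo_onD) blast
  obtain b where b: "(h has_derivative b) (at z)" "\<And>c v. b (c *s v) = c * b v"
    using assms(2) z by (rule holo_onD) blast
  show "\<exists>h'. ((\<lambda>z. g z + h z) has_derivative h') (at z) \<and> (\<forall>c v. h' (c *s v) = c * h' v)"
    using has_derivative_add[OF a(1) b(1)]
    by (intro exI[of _ "\<lambda>v. a v + b v"]) (simp add: a b algebra_simps)
qed

lemma holo_on_mult:
  assumes "holo_on U g" "holo_on U h" shows "holo_on U (\<lambda>z. g z * h z)"
  unfolding holo_on_def
proof
  fix z assume z: "z \<in> U"
  obtain a where a: "(g has_derivative a) (at z)" "\<And>c v. a (c *s v) = c * a v"
    using assms(1) z by (rule holo_onD) blast
  obtain b where b: "(h has_derivative b) (at z)" "\<And>c v. b (c *s v) = c * b v"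
    using assms(2) z by (rule holo_onD) blast
  show "\<exists>h'. ((\<lambda>z. g z * h z) has_derivative h') (at z) \<and> (\<forall>c v. h' (c *s v) = c * h' v)"
    using has_derivative_mult[OF a(1) b(1)] by (auto simp: a b algebra_simps)
qed

lemma holo_on_sum: "(\<And>i. i \<in> A \<Longrightarrow> holo_on U (g i)) \<Longrightarrow> holo_on U (\<lambda>z. \<Sum>i\<in>A. g i z)"
  by (induction A rule: infinite_finite_induct) (auto intro: holo_on_const holo_on_add)

lemma holo_on_prod: "(\<And>i. i \<in> A \<Longrightarrow> holo_on U (g i)) \<Longrightarrow> holo_on U (\<lambda>z. \<Prod>i\<in>A. g i z)"
  by (induction A rule: infinite_finite_induct) (auto intro: holo_on_const holo_on_mult)

lemma holo_on_power: "holo_on U g \<Longrightarrow> holo_on U (\<lambda>z. g z ^ n)"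
  by (induction n) (auto intro: holo_on_const holo_on_mult)

lemma holo_on_diff:
  assumes "holo_on U g" "holo_on U h" shows "holo_on U (\<lambda>z. g z - h z)"
  using holo_on_add[OF assms(1) holo_on_mult[OF holo_on_const[of U "-1"] assms(2)]] by simp

lemma holo_on_nth: "holo_on U (\<lambda>z. z $ i)"
  unfolding holo_on_def
  by (intro ballI exI[of _ "\<lambda>z. z $ i"])
     (auto intro!: bounded_linear_imp_has_derivative bounded_linear_vec_nth)

lemma holo_on_exp:
  assumes "holo_on U g" shows "holo_on U (\<lambda>z. exp (g z))"
  unfolding holo_on_def
proof
  fix z assume z: "z \<in> U"
  obtain a where a: "(g has_derivative a) (at z)" "\<And>c v. a (c *s v) = c * a v"
    using assms(1) z by (rule holo_onD) blast
  have "(exp has_derivative (*) (exp (g z))) (at (g z))"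
    using DERIV_exp[of "g z"] by (simp add: has_field_derivative_def)
  from has_derivative_compose[OF a(1) this]
  show "\<exists>h'. ((\<lambda>z. exp (g z)) has_derivative h') (at z) \<and> (\<forall>c v. h' (c *s v) = c * h' v)"
    by (auto simp: a algebra_simps)
qed

lemma holo_on_mpow: "holo_on U (\<lambda>z. mpow (z - p) \<gamma>)"
  unfolding mpow_def vector_minus_component
  by (intro holo_on_prod holo_on_power holo_on_diff holo_on_nth holo_on_const)

lemma holo_on_exp_herm: "holo_on U (\<lambda>z. exp (herm (z - p) \<zeta>))"
  unfolding herm_def vector_minus_component
  by (intro holo_on_exp holo_on_sum holo_on_mult holo_on_diff holo_on_nth holo_on_const)

lemma holo_on_compose:
  fixes f :: "complex ^ 'n::finite \<Rightarrow> complex ^ 'm::finite"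
  assumes f: "holo_map_on U f" and h: "holo_on V h" and fUV: "f ` U \<subseteq> V"
  shows "holo_on U (\<lambda>z. h (f z))"
  unfolding holo_on_def
proof
  fix z assume z: "z \<in> U"
  have "\<forall>i. \<exists>a. ((\<lambda>z. f z $ i) has_derivative a) (at z) \<and> (\<forall>c v. a (c *s v) = c * a v)"
    using f z by (auto simp: holo_map_on_def holo_on_def)
  from choice[OF this] obtain a where
    a: "\<And>i. ((\<lambda>z. f z $ i) has_derivative a i) (at z)" "\<And>i c v. a i (c *s v) = c * a i v"
    by blast
  have "z \<in> U \<Longrightarrow> f z \<in> V" using fUV by blast
  with h z obtain b where b: "(h has_derivative b) (at (f z))" "\<And>c v. b (c *s v) = c * b v"
    unfolding holo_on_def by blast
  have "((\<lambda>z. \<Sum>i\<in>UNIV. (f z $ i) *s axis i 1) has_derivative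
      (\<lambda>v. \<Sum>i\<in>UNIV. a i v *s axis i 1)) (at z)"
    by (intro has_derivative_sum bounded_linear.has_derivative[OF bounded_linear_smult_left] a(1))
  moreover have "(\<Sum>i\<in>UNIV. a i v *s axis i 1) = (\<chi> i. a i v)" for v
    using basis_expansion[of "\<chi> i. a i v"] by simp
  ultimately have d: "(f has_derivative (\<lambda>v. \<chi> i. a i v)) (at z)"
    by (simp add: basis_expansion)
  have "(\<chi> i. a i (c *s v)) = c *s (\<chi> i. a i v)" for c v
    by (simp add: a Finite_Cartesian_Product.vec_eq_iff)
  then show "\<exists>h'. ((\<lambda>z. h (f z)) has_derivative h') (at z) \<and> (\<forall>c v. h' (c *s v) = c * h' v)"
    using has_derivative_compose[OF d b(1)] by (auto simp: b)
qed

section \<open>Iterated partial derivatives\<close>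

lemma cpartial_cong:
  assumes "open U" "z \<in> U" "\<And>y. y \<in> U \<Longrightarrow> g y = h y"
  shows "cpartial i g z = cpartial i h z"
  unfolding cpartial_def
proof (rule deriv_cong_ev)
  have "isCont (\<lambda>t::complex. z + t *s axis i 1) 0"
    by (intro continuous_intros bounded_linear.isCont[OF bounded_linear_smult_left])
  moreover have "z + 0 *s axis i 1 \<in> U" using assms by simp
  ultimately have "eventually (\<lambda>t. z + t *s axis i 1 \<in> U) (at 0)"
    using \<open>open U\<close> by (simp add: isCont_def topological_tendstoD)
  then have "eventually (\<lambda>t. z + t *s axis i 1 \<in> U) (nhds 0)"
    using assms(2) by (simp add: eventually_nhds_conv_at)
  then show "eventually (\<lambda>t. g (z + t *s axis i 1) = h (z + t *s axis i 1)) (nhds 0)"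
    by eventually_elim (rule assms(3))
qed simp

lemma cpartial_add:
  assumes "holo_on U g" "holo_on U h" "z \<in> U"
  shows "cpartial i (\<lambda>z. g z + h z) z = cpartial i g z + cpartial i h z"
proof -
  obtain a where a: "(g has_derivative a) (at z)" "\<And>c v. a (c *s v) = c * a v"
    using assms(1,3) by (rule holo_onD) blast
  obtain b where b: "(h has_derivative b) (at z)" "\<And>c v. b (c *s v) = c * b v"
    using assms(2,3) by (rule holo_onD) blast
  have "cpartial i (\<lambda>z. g z + h z) z = a (axis i 1) + b (axis i 1)"
    by (rule cpartial_eq[OF has_derivative_add[OF a(1) b(1)]]) (simp add: a b algebra_simps)
  then show ?thesis by (simp add: cpartial_eq[OF a] cpartial_eq[OF b])
qed

lemma cpartial_cmult:
  assumes "holo_on U h" "z \<in> U"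
  shows "cpartial i (\<lambda>z. c * h z) z = c * cpartial i h z"
proof -
  obtain b where b: "(h has_derivative b) (at z)" "\<And>c v. b (c *s v) = c * b v"
    using assms by (rule holo_onD) blast
  have "cpartial i (\<lambda>z. c * h z) z = c * b (axis i 1)"
    by (rule cpartial_eq[OF has_derivative_mult_right[OF b(1), of c]]) (simp add: b)
  then show ?thesis by (simp add: cpartial_eq[OF b])
qed

text \<open>A word of coordinates stands for the corresponding iterated partial derivative; the
  multi-index derivatives are those of sorted words, so that statements about them can be
  proved by induction on the word.\<close>

definition word_deriv :: "'n::finite list \<Rightarrow> (complex ^ 'n \<Rightarrow> complex) \<Rightarrow> complex ^ 'n \<Rightarrow> complex" where
  "word_deriv is h = foldr cpartial is h"

lemma word_deriv_simps [simp]: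
  "word_deriv [] h = h" "word_deriv (i # is) h = cpartial i (word_deriv is h)"
  by (simp_all add: word_deriv_def)

lemma word_deriv_append: "word_deriv (is @ js) h = word_deriv is (word_deriv js h)"
  by (simp add: word_deriv_def)

lemma word_deriv_replicate: "word_deriv (replicate n i) h = (cpartial i ^^ n) h"
  by (induction n) auto

definition coord_order :: "'n::finite list" where
  "coord_order = (SOME is. distinct is \<and> set is = (UNIV :: 'n set))"

lemma coord_order: "distinct (coord_order :: 'n::finite list)" "set coord_order = (UNIV :: 'n set)"
  using someI_ex[of "\<lambda>is. distinct is \<and> set is = (UNIV :: 'n set)"]
    finite_distinct_list[of "UNIV :: 'n set"]
  unfolding coord_order_def by auto

lemma mderiv_foldr: "mderiv a h = foldr (\<lambda>i g. (cpartial i ^^ a i) g) coord_order h"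
  by (simp add: mderiv_def coord_order_def)

definition sorted_word :: "('n::finite \<Rightarrow> nat) \<Rightarrow> 'n list" where
  "sorted_word a = concat (map (\<lambda>i. replicate (a i) i) coord_order)"

lemma mderiv_word: "mderiv a h = word_deriv (sorted_word a) h"
proof -
  have "foldr (\<lambda>i g. (cpartial i ^^ a i) g) is h =
      word_deriv (concat (map (\<lambda>i. replicate (a i) i) is)) h" for "is"
    by (induction "is") (auto simp: word_deriv_append word_deriv_replicate)
  then show ?thesis by (simp add: mderiv_foldr sorted_word_def)
qed

lemma length_sorted_word: "length (sorted_word a) = mdeg a"
proof -
  have "length (sorted_word a) = sum_list (map a coord_order)"
    by (simp add: sorted_word_def length_concat o_def)
  also have "\<dots> = mdeg a"
    using sum_list_distinct_conv_sum_set[OF coord_order(1), of a]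
    by (simp add: mdeg_def coord_order(2))
  finally show ?thesis .
qed

lemma holo_on_word_deriv: "open U \<Longrightarrow> holo_on U h \<Longrightarrow> holo_on U (word_deriv is h)"
  by (induction "is") (auto intro: holo_on_cpartial)

lemma word_deriv_cong:
  assumes "open U" "\<And>y. y \<in> U \<Longrightarrow> g y = h y" "z \<in> U"
  shows "word_deriv is g z = word_deriv is h z"
  using assms(3) by (induction "is" arbitrary: z) (auto simp: assms intro: cpartial_cong[OF assms(1)])

lemma word_deriv_add:
  assumes U: "open U" and gh: "holo_on U g" "holo_on U h" and z: "z \<in> U"
  shows "word_deriv is (\<lambda>z. g z + h z) z = word_deriv is g z + word_deriv is h z"
  using z
proof (induction "is" arbitrary: z)
  case (Cons i "is")
  have "word_deriv (i # is) (\<lambda>z. g z + h z) z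
      = cpartial i (\<lambda>z. word_deriv is g z + word_deriv is h z) z"
    using Cons by (auto intro: cpartial_cong[OF U])
  also have "\<dots> = word_deriv (i # is) g z + word_deriv (i # is) h z"
    using Cons.prems by (simp add: cpartial_add[OF holo_on_word_deriv[OF U gh(1)] holo_on_word_deriv[OF U gh(2)]])
  finally show ?case .
qed simp

lemma word_deriv_cmult:
  assumes U: "open U" and h: "holo_on U h" and z: "z \<in> U"
  shows "word_deriv is (\<lambda>z. c * h z) z = c * word_deriv is h z"
  using z
proof (induction "is" arbitrary: z)
  case (Cons i "is")
  have "word_deriv (i # is) (\<lambda>z. c * h z) z = cpartial i (\<lambda>z. c * word_deriv is h z) z"
    using Cons by (auto intro: cpartial_cong[OF U])
  also have "\<dots> = c * word_deriv (i # is) h z"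
    using Cons.prems by (simp add: cpartial_cmult[OF holo_on_word_deriv[OF U h]])
  finally show ?case .
qed simp

lemma word_deriv_sum:
  assumes U: "open U" and g: "\<And>x. x \<in> A \<Longrightarrow> holo_on U (g x)" and z: "z \<in> U" and A: "finite A"
  shows "word_deriv is (\<lambda>z. \<Sum>x\<in>A. g x z) z = (\<Sum>x\<in>A. word_deriv is (g x) z)"
  using A g
proof (induction A)
  case empty
  have "word_deriv is (\<lambda>z. 0 * 0) z = 0 * word_deriv is (\<lambda>z. 0) z"
    by (rule word_deriv_cmult[OF U holo_on_const z])
  then show ?case by simp
next
  case (insert x A)
  then have "word_deriv is (\<lambda>z. g x z + (\<Sum>x\<in>A. g x z)) z
      = word_deriv is (g x) z + word_deriv is (\<lambda>z. \<Sum>x\<in>A. g x z) z"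
    by (intro word_deriv_add[OF U _ _ z] holo_on_sum) auto
  with insert show ?case by simp
qed

text \<open>Cauchy's estimate, once per derivative, each time on a ball of radius \<open>\<epsilon>\<close>.\<close>

lemma cpartial_bound:
  assumes "holo_on (ball z \<epsilon>) h" "\<And>y. y \<in> ball z \<epsilon> \<Longrightarrow> cmod (h y) \<le> M" "0 < \<epsilon>"
  shows "cmod (cpartial i h z) \<le> M / \<epsilon>"
  using derivative_estimates_ball(1)[OF assms, of "axis i 1"] by (simp add: cpartial_def)

lemma word_deriv_bound:
  fixes \<epsilon> :: real
  assumes h: "holo_on (ball p r) h" and M: "\<And>y. y \<in> ball p r \<Longrightarrow> cmod (h y) \<le> M" and \<epsilon>: "0 < \<epsilon>"
    and z: "z \<in> ball p (r - length is * \<epsilon>)"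
  shows "cmod (word_deriv is h z) \<le> M / \<epsilon> ^ length is"
  using z
proof (induction "is" arbitrary: z)
  case (Cons i "is")
  have "y \<in> ball p (r - length is * \<epsilon>)" if "y \<in> ball z \<epsilon>" for y
    using that Cons.prems dist_triangle[of p y z] by (simp add: algebra_simps)
  moreover have "ball p (r - length is * \<epsilon>) \<subseteq> ball p r" using \<epsilon> by (intro subset_ball) simp
  ultimately have "cmod (cpartial i (word_deriv is h) z) \<le> (M / \<epsilon> ^ length is) / \<epsilon>"
    by (intro cpartial_bound[OF _ _ \<epsilon>] holo_on_subset[OF holo_on_word_deriv[OF open_ball h]] Cons.IH)
       auto
  then show ?case by (simp add: field_simps)
qed (use M in simp)

text \<open>Each derivative costs one order of vanishing: Cauchy's estimate on the ball of radius \<open>\<epsilon>\<close>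
  about a point of \<open>ball p \<epsilon>\<close>, which is contained in \<open>ball p (2 * \<epsilon>)\<close>, divides the bound by
  \<open>\<epsilon>\<close>. Bounds on balls rather than at points let the induction treat \<open>p\<close> like its neighbours.\<close>

lemma word_deriv_vanishes:
  assumes h: "holo_on (ball p r) h" and r: "0 < r"
    and M: "\<And>\<epsilon> y. 0 < \<epsilon> \<Longrightarrow> \<epsilon> < r \<Longrightarrow> y \<in> ball p \<epsilon> \<Longrightarrow> cmod (h y) \<le> M * \<epsilon> ^ k"
    and len: "length is < k"
  shows "word_deriv is h p = 0"
proof -
  have "\<exists>M' r'. 0 < r' \<and> r' \<le> r \<and> (\<forall>\<epsilon> y. 0 < \<epsilon> \<and> \<epsilon> < r' \<and> y \<in> ball p \<epsilon> \<longrightarrow>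
      cmod (word_deriv is h y) \<le> M' * \<epsilon> ^ (k - length is))"
    using len
  proof (induction "is")
    case (Cons i "is")
    then obtain M' r' where r': "0 < r'" "r' \<le> r" and IH: "\<And>\<epsilon> y. 0 < \<epsilon> \<Longrightarrow> \<epsilon> < r' \<Longrightarrow> y \<in> ball p \<epsilon> \<Longrightarrow>
      cmod (word_deriv is h y) \<le> M' * \<epsilon> ^ (k - length is)" by auto
    define j where "j = k - length (i # is)"
    have j: "k - length is = Suc j" using Cons.prems by (auto simp: j_def)
    have "cmod (word_deriv (i # is) h y) \<le> (M' * 2 ^ Suc j) * \<epsilon> ^ j"
      if \<epsilon>: "0 < \<epsilon>" "\<epsilon> < r' / 2" and y: "y \<in> ball p \<epsilon>" for \<epsilon> y
    proof -
      have sub: "ball y \<epsilon> \<subseteq> ball p (2 * \<epsilon>)"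
      proof
        fix x assume "x \<in> ball y \<epsilon>"
        then show "x \<in> ball p (2 * \<epsilon>)" using y dist_triangle[of p x y] by simp
      qed
      have "ball p (2 * \<epsilon>) \<subseteq> ball p r" using \<epsilon> r' by (intro subset_ball) simp
      then have "cmod (cpartial i (word_deriv is h) y) \<le> (M' * (2 * \<epsilon>) ^ Suc j) / \<epsilon>"
        using sub \<epsilon> IH[of "2 * \<epsilon>"] unfolding j
        by (intro cpartial_bound holo_on_subset[OF holo_on_word_deriv[OF open_ball h]]) auto
      then show ?thesis using \<epsilon> by (simp add: power_mult_distrib field_simps)
    qed
    then show ?case
      using r' unfolding j_def by (intro exI[of _ "M' * 2 ^ Suc j"] exI[of _ "r' / 2"]) (auto simp: j_def)
  qed (use M r in auto)
  then obtain M' r' where r': "0 < r'" and b: "\<And>\<epsilon>. 0 < \<epsilon> \<Longrightarrow> \<epsilon> < r' \<Longrightarrow>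
      cmod (word_deriv is h p) \<le> M' * \<epsilon> ^ (k - length is)" by force
  have "cmod (word_deriv is h p) \<le> 0"
  proof (rule tendsto_lowerbound)
    have "((\<lambda>\<epsilon>::real. M' * \<epsilon> ^ (k - length is)) \<longlongrightarrow> M' * 0 ^ (k - length is)) (at_right 0)"
      by (intro tendsto_intros)
    moreover have "M' * 0 ^ (k - length is) = 0" using len by (simp add: power_0_left)
    ultimately show "((\<lambda>\<epsilon>::real. M' * \<epsilon> ^ (k - length is)) \<longlongrightarrow> 0) (at_right 0)"
      by simp
    show "eventually (\<lambda>\<epsilon>. cmod (word_deriv is h p) \<le> M' * \<epsilon> ^ (k - length is)) (at_right 0)"
      using eventually_at_right_real[OF r'] by eventually_elim (use b in auto)
  qed simp
  then show ?thesis by simp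
qed

text \<open>The falling factorial; the truncated subtraction makes it vanish for \<open>k > n\<close>.\<close>

definition falling :: "nat \<Rightarrow> nat \<Rightarrow> complex" where
  "falling n k = (\<Prod>l<k. of_nat (n - l))"

lemma falling_self: "falling n n = fact n"
  unfolding falling_def fact_prod_rev of_nat_prod atLeast0LessThan by simp

lemma falling_eq_0: "n < k \<Longrightarrow> falling n k = 0"
  unfolding falling_def by (rule prod_zero) auto

lemma deriv_mpow_line:
  "deriv (\<lambda>t. mpow (z + t *s axis i 1 - p) \<gamma>) 0 = of_nat (\<gamma> i) * mpow (z - p) (\<gamma>(i := \<gamma> i - 1))"
proof -
  let ?R = "\<Prod>j\<in>UNIV - {i}. (z $ j - p $ j) ^ \<gamma> j"
  have "mpow (z + t *s axis i 1 - p) \<gamma> = (z $ i - p $ i + t) ^ \<gamma> i * ?R" for t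
    unfolding mpow_def
    by (subst prod.remove[of _ i])
       (auto simp: axis_def algebra_simps intro!: prod.cong arg_cong2[where f = "(*)"])
  moreover have "((\<lambda>t. (z $ i - p $ i + t) ^ \<gamma> i * ?R) has_field_derivative
      of_nat (\<gamma> i) * (z $ i - p $ i) ^ (\<gamma> i - 1) * ?R) (at 0)"
    by (auto intro!: derivative_eq_intros)
  moreover have "mpow (z - p) (\<gamma>(i := \<gamma> i - 1)) = (z $ i - p $ i) ^ (\<gamma> i - 1) * ?R"
    unfolding mpow_def by (subst prod.remove[of _ i]) (auto intro!: prod.cong)
  ultimately show ?thesis by (simp add: DERIV_imp_deriv mult.assoc)
qed

lemma cpartial_mpow:
  "cpartial i (\<lambda>z. c * mpow (z - p) \<gamma>)
     = (\<lambda>z. (c * of_nat (\<gamma> i)) * mpow (z - p) (\<gamma>(i := \<gamma> i - 1)))"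
proof
  fix z
  have "cpartial i (\<lambda>z. c * mpow (z - p) \<gamma>) z = c * cpartial i (\<lambda>z. mpow (z - p) \<gamma>) z"
    by (rule cpartial_cmult[OF holo_on_mpow UNIV_I])
  then show "cpartial i (\<lambda>z. c * mpow (z - p) \<gamma>) z
      = (c * of_nat (\<gamma> i)) * mpow (z - p) (\<gamma>(i := \<gamma> i - 1))"
    by (simp add: cpartial_def deriv_mpow_line mult.assoc)
qed

lemma cpartial_funpow_mpow:
  "(cpartial i ^^ k) (\<lambda>z. c * mpow (z - p) \<gamma>)
     = (\<lambda>z. (c * falling (\<gamma> i) k) * mpow (z - p) (\<gamma>(i := \<gamma> i - k)))"
proof (induction k)
  case (Suc k)
  have "falling (\<gamma> i) (Suc k) = falling (\<gamma> i) k * of_nat (\<gamma> i - k)"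
    by (simp add: falling_def)
  moreover have "(cpartial i ^^ Suc k) (\<lambda>z. c * mpow (z - p) \<gamma>)
     = (\<lambda>z. (c * falling (\<gamma> i) k * of_nat (\<gamma> i - k)) * mpow (z - p) (\<gamma>(i := \<gamma> i - k - 1)))"
    by (simp only: funpow.simps o_apply Suc.IH cpartial_mpow fun_upd_upd fun_upd_same)
  ultimately show ?case by (simp add: mult.assoc fun_upd_def)
qed (simp add: falling_def)

lemma mderiv_mpow:
  "mderiv a (\<lambda>z. mpow (z - p) \<gamma>)
     = (\<lambda>z. (\<Prod>i\<in>UNIV. falling (\<gamma> i) (a i)) * mpow (z - p) (\<lambda>i. \<gamma> i - a i))"
proof -
  have "distinct is \<Longrightarrow> foldr (\<lambda>i g. (cpartial i ^^ a i) g) is (\<lambda>z. 1 * mpow (z - p) \<gamma>)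
     = (\<lambda>z. (\<Prod>i\<in>set is. falling (\<gamma> i) (a i)) *
         mpow (z - p) (\<lambda>i. if i \<in> set is then \<gamma> i - a i else \<gamma> i))" for "is"
  proof (induction "is")
    case (Cons i "is")
    have "(\<lambda>j. if j \<in> set is then \<gamma> j - a j else \<gamma> j)(i := \<gamma> i - a i)
        = (\<lambda>j. if j \<in> set (i # is) then \<gamma> j - a j else \<gamma> j)"
      using Cons.prems by auto
    with Cons show ?case
      by (simp add: cpartial_funpow_mpow mult.commute)
  qed simp
  from this[OF coord_order(1)] show ?thesis
    by (simp add: mderiv_foldr coord_order(2))
qed

lemma mpow_zero: "mpow 0 \<gamma> = (if \<gamma> = (\<lambda>_. 0) then 1 else 0)"
  by (auto simp: mpow_def fun_eq_iff intro: prod_zero)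

text \<open>The centred monomials and the derivatives at the centre are dual to each other up to the
  factor \<open>mfact \<gamma>\<close>: if the exponents differ, then either some falling factorial vanishes or a positive
  power of \<open>0\<close> is left.\<close>

lemma mderiv_mpow_center:
  "mderiv a (\<lambda>z. mpow (z - p) \<gamma>) p = (if a = \<gamma> then of_nat (mfact \<gamma>) else 0)"
proof -
  consider "a = \<gamma>" | i where "\<gamma> i < a i" | i where "a i < \<gamma> i"
    by (metis ext linorder_neqE_nat)
  then show ?thesis
  proof cases
    case 1
    then show ?thesis by (simp add: mderiv_mpow falling_self mpow_zero mfact_def)
  next
    case 2
    then have "(\<Prod>i\<in>UNIV. falling (\<gamma> i) (a i)) = 0"
      by (intro prod_zero) (auto intro: falling_eq_0)
    with 2 show ?thesis by (auto simp: mderiv_mpow)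
  next
    case 3
    then have "(\<lambda>i. \<gamma> i - a i) \<noteq> (\<lambda>_. 0)" by (metis zero_less_diff less_irrefl)
    with 3 show ?thesis by (auto simp: mderiv_mpow mpow_zero)
  qed
qed

lemma cpartial_exp_herm:
  "cpartial i (\<lambda>z. c * exp (herm (z - p) \<zeta>)) = (\<lambda>z. (c * cnj (\<zeta> $ i)) * exp (herm (z - p) \<zeta>))"
proof
  fix z
  have "herm (z + t *s axis i 1 - p) \<zeta> = herm (z - p) \<zeta> + t * cnj (\<zeta> $ i)" for t
  proof -
    have "herm (z + t *s axis i 1 - p) \<zeta> = herm (z - p) \<zeta> + (\<Sum>j\<in>UNIV. t * axis i 1 $ j * cnj (\<zeta> $ j))"
      by (simp add: herm_def algebra_simps sum.distrib sum_subtractf)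
    also have "(\<Sum>j\<in>UNIV. t * axis i 1 $ j * cnj (\<zeta> $ j)) = t * cnj (\<zeta> $ i)"
      by (simp add: axis_def if_distrib[of "\<lambda>x. t * x * _"] cong: if_cong)
    finally show ?thesis .
  qed
  then have "cpartial i (\<lambda>z. c * exp (herm (z - p) \<zeta>)) z
      = deriv (\<lambda>t. c * exp (herm (z - p) \<zeta> + t * cnj (\<zeta> $ i))) 0"
    by (simp add: cpartial_def)
  also have "\<dots> = c * cnj (\<zeta> $ i) * exp (herm (z - p) \<zeta>)"
    by (rule DERIV_imp_deriv) (auto intro!: derivative_eq_intros)
  finally show "cpartial i (\<lambda>z. c * exp (herm (z - p) \<zeta>)) z
      = (c * cnj (\<zeta> $ i)) * exp (herm (z - p) \<zeta>)" .
qed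

lemma mderiv_exp_herm:
  "mderiv a (\<lambda>z. exp (herm (z - p) \<zeta>)) = (\<lambda>z. cnj (mpow \<zeta> a) * exp (herm (z - p) \<zeta>))"
proof -
  have pow: "(cpartial i ^^ k) (\<lambda>z. c * exp (herm (z - p) \<zeta>))
     = (\<lambda>z. (c * cnj (\<zeta> $ i) ^ k) * exp (herm (z - p) \<zeta>))" for i k c
  proof (induction k)
    case (Suc k)
    have "(cpartial i ^^ Suc k) (\<lambda>z. c * exp (herm (z - p) \<zeta>))
       = (\<lambda>z. (c * cnj (\<zeta> $ i) ^ k * cnj (\<zeta> $ i)) * exp (herm (z - p) \<zeta>))"
      by (simp only: funpow.simps o_apply Suc.IH cpartial_exp_herm)
    then show ?case by (simp add: mult_ac)
  qed simp
  have "distinct is \<Longrightarrow> foldr (\<lambda>i g. (cpartial i ^^ a i) g) is (\<lambda>z. 1 * exp (herm (z - p) \<zeta>))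
     = (\<lambda>z. (\<Prod>i\<in>set is. cnj (\<zeta> $ i) ^ a i) * exp (herm (z - p) \<zeta>))" for "is"
    by (induction "is") (simp_all add: pow mult.assoc mult.left_commute)
  from this[OF coord_order(1)] show ?thesis
    by (simp add: mderiv_foldr coord_order(2) mpow_def)
qed

lemma mdeg_le_subset_PiE: "{\<gamma> :: 'n::finite \<Rightarrow> nat. mdeg \<gamma> \<le> n} \<subseteq> Pi\<^sub>E UNIV (\<lambda>_. {..n})"
proof
  fix \<gamma> :: "'n \<Rightarrow> nat" assume "\<gamma> \<in> {\<gamma>. mdeg \<gamma> \<le> n}"
  then have "\<gamma> i \<le> n" for i
    using member_le_sum[of i UNIV \<gamma>] by (simp add: mdeg_def)
  then show "\<gamma> \<in> Pi\<^sub>E UNIV (\<lambda>_. {..n})" by (auto simp: PiE_def)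
qed

lemma finite_mdeg_le: "finite {\<gamma> :: 'n::finite \<Rightarrow> nat. mdeg \<gamma> \<le> n}"
  by (rule finite_subset[OF mdeg_le_subset_PiE]) (intro finite_PiE, auto)

lemma finite_mdeg_eq: "finite {\<gamma> :: 'n::finite \<Rightarrow> nat. mdeg \<gamma> = n}"
  by (rule finite_subset[OF _ finite_mdeg_le[of n]]) auto

section \<open>Taylor expansion in several variables\<close>

definition taylor_poly :: "nat \<Rightarrow> (complex ^ 'n::finite \<Rightarrow> complex) \<Rightarrow> complex ^ 'n \<Rightarrow> complex ^ 'n \<Rightarrow> complex" where
  "taylor_poly n h p w = (\<Sum>\<gamma> | mdeg \<gamma> \<le> n. mderiv \<gamma> h p / of_nat (mfact \<gamma>) * mpow w \<gamma>)"

lemma deriv_line_sum_partials: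
  assumes U: "open U" and h: "holo_on U h" and t: "p + t *s w \<in> U"
  shows "((\<lambda>s. h (p + s *s w)) has_field_derivative
     (\<Sum>i\<in>UNIV. w $ i * cpartial i h (p + t *s w))) (at t)"
proof -
  obtain a where a: "(h has_derivative a) (at (p + t *s w))" "\<And>c v. a (c *s v) = c * a v"
    using h t by (rule holo_onD) blast
  have "a w = a (\<Sum>i\<in>UNIV. w $ i *s axis i 1)" by (simp add: basis_expansion)
  also have "\<dots> = (\<Sum>i\<in>UNIV. w $ i * a (axis i 1))"
    by (simp add: linear_sum[OF has_derivative_linear[OF a(1)]] a(2))
  finally show ?thesis
    using has_derivative_line[OF a] by (simp add: cpartial_eq[OF a])
qed

text \<open>With words as indices, another derivative along the line just prepends a letter. Words with the
  same letter counts are collected later.\<close>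

lemma deriv_line_words:
  assumes U: "open U" and h: "holo_on U h" and t: "p + t *s w \<in> U"
  shows "(deriv ^^ k) (\<lambda>s. h (p + s *s w)) t
     = (\<Sum>is | length is = k. prod_list (map (($) w) is) * word_deriv is h (p + t *s w))"
  using t
proof (induction k arbitrary: t)
  case (Suc k)
  let ?T = "(\<lambda>t. p + t *s w) -` U"
  have "open ?T"
    by (intro open_vimage U continuous_intros bounded_linear.continuous_on[OF bounded_linear_smult_left])
  moreover have "t \<in> ?T" using Suc.prems by simp
  ultimately have "eventually (\<lambda>s. s \<in> ?T) (nhds t)" by (rule eventually_nhds_in_open)
  then have ev: "eventually (\<lambda>s. (deriv ^^ k) (\<lambda>s. h (p + s *s w)) s
     = (\<Sum>is | length is = k. prod_list (map (($) w) is) * word_deriv is h (p + s *s w))) (nhds t)"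
    by eventually_elim (use Suc.IH in auto)
  have "(deriv ^^ Suc k) (\<lambda>s. h (p + s *s w)) t
      = deriv (\<lambda>s. \<Sum>is | length is = k. prod_list (map (($) w) is) * word_deriv is h (p + s *s w)) t"
    using deriv_cong_ev[OF ev refl] by simp
  also have "\<dots> = (\<Sum>is | length is = k. prod_list (map (($) w) is) *
      (\<Sum>i\<in>UNIV. w $ i * cpartial i (word_deriv is h) (p + t *s w)))"
    by (intro DERIV_imp_deriv DERIV_sum DERIV_cmult
        deriv_line_sum_partials[OF U holo_on_word_deriv[OF U h] Suc.prems])
  also have "\<dots> = (\<Sum>(is, i)\<in>{is. length is = k} \<times> UNIV.
      prod_list (map (($) w) (i # is)) * word_deriv (i # is) h (p + t *s w))"
    by (simp add: sum_distrib_left sum.cartesian_product[symmetric] mult_ac)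
  also have "\<dots> = (\<Sum>is | length is = Suc k. prod_list (map (($) w) is) * word_deriv is h (p + t *s w))"
    by (rule sum.reindex_bij_witness[where i = "\<lambda>is. (tl is, hd is)" and j = "\<lambda>(is, i). i # is"])
       (auto simp: length_Suc_conv)
  finally show ?case .
qed simp

lemma prod_list_eq_mpow: "prod_list (map (($) w) is) = mpow w (count_list is)"
proof (induction "is")
  case (Cons i "is")
  have "mpow w (count_list (i # is)) = (\<Prod>j\<in>UNIV. (if j = i then w $ i else 1) * (w $ j) ^ count_list is j)"
    unfolding mpow_def by (intro prod.cong) auto
  then show ?case
    by (simp add: Cons prod.distrib mpow_def)
qed (simp add: mpow_def)

lemma mdeg_count_list: "mdeg (count_list is) = length is"
  unfolding mdeg_def using sum_count_set[of "is" UNIV] by simp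

lemma word_deriv_vanishing_order:
  assumes h: "holo_on (ball p r) h" and r: "0 < r"
    and M: "\<And>w. norm w < r \<Longrightarrow> cmod (h (p + w)) \<le> M * norm w ^ k" and len: "length is < k"
  shows "word_deriv is h p = 0"
proof (rule word_deriv_vanishes[OF h r _ len])
  fix \<epsilon> :: real and y assume \<epsilon>: "0 < \<epsilon>" "\<epsilon> < r" "y \<in> ball p \<epsilon>"
  then have n: "norm (y - p) < \<epsilon>" by (simp add: dist_norm norm_minus_commute)
  then have "cmod (h y) \<le> M * norm (y - p) ^ k"
    using M[of "y - p"] \<epsilon> by simp
  also have "\<dots> \<le> \<bar>M\<bar> * \<epsilon> ^ k"
    using n by (intro mult_mono power_mono) auto
  finally show "cmod (h y) \<le> \<bar>M\<bar> * \<epsilon> ^ k" .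
qed

lemma finite_words: "finite {is :: 'n::finite list. length is \<le> n}"
  using finite_lists_length_le[of "UNIV :: 'n set" n] by simp

lemma taylor_words_remainder:
  fixes w :: "complex ^ 'n::finite"
  assumes U: "open U" and h: "holo_on U h" and \<rho>: "1 < \<rho>"
    and M: "\<And>t. t \<in> ball 0 \<rho> \<Longrightarrow> p + t *s w \<in> U \<and> cmod (h (p + t *s w)) \<le> M"
  shows "cmod (h (p + w) - (\<Sum>is | length is \<le> n. word_deriv is h p / fact (length is) * mpow w (count_list is)))
     \<le> M * (1 / \<rho>) ^ Suc n / (1 - 1 / \<rho>)"
proof -
  define \<phi> where "\<phi> t = h (p + t *s w)" for t
  have "\<phi> holomorphic_on ball 0 \<rho>"
    unfolding \<phi>_def using M by (intro holo_on_line[OF h]) blast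
  moreover have "cmod (\<phi> t) \<le> M" if "t \<in> ball 0 \<rho>" for t
    using M[OF that] by (simp add: \<phi>_def)
  ultimately have "cmod (\<phi> 1 - (\<Sum>k\<le>n. (deriv ^^ k) \<phi> 0 / fact k)) \<le> M * (1 / \<rho>) ^ Suc n / (1 - 1 / \<rho>)"
    using \<rho> by (intro taylor_remainder_disc) auto
  moreover have "(\<Sum>k\<le>n. (deriv ^^ k) \<phi> 0 / fact k)
     = (\<Sum>is | length is \<le> n. word_deriv is h p / fact (length is) * mpow w (count_list is))"
  proof -
    have p: "p + 0 *s w \<in> U" using M[of 0] \<rho> by simp
    note fin = finite_words[of n, where 'n = 'n]
    have "(\<Sum>k\<le>n. (deriv ^^ k) \<phi> 0 / fact k)
      = (\<Sum>k\<le>n. \<Sum>is\<in>{is \<in> {is. length is \<le> n}. length is = k}. word_deriv is h p / fact (length is) * mpow w (count_list is))"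
    proof (rule sum.cong[OF refl])
      fix k assume "k \<in> {..n}"
      then have e: "{is \<in> {is :: 'n list. length is \<le> n}. length is = k} = {is. length is = k}" by auto
      have "(deriv ^^ k) \<phi> 0 / fact k
         = (\<Sum>is | length is = k. mpow w (count_list is) * word_deriv is h p) / fact k"
        unfolding \<phi>_def deriv_line_words[OF U h p] by (simp add: prod_list_eq_mpow)
      also have "\<dots> = (\<Sum>is | length is = k. word_deriv is h p / fact (length is) * mpow w (count_list is))"
        unfolding sum_divide_distrib by (intro sum.cong) auto
      finally show "(deriv ^^ k) \<phi> 0 / fact k
        = (\<Sum>is\<in>{is \<in> {is. length is \<le> n}. length is = k}. word_deriv is h p / fact (length is) * mpow w (count_list is))"
        unfolding e .
    qed
    also have "\<dots> = (\<Sum>is | length is \<le> n. word_deriv is h p / fact (length is) * mpow w (count_list is))"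
      by (rule sum.group[OF fin]) auto
    finally show ?thesis .
  qed
  ultimately show ?thesis by (simp add: \<phi>_def)
qed

text \<open>A remainder that is controlled on every disc where \<open>h\<close> is bounded vanishes to the expected
  order at \<open>p\<close>: near \<open>p\<close> the discs in the direction \<open>w\<close> may have radius proportional to
  \<open>1 / norm w\<close>.\<close>

lemma remainder_bigO:
  fixes p :: "complex ^ 'n::finite"
  assumes U: "open U" and h: "holo_on U h" and p: "p \<in> U"
    and rem: "\<And>w \<rho> M. 1 < \<rho> \<Longrightarrow>
      (\<And>t. t \<in> ball 0 \<rho> \<Longrightarrow> p + t *s w \<in> U \<and> cmod (h (p + t *s w)) \<le> M) \<Longrightarrow>
      cmod (h (p + w) - P w) \<le> M * (1 / \<rho>) ^ Suc n / (1 - 1 / \<rho>)"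
  shows "\<exists>M r. 0 < r \<and> ball p r \<subseteq> U \<and>
      (\<forall>w. norm w < r \<longrightarrow> cmod (h (p + w) - P w) \<le> M * norm w ^ Suc n)"
proof -
  obtain R where R: "0 < R" "cball p R \<subseteq> U" using U p open_contains_cball by blast
  obtain M where M0: "0 \<le> M" and M: "\<And>y. y \<in> cball p R \<Longrightarrow> cmod (h y) \<le> M"
    by (rule continuous_on_compact_bound[OF holo_on_continuous[OF holo_on_subset[OF h R(2)]] compact_cball])
      (rule that)
  have bd: "cmod (h (p + w) - P w) \<le> (2 * M * (1 / R) ^ Suc n) * norm w ^ Suc n" if w: "norm w < R / 2" for w
  proof (cases "w = 0")
    case True
    have "cmod (h (p + 0) - P 0) \<le> M * (1 / \<rho>) ^ Suc n / (1 - 1 / \<rho>)" if \<rho>: "1 < \<rho>" for \<rho>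
      using R M p by (intro rem[OF \<rho>]) auto
    then have ev: "eventually (\<lambda>\<rho>. cmod (h (p + 0) - P 0) \<le> M * (1 / \<rho>) ^ Suc n / (1 - 1 / \<rho>)) at_top"
      by (intro eventually_mono[OF eventually_gt_at_top[of 1]]) auto
    have lim: "((\<lambda>\<rho>::real. M * (1 / \<rho>) ^ Suc n / (1 - 1 / \<rho>)) \<longlongrightarrow> M * 0 ^ Suc n / (1 - 0)) at_top"
      by (intro tendsto_intros tendsto_divide_0[OF tendsto_const] filterlim_at_top_imp_at_infinity
          filterlim_ident) auto
    have "cmod (h (p + 0) - P 0) \<le> M * 0 ^ Suc n / (1 - 0)"
      by (rule tendsto_lowerbound[OF lim ev]) simp
    then show ?thesis using True by simp
  next
    case False
    define \<rho> where "\<rho> = R / norm w"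
    have \<rho>: "2 < \<rho>" using w False by (simp add: \<rho>_def field_simps)
    have "cmod (h (p + w) - P w) \<le> M * (1 / \<rho>) ^ Suc n / (1 - 1 / \<rho>)"
    proof (rule rem)
      fix t :: complex assume "t \<in> ball 0 \<rho>"
      then have "p + t *s w \<in> cball p R"
        using False by (simp add: \<rho>_def dist_norm norm_smult_vec field_simps)
      then show "p + t *s w \<in> U \<and> cmod (h (p + t *s w)) \<le> M" using R M by auto
    qed (use \<rho> in simp)
    also have "\<dots> \<le> M * (1 / \<rho>) ^ Suc n / (1 / 2)"
      using \<rho> M0 by (intro divide_left_mono mult_nonneg_nonneg) (auto simp: field_simps)
    also have "\<dots> = (2 * M * (1 / R) ^ Suc n) * norm w ^ Suc n"
      by (simp add: \<rho>_def power_divide)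
    finally show ?thesis .
  qed
  moreover have "ball p (R / 2) \<subseteq> U" using R by (auto simp: subset_iff)
  ultimately show ?thesis
    using R by (intro exI[of _ "2 * M * (1 / R) ^ Suc n"] exI[of _ "R / 2"]) auto
qed

text \<open>Collecting the words by their letter counts gives a polynomial that agrees with \<open>h\<close> up to
  order \<open>n\<close>. Their difference has vanishing derivatives up to order \<open>n\<close>, so the coefficients of the
  polynomial are the derivatives of \<open>h\<close> divided by factorials.\<close>

lemma mderiv_eq_sum_words:
  fixes p :: "complex ^ 'n::finite"
  assumes U: "open U" and h: "holo_on U h" and p: "p \<in> U" and \<gamma>: "mdeg \<gamma> \<le> n"
  shows "mderiv \<gamma> h p / of_nat (mfact \<gamma>)
     = (\<Sum>is | length is \<le> n \<and> count_list is = \<gamma>. word_deriv is h p / fact (length is))"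
proof -
  define c where "c \<delta> = (\<Sum>is\<in>{is \<in> {is. length is \<le> n}. count_list is = \<delta>}. word_deriv is h p / fact (length is))" for \<delta>
  define P where "P w = (\<Sum>\<delta> | mdeg \<delta> \<le> n. c \<delta> * mpow w \<delta>)" for w
  note fin = finite_words[of n, where 'n = 'n]
  have P: "P w = (\<Sum>is | length is \<le> n. word_deriv is h p / fact (length is) * mpow w (count_list is))" for w
  proof -
    have "P w = (\<Sum>\<delta> | mdeg \<delta> \<le> n. \<Sum>is\<in>{is \<in> {is. length is \<le> n}. count_list is = \<delta>}.
        word_deriv is h p / fact (length is) * mpow w (count_list is))"
      unfolding P_def c_def sum_distrib_right by (intro sum.cong) auto
    also have "\<dots> = (\<Sum>is | length is \<le> n. word_deriv is h p / fact (length is) * mpow w (count_list is))"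
      by (rule sum.group[OF fin finite_mdeg_le]) (auto simp: mdeg_count_list)
    finally show ?thesis .
  qed
  have "\<exists>M r. 0 < r \<and> ball p r \<subseteq> U \<and>
      (\<forall>w. norm w < r \<longrightarrow> cmod (h (p + w) - P w) \<le> M * norm w ^ Suc n)"
    unfolding P by (intro remainder_bigO[OF U h p] taylor_words_remainder[OF U h])
  then obtain M r where r: "0 < r" "ball p r \<subseteq> U"
    and bd: "\<And>w. norm w < r \<Longrightarrow> cmod (h (p + w) - P w) \<le> M * norm w ^ Suc n" by blast
  define g where "g z = h z - P (z - p)" for z
  have hP: "holo_on U (\<lambda>z. P (z - p))"
    unfolding P_def by (intro holo_on_sum holo_on_mult holo_on_const holo_on_mpow)
  have hg: "holo_on U g" unfolding g_def by (intro holo_on_diff h hP)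
  have "word_deriv (sorted_word \<gamma>) g p = 0"
  proof (rule word_deriv_vanishing_order[OF _ r(1)])
    show "holo_on (ball p r) g" by (rule holo_on_subset[OF hg r(2)])
    show "length (sorted_word \<gamma>) < Suc n" using \<gamma> by (simp add: length_sorted_word)
    show "cmod (g (p + w)) \<le> M * norm w ^ Suc n" if "norm w < r" for w
      using bd[OF that] by (simp add: g_def)
  qed
  moreover have "word_deriv (sorted_word \<gamma>) (\<lambda>z. g z + P (z - p)) p
      = word_deriv (sorted_word \<gamma>) g p + word_deriv (sorted_word \<gamma>) (\<lambda>z. P (z - p)) p"
    by (rule word_deriv_add[OF U hg hP p])
  ultimately have "mderiv \<gamma> h p = word_deriv (sorted_word \<gamma>) (\<lambda>z. P (z - p)) p"
    by (simp add: g_def mderiv_word)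
  also have "\<dots> = (\<Sum>\<delta> | mdeg \<delta> \<le> n. word_deriv (sorted_word \<gamma>) (\<lambda>z. c \<delta> * mpow (z - p) \<delta>) p)"
    unfolding P_def
    by (intro word_deriv_sum[OF open_UNIV] finite_mdeg_le holo_on_mult holo_on_const holo_on_mpow UNIV_I)
  also have "\<dots> = (\<Sum>\<delta> | mdeg \<delta> \<le> n. c \<delta> * mderiv \<gamma> (\<lambda>z. mpow (z - p) \<delta>) p)"
    unfolding mderiv_word by (simp add: word_deriv_cmult[OF open_UNIV holo_on_mpow UNIV_I])
  also have "\<dots> = c \<gamma> * of_nat (mfact \<gamma>)"
    using \<gamma> finite_mdeg_le[of n, where 'n = 'n]
    by (simp add: mderiv_mpow_center if_distrib[of "\<lambda>x. _ * x"] sum.delta' cong: if_cong)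
  finally show ?thesis
    by (simp add: c_def mfact_def)
qed

text \<open>The remainder depends on the function only through its bound on the disc of radius \<open>\<rho>\<close> in
  the direction \<open>w\<close>, which makes it uniform over families of functions and of directions.\<close>

theorem taylor_poly_remainder:
  fixes w :: "complex ^ 'n::finite"
  assumes U: "open U" and h: "holo_on U h" and \<rho>: "1 < \<rho>"
    and M: "\<And>t. t \<in> ball 0 \<rho> \<Longrightarrow> p + t *s w \<in> U \<and> cmod (h (p + t *s w)) \<le> M"
  shows "cmod (h (p + w) - taylor_poly n h p w) \<le> M * (1 / \<rho>) ^ Suc n / (1 - 1 / \<rho>)"
proof -
  have p: "p \<in> U" using M[of 0] \<rho> by simp
  note fin = finite_words[of n, where 'n = 'n]
  have "taylor_poly n h p w = (\<Sum>\<gamma> | mdeg \<gamma> \<le> n. \<Sum>is\<in>{is \<in> {is. length is \<le> n}. count_list is = \<gamma>}.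
      word_deriv is h p / fact (length is) * mpow w (count_list is))"
    unfolding taylor_poly_def
    by (intro sum.cong refl) (auto simp: mderiv_eq_sum_words[OF U h p] sum_distrib_right)
  also have "\<dots> = (\<Sum>is | length is \<le> n. word_deriv is h p / fact (length is) * mpow w (count_list is))"
    by (rule sum.group[OF fin finite_mdeg_le]) (auto simp: mdeg_count_list)
  finally show ?thesis using taylor_words_remainder[OF U h \<rho> M, of n] by simp
qed

section \<open>Jet functionals and the Fourier-Borel transform\<close>

lemma taylor_poly_bigO:
  fixes p :: "complex ^ 'n::finite"
  assumes U: "open U" and h: "holo_on U h" and p: "p \<in> U"
  obtains M r where "0 < r" "ball p r \<subseteq> U"
    "\<And>w. norm w < r \<Longrightarrow> cmod (h (p + w) - taylor_poly n h p w) \<le> M * norm w ^ Suc n"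
proof -
  have "\<exists>M r. 0 < r \<and> ball p r \<subseteq> U \<and>
      (\<forall>w. norm w < r \<longrightarrow> cmod (h (p + w) - taylor_poly n h p w) \<le> M * norm w ^ Suc n)"
    by (intro remainder_bigO[OF U h p] taylor_poly_remainder[OF U h])
  then show ?thesis using that by blast
qed

text \<open>A derivative of order at most \<open>n\<close> of a product depends on the first factor only through its
  Taylor polynomial, since the rest of the product vanishes to order \<open>n + 1\<close>.\<close>

lemma mderiv_mult_exp:
  fixes p :: "complex ^ 'n::finite"
  assumes U: "open U" and h: "holo_on U h" and p: "p \<in> U" and n: "mdeg a \<le> n"
  shows "mderiv a (\<lambda>z. h z * exp (herm (z - p) \<zeta>)) p
    = (\<Sum>\<gamma> | mdeg \<gamma> \<le> n. mderiv \<gamma> h p / of_nat (mfact \<gamma>) *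
        mderiv a (\<lambda>z. mpow (z - p) \<gamma> * exp (herm (z - p) \<zeta>)) p)"
proof -
  let ?E = "\<lambda>z. exp (herm (z - p) \<zeta>)"
  define g where "g z = h z - taylor_poly n h p (z - p)" for z
  obtain M r where r: "0 < r" "ball p r \<subseteq> U"
    and M: "\<And>w. norm w < r \<Longrightarrow> cmod (h (p + w) - taylor_poly n h p w) \<le> M * norm w ^ Suc n"
    by (rule taylor_poly_bigO[OF U h p, of n]) blast
  obtain B where B: "\<And>y. y \<in> cball p r \<Longrightarrow> cmod (?E y) \<le> B" and B0: "0 \<le> B"
    using continuous_on_compact_bound[OF holo_on_continuous[OF holo_on_exp_herm] compact_cball] by blast
  have hT: "holo_on V (\<lambda>z. taylor_poly n h p (z - p))" for V
    unfolding taylor_poly_def by (intro holo_on_sum holo_on_mult holo_on_const holo_on_mpow)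
  have hg: "holo_on U g" unfolding g_def by (intro holo_on_diff h hT)
  have "word_deriv (sorted_word a) (\<lambda>z. g z * ?E z) p = 0"
  proof (rule word_deriv_vanishing_order[OF _ r(1)])
    show "holo_on (ball p r) (\<lambda>z. g z * ?E z)"
      by (intro holo_on_mult holo_on_exp_herm holo_on_subset[OF hg r(2)])
    show "length (sorted_word a) < Suc n" using n by (simp add: length_sorted_word)
    fix w :: "complex ^ 'n" assume w: "norm w < r"
    have "cmod (g (p + w)) \<le> M * norm w ^ Suc n" using M[OF w] by (simp add: g_def)
    moreover have "cmod (?E (p + w)) \<le> B" using w by (intro B) (simp add: dist_norm)
    ultimately have "cmod (g (p + w) * ?E (p + w)) \<le> (M * norm w ^ Suc n) * B"
      unfolding norm_mult
      using order_trans[OF norm_ge_zero \<open>cmod (g (p + w)) \<le> M * norm w ^ Suc n\<close>]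
      by (intro mult_mono norm_ge_zero)
    then show "cmod (g (p + w) * ?E (p + w)) \<le> (M * B) * norm w ^ Suc n" by (simp add: mult_ac)
  qed
  moreover have "word_deriv (sorted_word a) (\<lambda>z. g z * ?E z + taylor_poly n h p (z - p) * ?E z) p
     = word_deriv (sorted_word a) (\<lambda>z. g z * ?E z) p + word_deriv (sorted_word a) (\<lambda>z. taylor_poly n h p (z - p) * ?E z) p"
    by (intro word_deriv_add[OF U _ _ p] holo_on_mult holo_on_exp_herm hg hT)
  ultimately have "mderiv a (\<lambda>z. h z * ?E z) p
     = word_deriv (sorted_word a) (\<lambda>z. taylor_poly n h p (z - p) * ?E z) p"
    by (simp add: g_def mderiv_word algebra_simps)
  also have "\<dots> = word_deriv (sorted_word a)
      (\<lambda>z. \<Sum>\<gamma> | mdeg \<gamma> \<le> n. mderiv \<gamma> h p / of_nat (mfact \<gamma>) * (mpow (z - p) \<gamma> * ?E z)) p"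
    by (simp add: taylor_poly_def sum_distrib_right mult.assoc)
  also have "\<dots> = (\<Sum>\<gamma> | mdeg \<gamma> \<le> n. word_deriv (sorted_word a)
      (\<lambda>z. mderiv \<gamma> h p / of_nat (mfact \<gamma>) * (mpow (z - p) \<gamma> * ?E z)) p)"
    by (intro word_deriv_sum[OF open_UNIV] finite_mdeg_le holo_on_mult holo_on_const holo_on_mpow
        holo_on_exp_herm UNIV_I)
  also have "\<dots> = (\<Sum>\<gamma> | mdeg \<gamma> \<le> n. mderiv \<gamma> h p / of_nat (mfact \<gamma>) *
        mderiv a (\<lambda>z. mpow (z - p) \<gamma> * ?E z) p)"
    unfolding mderiv_word
    by (intro sum.cong refl word_deriv_cmult[OF open_UNIV] holo_on_mult holo_on_mpow holo_on_exp_herm UNIV_I)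
  finally show ?thesis .
qed

lemma herm_zero_left: "herm 0 w = 0"
  by (simp add: herm_def)

lemma herm_diff_left: "herm (x - y) w = herm x w - herm y w"
  by (simp add: herm_def algebra_simps sum_subtractf)

lemma herm_diff_right: "herm x (y - w) = herm x y - herm x w"
  by (simp add: herm_def algebra_simps sum_subtractf)

lemma herm_minus_right: "herm x (- w) = - herm x w"
  by (simp add: herm_def sum_negf)

lemma cnj_herm: "cnj (herm x y) = herm y x"
  by (simp add: herm_def mult.commute)

lemma herm_self: "herm p p = complex_of_real ((norm p)\<^sup>2)"
  by (simp add: herm_def norm_vec_def L2_set_def sum_nonneg complex_norm_square[symmetric])

lemma mfact_pos: "0 < mfact a"
  by (simp add: mfact_def)

definition jet_scale :: "('n::finite \<Rightarrow> nat) \<Rightarrow> complex ^ 'n \<Rightarrow> complex" where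
  "jet_scale \<alpha> p = complex_of_real (exp (- (norm p)\<^sup>2 / 2) / sqrt (real (mfact \<alpha>)))"

lemma jet_basis_scale: "jet_basis a p i z = jet_scale (a i) p * mpow (z - p) (a i) * exp (herm z p)"
  by (simp add: jet_basis_def jet_scale_def)

lemma jet_scale_square:
  "jet_scale \<alpha> p * jet_scale \<alpha> p * exp (herm p p) = 1 / of_nat (mfact \<alpha>)"
proof -
  have "exp (- (norm p)\<^sup>2 / 2) * exp (- (norm p)\<^sup>2 / 2) * exp ((norm p)\<^sup>2) = 1"
    by (simp flip: exp_add)
  moreover have "sqrt (real (mfact \<alpha>)) * sqrt (real (mfact \<alpha>)) = real (mfact \<alpha>)" by simp
  ultimately have *: "(exp (- (norm p)\<^sup>2 / 2) / sqrt (real (mfact \<alpha>))) * (exp (- (norm p)\<^sup>2 / 2) / sqrt (real (mfact \<alpha>)))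
     * exp ((norm p)\<^sup>2) = 1 / real (mfact \<alpha>)"
    by (simp add: field_simps)
  show ?thesis
    unfolding jet_scale_def herm_self exp_of_real of_real_mult[symmetric] *
    by (simp only: of_real_divide of_real_1 of_real_of_nat_eq)
qed

text \<open>The functional that reads off the coefficient of \<open>jet_basis a p i\<close> in the expansion of \<open>h\<close>
  at \<open>p\<close>. It is the preimage of \<open>jet_basis a p i\<close> under the antilinear Fourier-Borel transform.\<close>

definition jet_coeff ::
    "(complex ^ 'n::finite) set \<Rightarrow> (nat \<Rightarrow> 'n \<Rightarrow> nat) \<Rightarrow> complex ^ 'n \<Rightarrow> nat \<Rightarrow> 'n functional" where
  "jet_coeff S a p i = (\<lambda>h. if h \<in> holo_near S
     then jet_scale (a i) p * mderiv (a i) (\<lambda>z. h z * exp (herm (z - p) (- p))) p else 0)"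

lemma holo_near_add: "g \<in> holo_near S \<Longrightarrow> h \<in> holo_near S \<Longrightarrow> (\<lambda>z. g z + h z) \<in> holo_near S"
proof -
  assume "g \<in> holo_near S" "h \<in> holo_near S"
  then obtain U V where U: "open U" "S \<subseteq> U" "holo_on U g" and V: "open V" "S \<subseteq> V" "holo_on V h"
    by (auto simp: holo_near_def)
  then have "holo_on (U \<inter> V) (\<lambda>z. g z + h z)"
    by (intro holo_on_add holo_on_subset[OF U(3)] holo_on_subset[OF V(3)]) auto
  then show ?thesis using U V by (auto simp: holo_near_def intro!: exI[of _ "U \<inter> V"])
qed

lemma holo_near_cmult: "h \<in> holo_near S \<Longrightarrow> (\<lambda>z. c * h z) \<in> holo_near S"
  unfolding holo_near_def using holo_on_mult[OF holo_on_const[of _ c]] by blast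

lemma holo_near_UNIV: "holo_on UNIV h \<Longrightarrow> h \<in> holo_near S"
  unfolding holo_near_def by auto

lemma holo_on_exp_fun: "holo_on U (exp_fun \<zeta>)"
  using holo_on_exp_herm[of U 0 \<zeta>] by (simp add: exp_fun_def[abs_def])

lemma holo_on_jet_basis: "holo_on U (jet_basis a p i)"
  using holo_on_exp_fun[of U p] unfolding jet_basis_scale[abs_def] exp_fun_def[abs_def]
  by (intro holo_on_mult holo_on_const holo_on_mpow)

text \<open>Continuity is Cauchy's estimate on a ball about \<open>p\<close>, whose radius is shared out among the
  derivatives.\<close>

lemma jet_coeff_in_analytic_dual:
  fixes S :: "(complex ^ 'n::finite) set"
  assumes p: "p \<in> S"
  shows "jet_coeff S a p i \<in> analytic_dual S"
proof -
  let ?E = "\<lambda>z. exp (herm (z - p) (- p))"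
  let ?W = "sorted_word (a i)"
  note mw = jet_coeff_def mderiv_word
  have germ: "jet_coeff S a p i g = jet_coeff S a p i h"
    if gh: "g \<in> holo_near S" "h \<in> holo_near S" "same_germ S g h" for g h
  proof -
    obtain U where U: "open U" "S \<subseteq> U" "\<And>z. z \<in> U \<Longrightarrow> g z = h z"
      using gh(3) unfolding same_germ_def by blast
    have "word_deriv ?W (\<lambda>z. g z * ?E z) p = word_deriv ?W (\<lambda>z. h z * ?E z) p"
      using U p by (intro word_deriv_cong[OF U(1)]) auto
    then show ?thesis using gh by (simp add: mw)
  qed
  have add: "jet_coeff S a p i (\<lambda>z. g z + h z) = jet_coeff S a p i g + jet_coeff S a p i h"
    if gh: "g \<in> holo_near S" "h \<in> holo_near S" for g h
  proof -
    obtain U V where U: "open U" "S \<subseteq> U" "holo_on U g" and V: "open V" "S \<subseteq> V" "holo_on V h"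
      using gh unfolding holo_near_def by blast
    have "word_deriv ?W (\<lambda>z. g z * ?E z + h z * ?E z) p
       = word_deriv ?W (\<lambda>z. g z * ?E z) p + word_deriv ?W (\<lambda>z. h z * ?E z) p"
      using U V p by (intro word_deriv_add[OF open_Int[of U V]] holo_on_mult holo_on_exp_herm
          holo_on_subset[OF U(3)] holo_on_subset[OF V(3)]) auto
    then show ?thesis using gh by (simp add: mw holo_near_add algebra_simps)
  qed
  have cmult: "jet_coeff S a p i (\<lambda>z. c * h z) = c * jet_coeff S a p i h"
    if h: "h \<in> holo_near S" for c h
  proof -
    obtain U where U: "open U" "S \<subseteq> U" "holo_on U h"
      using h unfolding holo_near_def by blast
    have "word_deriv ?W (\<lambda>z. c * (h z * ?E z)) p = c * word_deriv ?W (\<lambda>z. h z * ?E z) p"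
      using U p by (intro word_deriv_cmult[OF U(1)] holo_on_mult holo_on_exp_herm) auto
    then show ?thesis using h by (simp add: mw holo_near_cmult mult.assoc mult.left_commute)
  qed
  have cont: "\<exists>L A. compact L \<and> L \<subseteq> U \<and>
       (\<forall>h B. holo_on U h \<and> 0 \<le> B \<and> (\<forall>z\<in>L. cmod (h z) \<le> B) \<longrightarrow> cmod (jet_coeff S a p i h) \<le> A * B)"
    if U: "open U" "S \<subseteq> U" for U
  proof -
    obtain R where R: "0 < R" "cball p R \<subseteq> U" using U p open_contains_cball by blast
    obtain D where D: "\<And>y. y \<in> cball p R \<Longrightarrow> cmod (?E y) \<le> D"
      using continuous_on_compact_bound[OF holo_on_continuous[OF holo_on_exp_herm] compact_cball] by blast
    define \<epsilon> where "\<epsilon> = R / (length ?W + 1)"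
    have \<epsilon>: "0 < \<epsilon>" using R by (simp add: \<epsilon>_def add_pos_nonneg)
    have small: "real (length ?W) * \<epsilon> < R" using R by (simp add: \<epsilon>_def field_simps)
    have "cmod (jet_coeff S a p i h) \<le> (cmod (jet_scale (a i) p) * (D / \<epsilon> ^ length ?W)) * B"
      if h: "holo_on U h" "0 \<le> B" "\<And>z. z \<in> cball p R \<Longrightarrow> cmod (h z) \<le> B" for h B
    proof -
      have "cmod (word_deriv ?W (\<lambda>z. h z * ?E z) p) \<le> (B * D) / \<epsilon> ^ length ?W"
      proof (rule word_deriv_bound[OF _ _ \<epsilon>])
        show "holo_on (ball p R) (\<lambda>z. h z * ?E z)"
          using R by (intro holo_on_mult holo_on_exp_herm holo_on_subset[OF h(1)]) auto
        show "cmod (h y * ?E y) \<le> B * D" if "y \<in> ball p R" for y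
          unfolding norm_mult using h D that by (intro mult_mono) auto
        show "p \<in> ball p (R - real (length ?W) * \<epsilon>)" using small by simp
      qed
      moreover have "h \<in> holo_near S" using h(1) U by (auto simp: holo_near_def)
      ultimately have "cmod (jet_coeff S a p i h) \<le> cmod (jet_scale (a i) p) * ((B * D) / \<epsilon> ^ length ?W)"
        by (simp add: mw norm_mult mult_left_mono del: times_divide_eq_right)
      then show ?thesis by (simp add: mult_ac)
    qed
    then show ?thesis using R
      by (intro exI[of _ "cball p R"] exI[of _ "cmod (jet_scale (a i) p) * (D / \<epsilon> ^ length ?W)"]) auto
  qed
  show ?thesis
    unfolding analytic_dual_def
    using germ add cmult cont by (auto simp: jet_coeff_def[of S a p i])
qed

text \<open>The weight turns \<open>exp_fun \<zeta>\<close> into a multiple of the exponential with frequency \<open>\<zeta> - p\<close> centred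
  at \<open>p\<close>, and differentiating it produces the conjugated monomial in \<open>\<zeta> - p\<close>.\<close>

lemma FB_bar_jet_coeff: "FB_bar (jet_coeff S a p i) = jet_basis a p i"
proof
  fix \<zeta>
  have "exp_fun \<zeta> z * exp (herm (z - p) (- p)) = exp (herm p \<zeta>) * exp (herm (z - p) (\<zeta> - p))" for z
    unfolding exp_fun_def exp_add[symmetric]
    by (rule arg_cong[of _ _ exp]) (simp add: herm_diff_left herm_diff_right herm_minus_right)
  then have "mderiv (a i) (\<lambda>z. exp_fun \<zeta> z * exp (herm (z - p) (- p))) p
     = mderiv (a i) (\<lambda>z. exp (herm p \<zeta>) * exp (herm (z - p) (\<zeta> - p))) p" by simp
  also have "\<dots> = exp (herm p \<zeta>) * mderiv (a i) (\<lambda>z. exp (herm (z - p) (\<zeta> - p))) p"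
    unfolding mderiv_word by (rule word_deriv_cmult[OF open_UNIV holo_on_exp_herm UNIV_I])
  also have "\<dots> = exp (herm p \<zeta>) * cnj (mpow (\<zeta> - p) (a i))"
    by (simp add: mderiv_exp_herm herm_zero_left)
  finally show "FB_bar (jet_coeff S a p i) \<zeta> = jet_basis a p i \<zeta>"
    by (simp add: FB_bar_def jet_coeff_def holo_near_UNIV[OF holo_on_exp_fun] jet_basis_scale
        jet_scale_def exp_cnj cnj_herm mult_ac)
qed

lemma jet_coeff_in_jet_functionals:
  assumes p: "p \<in> S" and n: "mdeg (a i) \<le> n"
  shows "jet_coeff S a p i \<in> jet_functionals S p n"
  unfolding jet_functionals_def mem_Collect_eq
proof (intro exI ext)
  fix h
  let ?E = "\<lambda>z. exp (herm (z - p) (- p))"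
  let ?c = "\<lambda>\<gamma>. jet_scale (a i) p * mderiv (a i) (\<lambda>z. mpow (z - p) \<gamma> * ?E z) p / of_nat (mfact \<gamma>)"
  show "jet_coeff S a p i h = (if h \<in> holo_near S then \<Sum>\<gamma> | mdeg \<gamma> \<le> n. ?c \<gamma> * mderiv \<gamma> h p else 0)"
  proof (cases "h \<in> holo_near S")
    case True
    then obtain U where U: "open U" "S \<subseteq> U" "holo_on U h" by (auto simp: holo_near_def)
    have "p \<in> U" using p U by blast
    from mderiv_mult_exp[OF U(1,3) this n] show ?thesis
      using True by (simp add: jet_coeff_def sum_distrib_left mult_ac)
  qed (simp add: jet_coeff_def)
qed

text \<open>After multiplication with the weight, the basis functions are multiples of centred monomials.\<close>

lemma jet_coeff_jet_basis:
  assumes a: "inj a"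
  shows "jet_coeff S a p k (jet_basis a p i) = (if k = i then 1 else 0)"
proof -
  have "jet_basis a p i z * exp (herm (z - p) (- p))
      = jet_scale (a i) p * exp (herm p p) * mpow (z - p) (a i)" for z
  proof -
    have "exp (herm z p) * exp (herm (z - p) (- p)) = exp (herm p p)"
      unfolding exp_add[symmetric] by (simp add: herm_diff_left herm_minus_right)
    then show ?thesis
      by (simp add: jet_basis_scale mult.assoc mult.commute[of "exp (herm p p)"])
  qed
  then have "mderiv (a k) (\<lambda>z. jet_basis a p i z * exp (herm (z - p) (- p))) p
     = mderiv (a k) (\<lambda>z. jet_scale (a i) p * exp (herm p p) * mpow (z - p) (a i)) p" by simp
  also have "\<dots> = jet_scale (a i) p * exp (herm p p) * mderiv (a k) (\<lambda>z. mpow (z - p) (a i)) p"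
    unfolding mderiv_word by (rule word_deriv_cmult[OF open_UNIV holo_on_mpow UNIV_I])
  also have "\<dots> = (if k = i then jet_scale (a i) p * exp (herm p p) * of_nat (mfact (a i)) else 0)"
    using a by (simp add: mderiv_mpow_center inj_eq)
  finally show ?thesis
    using jet_scale_square[of "a i" p] mfact_pos[of "a i"]
    by (simp add: jet_coeff_def holo_near_UNIV[OF holo_on_jet_basis] mult_ac)
qed

section \<open>Injectivity of the Fourier-Borel transform\<close>

text \<open>The derivative in a coordinate direction can be computed along real increments.\<close>

lemma cpartial_vanishes_on_reals:
  assumes g: "holo_on UNIV g" and v: "\<And>x. g (cvec x) = 0"
  shows "cpartial i g (cvec x) = 0"
proof -
  let ?\<phi> = "\<lambda>t. g (cvec x + t *s axis i 1)"
  have real: "?\<phi> (complex_of_real s) = 0" for s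
  proof -
    have "cvec x + complex_of_real s *s axis i 1 = cvec (x + s *\<^sub>R axis i 1)"
      by (simp add: Finite_Cartesian_Product.vec_eq_iff cvec_def axis_def)
    then show ?thesis by (simp add: v)
  qed
  obtain a where a: "(g has_derivative a) (at (cvec x))" "\<And>c v. a (c *s v) = c * a v"
    using g UNIV_I by (rule holo_onD) blast
  have "(?\<phi> has_field_derivative a (axis i 1)) (at 0)"
    using has_derivative_line[of g a "cvec x" 0] a by simp
  then have lim: "((\<lambda>s. (?\<phi> s - ?\<phi> 0) / s) \<longlongrightarrow> a (axis i 1)) (at 0)"
    by (simp add: DERIV_def)
  let ?t = "\<lambda>n. complex_of_real (1 / real (Suc n))"
  have "?t \<longlonglongrightarrow> complex_of_real 0"
    by (intro tendsto_of_real LIMSEQ_inverse_real_of_nat[unfolded inverse_eq_divide])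
  moreover have "?t n \<noteq> 0" for n unfolding of_real_eq_0_iff by simp
  ultimately have "filterlim ?t (at 0) sequentially"
    by (intro filterlim_atI) auto
  from filterlim_compose[OF lim this] have "(\<lambda>n. 0) \<longlonglongrightarrow> a (axis i 1)"
    using real[of 0] by (simp only: real of_real_0 diff_self div_0)
  then have "a (axis i 1) = 0" using LIMSEQ_unique tendsto_const by blast
  then show ?thesis by (simp add: cpartial_eq[OF a])
qed

text \<open>If a holomorphic function vanishes at all real points, then so do its partial derivatives; and the
  derivatives of a polynomial at \<open>0\<close> are its coefficients up to factorials.\<close>

lemma real_zero_polynomial_coeff:
  fixes \<Gamma> :: "('n::finite \<Rightarrow> nat) set"
  assumes fin: "finite \<Gamma>" and z: "\<And>x. (\<Sum>\<gamma>\<in>\<Gamma>. c \<gamma> * mpow (cvec x) \<gamma>) = 0" and \<delta>: "\<delta> \<in> \<Gamma>"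
  shows "c \<delta> = 0"
proof -
  define P where "P z = (\<Sum>\<gamma>\<in>\<Gamma>. c \<gamma> * mpow (z - 0) \<gamma>)" for z
  have P: "holo_on UNIV P"
    unfolding P_def by (intro holo_on_sum holo_on_mult holo_on_const holo_on_mpow)
  have "holo_on UNIV (word_deriv is P) \<and> (\<forall>x. word_deriv is P (cvec x) = 0)" for "is"
  proof (induction "is")
    case Nil
    have "P (cvec x) = 0" for x using z by (simp add: P_def)
    then show ?case using P by simp
  next
    case (Cons i "is")
    then show ?case by (auto intro: holo_on_cpartial cpartial_vanishes_on_reals)
  qed
  then have "word_deriv (sorted_word \<delta>) P (cvec 0) = 0" by blast
  moreover have "cvec 0 = (0 :: complex ^ 'n)" by (simp add: cvec_def Finite_Cartesian_Product.vec_eq_iff)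
  moreover have "word_deriv (sorted_word \<delta>) P 0 = (\<Sum>\<gamma>\<in>\<Gamma>. c \<gamma> * mderiv \<delta> (\<lambda>z. mpow (z - 0) \<gamma>) 0)"
    unfolding P_def mderiv_word
    by (subst word_deriv_sum[OF open_UNIV _ UNIV_I fin])
       (auto intro!: holo_on_mult holo_on_const holo_on_mpow[of _ 0, simplified] sum.cong
         word_deriv_cmult[OF open_UNIV])
  ultimately have "(\<Sum>\<gamma>\<in>\<Gamma>. c \<gamma> * mderiv \<delta> (\<lambda>z. mpow (z - 0) \<gamma>) 0) = 0" by simp
  then have "c \<delta> * of_nat (mfact \<delta>) = 0"
    unfolding mderiv_mpow_center using \<delta> fin
    by (simp add: if_distrib[of "\<lambda>x. _ * x"] cong: if_cong)
  then show ?thesis using mfact_pos[of \<delta>] by simp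
qed

text \<open>The sets on whose germs the Fourier-Borel transform is shown to be injective: those with a
  base of neighbourhoods that are circled about \<open>p\<close>, so that the Taylor expansion at \<open>p\<close> of every
  germ converges on a neighbourhood of the set.\<close>

definition circled_about :: "complex ^ 'n::finite \<Rightarrow> (complex ^ 'n) set \<Rightarrow> bool" where
  "circled_about p V \<longleftrightarrow> (\<forall>z\<in>V. \<forall>c. cmod c \<le> 1 \<longrightarrow> p + c *s (z - p) \<in> V)"

definition circled_base :: "complex ^ 'n::finite \<Rightarrow> (complex ^ 'n) set \<Rightarrow> bool" where
  "circled_base p S \<longleftrightarrow>
     (\<forall>U. open U \<and> S \<subseteq> U \<longrightarrow> (\<exists>V. open V \<and> S \<subseteq> V \<and> V \<subseteq> U \<and> circled_about p V))"

lemma circled_base_UNIV: "circled_base p UNIV"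
  by (auto simp: circled_base_def circled_about_def)

lemma absolutely_convex_smult:
  assumes "absolutely_convex K0" "z \<in> K0" "cmod c \<le> 1"
  shows "c *s z \<in> K0"
proof -
  have "c *s z + 0 *s z \<in> K0"
    using assms unfolding absolutely_convex_def by (metis add.right_neutral norm_zero)
  then show ?thesis by simp
qed

lemma circled_base_translate:
  assumes "compact K0" "absolutely_convex K0"
  shows "circled_base p ((\<lambda>z. p + z) ` K0)"
  unfolding circled_base_def
proof (intro allI impI)
  let ?K = "(\<lambda>z. p + z) ` K0"
  fix U assume U: "open U \<and> ?K \<subseteq> U"
  have "compact ?K" by (intro compact_continuous_image continuous_intros assms)
  then obtain \<epsilon> where \<epsilon>: "0 < \<epsilon>" "(\<Union>x\<in>?K. ball x \<epsilon>) \<subseteq> U"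
    using compact_subset_open_imp_ball_epsilon_subset[of ?K U] U by blast
  have "circled_about p (\<Union>x\<in>?K. ball x \<epsilon>)"
    unfolding circled_about_def
  proof (intro ballI allI impI)
    fix z c assume "z \<in> (\<Union>x\<in>?K. ball x \<epsilon>)" and c: "cmod c \<le> 1"
    then obtain k where k: "k \<in> K0" "dist (p + k) z < \<epsilon>" by auto
    have "p + c *s k \<in> ?K" using absolutely_convex_smult[OF assms(2) k(1) c] by simp
    moreover have "dist (p + c *s k) (p + c *s (z - p)) = cmod c * dist (p + k) z"
    proof -
      have "(p + c *s k) - (p + c *s (z - p)) = c *s ((p + k) - z)"
        by (simp add: Finite_Cartesian_Product.vec_eq_iff algebra_simps)
      then show ?thesis by (simp only: dist_norm norm_smult_vec)
    qed
    then have "dist (p + c *s k) (p + c *s (z - p)) < \<epsilon>"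
      using k(2) mult_right_mono[OF c zero_le_dist[of "p + k" z]] by simp
    ultimately show "p + c *s (z - p) \<in> (\<Union>x\<in>?K. ball x \<epsilon>)" by auto
  qed
  then show "\<exists>V. open V \<and> ?K \<subseteq> V \<and> V \<subseteq> U \<and> circled_about p V"
    using \<epsilon> by (intro exI[of _ "\<Union>x\<in>?K. ball x \<epsilon>"]) auto
qed

text \<open>The circled hull of \<open>L\<close> about \<open>p\<close> is compact and contained in \<open>V\<close>, so it has a positive distance to
  the complement of \<open>V\<close>. A dilation by a factor close to \<open>1\<close> moves its points by less than that.\<close>

lemma circled_enlarge:
  fixes p :: "complex ^ 'n::finite"
  assumes V: "open V" "circled_about p V" and L: "compact L" "L \<subseteq> V"
  obtains \<rho> L' where "1 < \<rho>" "compact L'" "L' \<subseteq> V"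
    "\<And>z t. z \<in> L \<Longrightarrow> cmod t \<le> \<rho> \<Longrightarrow> p + t *s (z - p) \<in> L'"
proof -
  let ?F = "\<lambda>(c, z). p + c *s (z - p)"
  have cont: "continuous_on X ?F" for X :: "(complex \<times> (complex ^ 'n)) set"
  proof -
    have "(\<lambda>x. fst x *s (snd x - p)) = (\<lambda>x. \<chi> i. fst x * (snd x $ i - p $ i))"
      by (simp add: fun_eq_iff Finite_Cartesian_Product.vec_eq_iff algebra_simps)
    moreover have "continuous_on X (\<lambda>x. \<chi> i. fst x * (snd x $ i - p $ i))"
      by (intro continuous_intros)
    ultimately show ?thesis
      unfolding case_prod_unfold by (intro continuous_on_add continuous_on_const) (simp only:)
  qed
  define A where "A = ?F ` (cball 0 1 \<times> L)"
  have "compact A" unfolding A_def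
    by (intro compact_continuous_image[OF cont] compact_Times compact_cball L)
  moreover have "A \<subseteq> V" using V(2) L(2) by (auto simp: A_def circled_about_def)
  ultimately obtain \<epsilon> where \<epsilon>: "0 < \<epsilon>" "(\<Union>x\<in>A. cball x \<epsilon>) \<subseteq> V"
    using compact_subset_open_imp_cball_epsilon_subset[OF _ V(1)] by blast
  obtain D where D: "\<And>z. z \<in> L \<Longrightarrow> norm (z - p) \<le> D"
  proof -
    have "bounded ((\<lambda>z. z - p) ` L)"
      by (intro compact_imp_bounded compact_continuous_image continuous_intros L)
    then show ?thesis using that by (auto simp: bounded_iff)
  qed
  define \<rho> where "\<rho> = 1 + \<epsilon> / (\<bar>D\<bar> + 1)"
  have \<rho>: "1 < \<rho>" using \<epsilon> by (simp add: \<rho>_def)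
  define L' where "L' = ?F ` (cball 0 \<rho> \<times> L)"
  have "compact L'" unfolding L'_def
    by (intro compact_continuous_image[OF cont] compact_Times compact_cball L)
  moreover have "L' \<subseteq> V"
  proof
    fix x assume "x \<in> L'"
    then obtain t z where t: "cmod t \<le> \<rho>" and z: "z \<in> L" and x: "x = p + t *s (z - p)"
      by (auto simp: L'_def)
    let ?c = "t / complex_of_real \<rho>"
    have "cmod ?c \<le> 1" using t \<rho> by (simp add: norm_divide)
    then have "p + ?c *s (z - p) \<in> A" using z by (force simp: A_def)
    moreover have "dist (p + ?c *s (z - p)) x \<le> \<epsilon>"
    proof -
      have "(p + ?c *s (z - p)) - x = (?c * complex_of_real (1 - \<rho>)) *s (z - p)"
        using \<rho> by (simp add: x Finite_Cartesian_Product.vec_eq_iff field_simps)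
      then have "dist (p + ?c *s (z - p)) x = cmod ?c * (\<rho> - 1) * norm (z - p)"
        using \<rho> by (simp only: dist_norm norm_smult_vec norm_mult norm_of_real) simp
      also have "\<dots> \<le> 1 * (\<rho> - 1) * (\<bar>D\<bar> + 1)"
        using \<open>cmod ?c \<le> 1\<close> \<rho> D[OF z] by (intro mult_mono) auto
      also have "\<dots> = \<epsilon>" by (simp add: \<rho>_def)
      finally show ?thesis .
    qed
    ultimately show "x \<in> V" using \<epsilon>(2) by (meson UN_I mem_cball subsetD)
  qed
  moreover have "p + t *s (z - p) \<in> L'" if "z \<in> L" "cmod t \<le> \<rho>" for z t
    using that by (force simp: L'_def)
  ultimately show ?thesis using that \<rho> by blast
qed

lemma taylor_poly_uniform_limit:
  fixes p :: "complex ^ 'n::finite"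
  assumes V: "open V" "circled_about p V" and L: "compact L" "L \<subseteq> V" and h: "holo_on V h"
  obtains M q where "0 \<le> q" "q < 1" "0 \<le> M"
    "\<And>n z. z \<in> L \<Longrightarrow> cmod (h z - taylor_poly n h p (z - p)) \<le> M * q ^ Suc n"
proof -
  obtain \<rho> L' where \<rho>: "1 < \<rho>" and L': "compact L'" "L' \<subseteq> V"
    and in_L': "\<And>z t. z \<in> L \<Longrightarrow> cmod t \<le> \<rho> \<Longrightarrow> p + t *s (z - p) \<in> L'"
    by (rule circled_enlarge[OF V L]) blast
  obtain M where M: "0 \<le> M" "\<And>y. y \<in> L' \<Longrightarrow> cmod (h y) \<le> M"
    using continuous_on_compact_bound[OF holo_on_continuous[OF holo_on_subset[OF h L'(2)]] L'(1)] by blast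
  have "cmod (h (p + (z - p)) - taylor_poly n h p (z - p)) \<le> M * (1 / \<rho>) ^ Suc n / (1 - 1 / \<rho>)"
    if "z \<in> L" for n z
  proof (rule taylor_poly_remainder[OF V(1) h \<rho>])
    fix t :: complex assume "t \<in> ball 0 \<rho>"
    then have "p + t *s (z - p) \<in> L'" using that by (intro in_L') auto
    then show "p + t *s (z - p) \<in> V \<and> cmod (h (p + t *s (z - p))) \<le> M"
      using M(2) L'(2) by blast
  qed
  then have "cmod (h z - taylor_poly n h p (z - p)) \<le> M / (1 - 1 / \<rho>) * (1 / \<rho>) ^ Suc n"
    if "z \<in> L" for n z
    using that by (simp only: times_divide_eq_left add_diff_cancel_left' add_diff_eq)
  then show ?thesis
    by (rule that[rotated 3]) (use \<rho> M(1) in auto)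
qed

lemma analytic_dualD:
  assumes "\<nu> \<in> analytic_dual S"
  shows "h \<notin> holo_near S \<Longrightarrow> \<nu> h = 0"
    and "g \<in> holo_near S \<Longrightarrow> h \<in> holo_near S \<Longrightarrow> \<nu> (\<lambda>z. g z + h z) = \<nu> g + \<nu> h"
    and "h \<in> holo_near S \<Longrightarrow> \<nu> (\<lambda>z. c * h z) = c * \<nu> h"
    and "open U \<Longrightarrow> S \<subseteq> U \<Longrightarrow> \<exists>L A. compact L \<and> L \<subseteq> U \<and>
       (\<forall>h B. holo_on U h \<and> 0 \<le> B \<and> (\<forall>z\<in>L. cmod (h z) \<le> B) \<longrightarrow> cmod (\<nu> h) \<le> A * B)"
  using assms by (simp_all add: analytic_dual_def)

lemma analytic_dual_diff:
  assumes \<nu>: "\<nu> \<in> analytic_dual S" and "g \<in> holo_near S" "h \<in> holo_near S"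
  shows "\<nu> (\<lambda>z. g z - h z) = \<nu> g - \<nu> h"
proof -
  have "\<nu> (\<lambda>z. g z + (-1) * h z) = \<nu> g + \<nu> (\<lambda>z. (-1) * h z)"
    by (intro analytic_dualD(2)[OF \<nu>] holo_near_cmult assms)
  also have "\<nu> (\<lambda>z. (-1) * h z) = (-1) * \<nu> h"
    by (rule analytic_dualD(3)[OF \<nu> assms(3)])
  finally show ?thesis by simp
qed

lemma analytic_dual_sum:
  assumes \<nu>: "\<nu> \<in> analytic_dual S" and "finite A" and "\<And>i. i \<in> A \<Longrightarrow> g i \<in> holo_near S"
  shows "\<nu> (\<lambda>z. \<Sum>i\<in>A. c i * g i z) = (\<Sum>i\<in>A. c i * \<nu> (g i))"
  using assms(2,3)
proof (induction A)
  case empty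
  have "\<nu> (\<lambda>z. 0 * 0) = 0 * \<nu> (\<lambda>z. 0)"
    by (intro analytic_dualD(3)[OF \<nu>] holo_near_UNIV holo_on_const)
  then show ?case by simp
next
  case (insert i A)
  have n: "(\<lambda>z. c j * g j z) \<in> holo_near S" if "j \<in> insert i A" for j
    using insert that by (intro holo_near_cmult) auto
  have s: "(\<lambda>z. \<Sum>i\<in>A. c i * g i z) \<in> holo_near S"
    using insert(1) n
  proof (induction A)
    case empty
    show ?case using holo_near_UNIV[OF holo_on_const, of 0 S] by simp
  next
    case (insert j A)
    have "(\<lambda>z. c j * g j z + (\<Sum>i\<in>A. c i * g i z)) \<in> holo_near S"
      using insert by (intro holo_near_add) auto
    then show ?case using insert by simp
  qed
  have "\<nu> (\<lambda>z. c i * g i z + (\<Sum>i\<in>A. c i * g i z)) = \<nu> (\<lambda>z. c i * g i z) + \<nu> (\<lambda>z. \<Sum>i\<in>A. c i * g i z)"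
    using n[of i] s by (intro analytic_dualD(2)[OF \<nu>]) auto
  moreover have "\<nu> (\<lambda>z. c i * g i z) = c i * \<nu> (g i)"
    using insert by (intro analytic_dualD(3)[OF \<nu>]) auto
  ultimately show ?case using insert by simp
qed

text \<open>The Taylor polynomials converge uniformly on the compact set that controls the functional on the
  functions holomorphic on \<open>V\<close>, so a functional is determined by its moments about \<open>p\<close>.\<close>

lemma analytic_dual_taylor_limit:
  fixes p :: "complex ^ 'n::finite"
  assumes \<nu>: "\<nu> \<in> analytic_dual S" and S: "circled_base p S" and h: "h \<in> holo_near S"
  shows "(\<lambda>n. \<Sum>\<gamma> | mdeg \<gamma> \<le> n. mderiv \<gamma> h p / of_nat (mfact \<gamma>) * \<nu> (\<lambda>z. mpow (z - p) \<gamma>))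
     \<longlonglongrightarrow> \<nu> h"
proof -
  obtain U where U: "open U" "S \<subseteq> U" "holo_on U h" using h by (auto simp: holo_near_def)
  obtain V where V: "open V" "S \<subseteq> V" "V \<subseteq> U" "circled_about p V"
    using S[unfolded circled_base_def, rule_format, of U] U by auto
  have hV: "holo_on V h" by (rule holo_on_subset[OF U(3) V(3)])
  obtain L A where L: "compact L" "L \<subseteq> V"
    and A': "\<forall>g B. holo_on V g \<and> 0 \<le> B \<and> (\<forall>z\<in>L. cmod (g z) \<le> B) \<longrightarrow> cmod (\<nu> g) \<le> A * B"
    using analytic_dualD(4)[OF \<nu> V(1,2)] by (elim exE conjE) (rule that)
  have A: "cmod (\<nu> g) \<le> A * B"
    if "holo_on V g" "0 \<le> B" "\<And>z. z \<in> L \<Longrightarrow> cmod (g z) \<le> B" for g B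
    using A' that by simp
  obtain M q where q: "0 \<le> q" "q < 1" "0 \<le> M"
    and M: "\<And>n z. z \<in> L \<Longrightarrow> cmod (h z - taylor_poly n h p (z - p)) \<le> M * q ^ Suc n"
    by (rule taylor_poly_uniform_limit[OF V(1,4) L hV]) blast
  let ?T = "\<lambda>n z. taylor_poly n h p (z - p)"
  have hT: "holo_on UNIV (?T n)" for n
    unfolding taylor_poly_def by (intro holo_on_sum holo_on_mult holo_on_const holo_on_mpow)
  have \<nu>T: "\<nu> (?T n) = (\<Sum>\<gamma> | mdeg \<gamma> \<le> n. mderiv \<gamma> h p / of_nat (mfact \<gamma>) * \<nu> (\<lambda>z. mpow (z - p) \<gamma>))" for n
    unfolding taylor_poly_def
    by (intro analytic_dual_sum[OF \<nu> finite_mdeg_le] holo_near_UNIV holo_on_mpow)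
  have "cmod (\<nu> h - \<nu> (?T n)) \<le> A * (M * q ^ Suc n)" for n
  proof -
    have "\<nu> h - \<nu> (?T n) = \<nu> (\<lambda>z. h z - ?T n z)"
      using analytic_dual_diff[OF \<nu> h holo_near_UNIV[OF hT]] by simp
    also have "cmod \<dots> \<le> A * (M * q ^ Suc n)"
      using M q by (intro A holo_on_diff hV holo_on_subset[OF hT]) auto
    finally show ?thesis .
  qed
  then have ev: "eventually (\<lambda>n. norm (\<nu> h - \<nu> (?T n)) \<le> A * (M * q ^ Suc n)) sequentially"
    by simp
  have "(\<lambda>n. A * (M * q ^ Suc n)) \<longlonglongrightarrow> 0"
  proof -
    have "(\<lambda>n. q ^ Suc n) \<longlonglongrightarrow> 0" using q by (intro LIMSEQ_Suc LIMSEQ_realpow_zero) auto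
    from tendsto_mult_left[OF tendsto_mult_left[OF this, of M], of A] show ?thesis by simp
  qed
  then have "(\<lambda>n. \<nu> h - \<nu> (?T n)) \<longlonglongrightarrow> 0" by (rule Lim_null_comparison[OF ev])
  from tendsto_diff[OF tendsto_const this, of "\<nu> h"] show ?thesis by (simp add: \<nu>T)
qed

lemma entire_powser_zero:
  fixes a :: "nat \<Rightarrow> complex"
  assumes "\<And>t. (\<lambda>k. a k * t ^ k) sums 0"
  shows "a k = 0"
proof (cases "k = 0")
  case True
  have "(\<lambda>n. a n * 0 ^ n) sums 0" by (rule assms)
  then show ?thesis using True by simp
next
  case False
  show ?thesis
  proof (rule ccontr)
    assume "a k \<noteq> 0"
    show False
    proof (rule powser_0_nonzero[of 1 0 a "\<lambda>_. 0" k])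
      show "(\<lambda>n. a n * (x - 0) ^ n) sums 0" for x using assms[of x] by simp
      show False if s: "0 < s" "\<And>z::complex. z \<in> cball 0 s - {0} \<Longrightarrow> (0 :: complex) \<noteq> 0" for s
        using s(2)[of "of_real s"] s(1) by simp
    qed (use False \<open>a k \<noteq> 0\<close> in auto)
  qed
qed

text \<open>Along the ray through \<open>\<zeta>\<close>, the transform is a power series in the ray parameter whose
  coefficients are polynomials in \<open>\<zeta>\<close> with the moments of the functional as coefficients. So the
  transform determines the moments, and these determine the functional.\<close>

theorem inj_on_FB_bar:
  fixes S :: "(complex ^ 'n::finite) set"
  assumes S: "circled_base p S"
  shows "inj_on FB_bar (analytic_dual S)"
proof (rule inj_onI)
  fix \<nu>1 \<nu>2 assume \<nu>1: "\<nu>1 \<in> analytic_dual S" and \<nu>2: "\<nu>2 \<in> analytic_dual S"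
    and eq: "FB_bar \<nu>1 = FB_bar \<nu>2"
  define m where "m \<gamma> = \<nu>1 (\<lambda>z. mpow (z - p) \<gamma>) - \<nu>2 (\<lambda>z. mpow (z - p) \<gamma>)" for \<gamma>
  have lim: "(\<lambda>n. \<Sum>\<gamma> | mdeg \<gamma> \<le> n. mderiv \<gamma> h p / of_nat (mfact \<gamma>) * m \<gamma>) \<longlonglongrightarrow> \<nu>1 h - \<nu>2 h"
    if "h \<in> holo_near S" for h
    using tendsto_diff[OF analytic_dual_taylor_limit[OF \<nu>1 S that] analytic_dual_taylor_limit[OF \<nu>2 S that]]
    by (simp add: m_def right_diff_distrib sum_subtractf)
  have exp0: "\<nu>1 (exp_fun \<zeta>) = \<nu>2 (exp_fun \<zeta>)" for \<zeta>
    using fun_cong[OF eq, of \<zeta>] by (simp add: FB_bar_def)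
  define Q where "Q k \<zeta> = (\<Sum>\<gamma> | mdeg \<gamma> = k. (m \<gamma> / of_nat (mfact \<gamma>)) * cnj (mpow \<zeta> \<gamma>))" for k \<zeta>
  (* Up to conjugation and the factor exp_fun \<zeta> p, Q k is the homogeneous part of degree k of the
     difference of the two transforms. *)
  have Q0: "Q k \<zeta> = 0" for k \<zeta>
  proof (rule entire_powser_zero)
    fix t
    have mp: "mpow (cnj t *s \<zeta>) \<gamma> = cnj t ^ mdeg \<gamma> * mpow \<zeta> \<gamma>" for \<gamma>
      by (simp add: mpow_def mdeg_def power_mult_distrib prod.distrib power_sum)
    let ?h = "exp_fun (cnj t *s \<zeta>)"
    have md: "mderiv \<gamma> ?h p = ?h p * (t ^ mdeg \<gamma> * cnj (mpow \<zeta> \<gamma>))" for \<gamma>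
    proof -
      have "mderiv \<gamma> (\<lambda>z. exp (herm (z - 0) (cnj t *s \<zeta>))) = (\<lambda>z. cnj (mpow (cnj t *s \<zeta>) \<gamma>) * exp (herm (z - 0) (cnj t *s \<zeta>)))"
        by (rule mderiv_exp_herm)
      then show ?thesis by (simp add: exp_fun_def[abs_def] mp mult_ac)
    qed
    have "(\<Sum>\<gamma> | mdeg \<gamma> \<le> n. mderiv \<gamma> ?h p / of_nat (mfact \<gamma>) * m \<gamma>) = ?h p * (\<Sum>k<Suc n. Q k \<zeta> * t ^ k)" for n
    proof -
      have "(\<Sum>k\<le>n. Q k \<zeta> * t ^ k) = (\<Sum>k\<le>n. \<Sum>\<gamma>\<in>{\<gamma> \<in> {\<gamma>. mdeg \<gamma> \<le> n}. mdeg \<gamma> = k}.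
          m \<gamma> / of_nat (mfact \<gamma>) * (t ^ mdeg \<gamma> * cnj (mpow \<zeta> \<gamma>)))"
      proof (rule sum.cong[OF refl])
        fix k assume "k \<in> {..n}"
        then have e: "{\<gamma> \<in> {\<gamma> :: 'n \<Rightarrow> nat. mdeg \<gamma> \<le> n}. mdeg \<gamma> = k} = {\<gamma>. mdeg \<gamma> = k}" by auto
        show "Q k \<zeta> * t ^ k = (\<Sum>\<gamma>\<in>{\<gamma> \<in> {\<gamma>. mdeg \<gamma> \<le> n}. mdeg \<gamma> = k}.
          m \<gamma> / of_nat (mfact \<gamma>) * (t ^ mdeg \<gamma> * cnj (mpow \<zeta> \<gamma>)))"
          unfolding e Q_def sum_distrib_right by (intro sum.cong refl) auto
      qed
      also have "\<dots> = (\<Sum>\<gamma> | mdeg \<gamma> \<le> n. m \<gamma> / of_nat (mfact \<gamma>) * (t ^ mdeg \<gamma> * cnj (mpow \<zeta> \<gamma>)))"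
        by (rule sum.group[OF finite_mdeg_le]) auto
      finally show ?thesis
        by (simp only: md lessThan_Suc_atMost) (simp add: sum_distrib_left mult_ac)
    qed
    with lim[OF holo_near_UNIV[OF holo_on_exp_fun], of "cnj t *s \<zeta>"]
    have "(\<lambda>n. ?h p * (\<Sum>k<Suc n. Q k \<zeta> * t ^ k)) \<longlonglongrightarrow> 0"
      by (simp only: exp0 diff_self)
    then have "(\<lambda>n. inverse (?h p) * (?h p * (\<Sum>k<Suc n. Q k \<zeta> * t ^ k))) \<longlonglongrightarrow> inverse (?h p) * 0"
      by (rule tendsto_mult_left)
    moreover have "?h p \<noteq> 0" by (simp add: exp_fun_def)
    ultimately have "(\<lambda>n. \<Sum>k<Suc n. Q k \<zeta> * t ^ k) \<longlonglongrightarrow> 0"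
      by (simp only: mult.assoc[symmetric] left_inverse mult_1 mult_zero_right simp_thms not_False_eq_True)
    then show "(\<lambda>k. Q k \<zeta> * t ^ k) sums 0"
      unfolding sums_def by (rule LIMSEQ_imp_Suc)
  qed
  have m0: "m \<delta> = 0" for \<delta>
  proof -
    have "m \<delta> / of_nat (mfact \<delta>) = 0"
    proof (rule real_zero_polynomial_coeff[OF finite_mdeg_eq[of "mdeg \<delta>"], where c = "\<lambda>\<gamma>. m \<gamma> / of_nat (mfact \<gamma>)"])
      fix x :: "real ^ 'n"
      have "cnj (mpow (cvec x) \<gamma>) = mpow (cvec x) \<gamma>" for \<gamma>
        by (simp add: mpow_def cvec_def)
      then show "(\<Sum>\<gamma> | mdeg \<gamma> = mdeg \<delta>. m \<gamma> / of_nat (mfact \<gamma>) * mpow (cvec x) \<gamma>) = 0"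
        using Q0[of "mdeg \<delta>" "cvec x"] by (simp add: Q_def)
    qed simp
    then show ?thesis using mfact_pos[of \<delta>] by simp
  qed
  show "\<nu>1 = \<nu>2"
  proof
    fix h
    show "\<nu>1 h = \<nu>2 h"
    proof (cases "h \<in> holo_near S")
      case True
      from lim[OF this] have "(\<lambda>n. 0) \<longlonglongrightarrow> \<nu>1 h - \<nu>2 h" by (simp add: m0)
      then have "\<nu>1 h - \<nu>2 h = 0" using LIMSEQ_unique tendsto_const by blast
      then show ?thesis by simp
    next
      case False
      then show ?thesis by (simp add: analytic_dualD(1)[OF \<nu>1] analytic_dualD(1)[OF \<nu>2])
    qed
  qed
qed

lemma FB_bar_inv_jet_basis:
  assumes "circled_base p S" "p \<in> S"
  shows "FB_bar_inv S (jet_basis a p i) = jet_coeff S a p i"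
  unfolding FB_bar_inv_def
proof (rule inv_into_f_eq)
  show "inj_on FB_bar (analytic_dual S)" by (rule inj_on_FB_bar[OF assms(1)])
  show "jet_coeff S a p i \<in> analytic_dual S" by (rule jet_coeff_in_analytic_dual[OF assms(2)])
  show "FB_bar (jet_coeff S a p i) = jet_basis a p i" by (rule FB_bar_jet_coeff)
qed

text \<open>The entries of the representation matrix of the push-forward are the expansion
  coefficients of the functions \<open>jet_basis b (f p) i \<circ> f\<close>, since the functionals that represent the
  basis of the target are dual to the functions \<open>jet_basis b (f p) i\<close>.\<close>

lemma representation_matrix_entry:
  assumes S: "circled_base p S" "p \<in> S" and b: "inj b"
    and C: "representation_matrix (restrict (push_forward f) (jet_functionals S p m))
          k (\<lambda>i. FB_bar_inv S (jet_basis a p i)) l (\<lambda>i. FB_bar_inv UNIV (jet_basis b (f p) i)) C"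
    and ij: "i < l" "j < k" "mdeg (a j) \<le> m"
  shows "C $$ (i, j) = jet_coeff S a p j (\<lambda>z. jet_basis b (f p) i (f z))"
proof -
  let ?v = "jet_basis b (f p) i"
  have 1: "FB_bar_inv S (jet_basis a p j) = jet_coeff S a p j" for j
    by (rule FB_bar_inv_jet_basis[OF S])
  have 2: "FB_bar_inv UNIV (jet_basis b (f p) i) = jet_coeff UNIV b (f p) i" for i
    by (rule FB_bar_inv_jet_basis[OF circled_base_UNIV UNIV_I])
  have "restrict (push_forward f) (jet_functionals S p m) (jet_coeff S a p j)
     = (\<lambda>h. \<Sum>i<l. C $$ (i, j) * jet_coeff UNIV b (f p) i h)"
    using C ij unfolding representation_matrix_def 1 2 by simp
  then have "push_forward f (jet_coeff S a p j) ?v = (\<Sum>i<l. C $$ (i, j) * jet_coeff UNIV b (f p) i ?v)"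
    using jet_coeff_in_jet_functionals[OF S(2), of a j m] ij(3) by (simp add: restrict_def fun_eq_iff)
  also have "\<dots> = C $$ (i, j)"
    using ij by (simp add: jet_coeff_jet_basis[OF b] if_distrib[of "\<lambda>x. _ * x"] cong: if_cong)
  finally show ?thesis
    by (simp add: push_forward_def holo_near_UNIV[OF holo_on_jet_basis] o_def)
qed

text \<open>The factor \<open>exp (herm (z - p) (- p))\<close> turns the basis functions into multiples of centred monomials,
  and \<open>jet_scale_square\<close> matches the scalings with the factorials of the Taylor polynomial.\<close>

lemma jet_expansion:
  assumes a: "bij_betw a I {\<gamma>. mdeg \<gamma> \<le> n}" and h: "h \<in> holo_near S"
  shows "(\<Sum>i\<in>I. jet_coeff S a p i h * jet_basis a p i (p + w))
    = taylor_poly n (\<lambda>z. h z * exp (herm (z - p) (- p))) p w * exp (herm w p)"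
proof -
  have "jet_coeff S a p i h * jet_basis a p i (p + w)
      = (\<lambda>\<gamma>. mderiv \<gamma> (\<lambda>z. h z * exp (herm (z - p) (- p))) p / of_nat (mfact \<gamma>) * mpow w \<gamma>) (a i) * exp (herm w p)" for i
  proof -
    have "herm (p + w) p = herm p p + herm w p" by (simp add: herm_def algebra_simps sum.distrib)
    then have "jet_coeff S a p i h * jet_basis a p i (p + w)
       = (jet_scale (a i) p * jet_scale (a i) p * exp (herm p p)) *
         (mderiv (a i) (\<lambda>z. h z * exp (herm (z - p) (- p))) p * mpow w (a i) * exp (herm w p))"
      using h by (simp add: jet_coeff_def jet_basis_scale exp_add mult_ac)
    then show ?thesis by (simp add: jet_scale_square)
  qed
  then show ?thesis
    unfolding taylor_poly_def sum_distrib_right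
    using sum.reindex_bij_betw[OF a, of "\<lambda>\<gamma>. mderiv \<gamma> (\<lambda>z. h z * exp (herm (z - p) (- p))) p /
      of_nat (mfact \<gamma>) * mpow w \<gamma> * exp (herm w p)"] by simp
qed

section \<open>Counting multi-indices\<close>

text \<open>Splitting according to the value at one more coordinate gives a sum of binomial coefficients along
  a diagonal of Pascal's triangle.\<close>

lemma card_bounded_degree:
  assumes "finite A"
  shows "finite {\<gamma> :: 'a \<Rightarrow> nat. (\<forall>i. i \<notin> A \<longrightarrow> \<gamma> i = 0) \<and> sum \<gamma> A \<le> n} \<and>
     card {\<gamma> :: 'a \<Rightarrow> nat. (\<forall>i. i \<notin> A \<longrightarrow> \<gamma> i = 0) \<and> sum \<gamma> A \<le> n} = (n + card A) choose card A"
  using assms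
proof (induction A arbitrary: n)
  case empty
  have "{\<gamma> :: 'a \<Rightarrow> nat. \<forall>i. \<gamma> i = 0} = {\<lambda>_. 0}" by auto
  then show ?case by simp
next
  case (insert a A)
  let ?T = "\<lambda>A n. {\<gamma> :: 'a \<Rightarrow> nat. (\<forall>i. i \<notin> A \<longrightarrow> \<gamma> i = 0) \<and> sum \<gamma> A \<le> n}"
  have upd: "sum (\<gamma>(a := k)) A = sum \<gamma> A" for \<gamma> :: "'a \<Rightarrow> nat" and k
    using insert by (intro sum.cong) auto
  have upd': "(\<Sum>x\<in>A. if x = a then k else \<gamma> x) = sum \<gamma> A" for \<gamma> :: "'a \<Rightarrow> nat" and k
    using insert by (intro sum.cong) auto
  have bij: "bij_betw (\<lambda>(k, \<gamma>). \<gamma>(a := k)) (SIGMA k:{..n}. ?T A (n - k)) (?T (insert a A) n)"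
  proof (rule bij_betw_byWitness[where f' = "\<lambda>\<gamma>. (\<gamma> a, \<gamma>(a := 0))"])
    show "\<forall>x\<in>SIGMA k:{..n}. ?T A (n - k). (\<lambda>\<gamma>. (\<gamma> a, \<gamma>(a := 0))) ((\<lambda>(k, \<gamma>). \<gamma>(a := k)) x) = x"
      using insert by (auto simp: fun_eq_iff)
    show "(\<lambda>(k, \<gamma>). \<gamma>(a := k)) ` (SIGMA k:{..n}. ?T A (n - k)) \<subseteq> ?T (insert a A) n"
      using insert by (auto simp: upd upd')
    show "(\<lambda>\<gamma>. (\<gamma> a, \<gamma>(a := 0))) ` ?T (insert a A) n \<subseteq> (SIGMA k:{..n}. ?T A (n - k))"
      using insert by (auto simp: upd upd')
  qed auto
  have "finite (SIGMA k:{..n}. ?T A (n - k))" using insert by (intro finite_SigmaI) auto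
  with bij have "finite (?T (insert a A) n)" using bij_betw_finite by blast
  moreover have "card (?T (insert a A) n) = (\<Sum>k\<le>n. card (?T A (n - k)))"
    using bij_betw_same_card[OF bij] insert by (simp add: card_SigmaI)
  moreover have "(\<Sum>k\<le>n. card (?T A (n - k))) = (\<Sum>k\<le>n. (card A + (n - k)) choose card A)"
    using insert by (simp add: add.commute)
  moreover have "\<dots> = (\<Sum>k\<le>n. (card A + k) choose card A)"
    by (rule sum.reindex_bij_witness[where i = "\<lambda>k. n - k" and j = "\<lambda>k. n - k"]) auto
  moreover have "\<dots> = (card A + n + 1) choose (card A + 1)"
    by (rule choose_rising_sum(1))
  ultimately show ?case using insert by (simp add: add_ac)
qed

lemma card_mdeg_le: "card {\<gamma> :: 'n::finite \<Rightarrow> nat. mdeg \<gamma> \<le> n} = jet_dim CARD('n) n"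
  using card_bounded_degree[of "UNIV :: 'n set" n] by (simp add: mdeg_def jet_dim_def)

lemma finite_downward_closed_nat:
  fixes D :: "nat set"
  assumes "finite D" "\<And>i j. j \<in> D \<Longrightarrow> i \<le> j \<Longrightarrow> i \<in> D"
  shows "D = {..<card D}"
proof -
  define m where "m = (LEAST m. m \<notin> D)"
  have ex: "\<exists>m. m \<notin> D" using assms(1) by (metis UNIV_eq_I infinite_UNIV_nat)
  have "m \<notin> D" unfolding m_def using ex by (rule LeastI_ex)
  then have "D = {..<m}"
    using assms(2) not_less_Least[of _ "\<lambda>m. m \<notin> D"] unfolding m_def[symmetric]
    by (metis lessThan_iff linorder_not_less subsetI subset_antisym)
  then show ?thesis by simp
qed

text \<open>Since the degree is monotone along the numbering, the indices of the multi-indices of degree at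
  most \<open>n\<close> form an initial segment of the natural numbers, whose length is their number.\<close>

lemma graded_numbering_less_iff:
  fixes a :: "nat \<Rightarrow> 'n::finite \<Rightarrow> nat"
  assumes a: "graded_numbering a"
  shows "mdeg (a j) \<le> n \<longleftrightarrow> j < jet_dim CARD('n) n"
proof -
  let ?D = "{j. mdeg (a j) \<le> n}"
  have bij: "bij a" and mono: "\<And>i j. i \<le> j \<Longrightarrow> mdeg (a i) \<le> mdeg (a j)"
    using a by (auto simp: graded_numbering_def)
  have "a ` ?D = {\<gamma>. mdeg \<gamma> \<le> n}"
    using bij_is_surj[OF bij] by (auto simp: surj_def image_iff)
  moreover have inj: "inj_on a ?D" using bij_is_inj[OF bij] by (rule inj_on_subset) simp
  ultimately have "card ?D = jet_dim CARD('n) n" "finite ?D"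
    using card_image[OF inj] finite_image_iff[OF inj] by (auto simp: card_mdeg_le finite_mdeg_le)
  moreover have "?D = {..<card ?D}"
    by (rule finite_downward_closed_nat[OF \<open>finite ?D\<close>]) (use mono order_trans in blast)
  ultimately show ?thesis by auto
qed

lemma graded_numbering_bij_betw:
  fixes a :: "nat \<Rightarrow> 'n::finite \<Rightarrow> nat"
  assumes a: "graded_numbering a"
  shows "bij_betw a {..<jet_dim CARD('n) n} {\<gamma>. mdeg \<gamma> \<le> n}"
proof -
  have bij: "bij a" using a by (simp add: graded_numbering_def)
  have "a ` {..<jet_dim CARD('n) n} = {\<gamma>. mdeg \<gamma> \<le> n}"
  proof safe
    fix \<gamma> :: "'n \<Rightarrow> nat" assume "mdeg \<gamma> \<le> n"
    moreover obtain j where "\<gamma> = a j" using bij_is_surj[OF bij] by (metis surjD)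
    ultimately show "\<gamma> \<in> a ` {..<jet_dim CARD('n) n}"
      by (auto simp: graded_numbering_less_iff[OF a])
  qed (simp add: graded_numbering_less_iff[OF a])
  then show ?thesis
    using bij_is_inj[OF bij] by (auto simp: bij_betw_def intro: inj_on_subset)
qed

lemma jet_dim_mono: "m \<le> n \<Longrightarrow> jet_dim d m \<le> jet_dim d n"
  unfolding jet_dim_def by (rule binomial_right_mono) simp

lemma jet_dim_pos: "0 < jet_dim d n"
  by (simp add: jet_dim_def)

lemma mfact_le_fact_mdeg: "mfact (a :: 'n::finite \<Rightarrow> nat) \<le> fact (mdeg a)"
proof -
  have "finite A \<Longrightarrow> (\<Prod>i\<in>A. fact (a i)) \<le> (fact (sum a A) :: nat)" for A :: "'n set"
  proof (induction A rule: finite_induct)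
    case (insert i A)
    have "fact (a i) * (\<Prod>i\<in>A. fact (a i)) \<le> fact (a i) * (fact (sum a A) :: nat)"
      using insert by simp
    also have "\<dots> \<le> fact (a i + sum a A)"
      using fact_fact_dvd_fact[of "a i" "sum a A", where 'a = nat] by (intro dvd_imp_le) auto
    finally show ?case using insert by simp
  qed simp
  then show ?thesis by (simp add: mfact_def mdeg_def)
qed

section \<open>Least squares and eigenvalues\<close>

lemma mat_adjoint_carrier: "A \<in> carrier_mat n m \<Longrightarrow> mat_adjoint A \<in> carrier_mat m n"
  by (auto simp: mat_adjoint_def)

lemma mat_adjoint_index:
  fixes A :: "complex mat"
  assumes "i < dim_col A" "j < dim_row A"
  shows "mat_adjoint A $$ (i, j) = cnj (A $$ (j, i))"
  using assms by (simp add: mat_adjoint_def mat_of_rows_index)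

lemma mat_adjoint_dim [simp]:
  "dim_row (mat_adjoint A) = dim_col A" "dim_col (mat_adjoint A) = dim_row A"
  by (simp_all add: mat_adjoint_def)

lemma mat_adjoint_adjoint: "mat_adjoint (mat_adjoint A) = (A :: complex mat)"
  by (rule eq_matI) (simp_all add: mat_adjoint_index)

lemma mat_mult_index_sum:
  assumes "A \<in> carrier_mat n m" "B \<in> carrier_mat m k" "i < n" "j < k"
  shows "(A * B) $$ (i, j) = (\<Sum>l<m. A $$ (i, l) * B $$ (l, j))"
  using assms by (simp add: scalar_prod_def atLeast0LessThan)

lemma mat_adjoint_mult:
  fixes A B :: "complex mat"
  assumes A: "A \<in> carrier_mat n m" and B: "B \<in> carrier_mat m k"
  shows "mat_adjoint (A * B) = mat_adjoint B * mat_adjoint A"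
proof (rule eq_matI)
  show "mat_adjoint (A * B) $$ (i, j) = (mat_adjoint B * mat_adjoint A) $$ (i, j)"
    if "i < dim_row (mat_adjoint B * mat_adjoint A)" "j < dim_col (mat_adjoint B * mat_adjoint A)" for i j
  proof -
    have ij: "i < k" "j < n" using that A B by auto
    have "mat_adjoint (A * B) $$ (i, j) = cnj ((A * B) $$ (j, i))"
      using A B ij by (intro mat_adjoint_index) auto
    also have "\<dots> = (\<Sum>l<m. cnj (A $$ (j, l)) * cnj (B $$ (l, i)))"
      using mat_mult_index_sum[OF A B ij(2,1)] by simp
    also have "\<dots> = (\<Sum>l<m. mat_adjoint B $$ (i, l) * mat_adjoint A $$ (l, j))"
      using A B ij by (intro sum.cong) (auto simp: mat_adjoint_index)
    also have "\<dots> = (mat_adjoint B * mat_adjoint A) $$ (i, j)"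
      by (rule mat_mult_index_sum[OF mat_adjoint_carrier[OF B] mat_adjoint_carrier[OF A] ij, symmetric])
    finally show ?thesis .
  qed
qed (use A B in auto)

lemma mat_inverse_if_kernel_trivial:
  fixes G :: "complex mat"
  assumes G: "G \<in> carrier_mat r r"
    and ker: "\<And>v. v \<in> carrier_vec r \<Longrightarrow> G *\<^sub>v v = 0\<^sub>v r \<Longrightarrow> v = 0\<^sub>v r"
  obtains H where "H \<in> carrier_mat r r" "G * H = 1\<^sub>m r" "H * G = 1\<^sub>m r"
proof -
  have "det G \<noteq> 0" using det_0_iff_vec_prod_zero_field[OF G] ker by blast
  from det_non_zero_imp_unit[OF G this] show ?thesis
    using that by (auto simp: Units_def ring_mat_def)
qed

text \<open>The matrix \<open>X = U H\<close> is a right inverse of the adjoint \<open>A\<close> of \<open>U\<close> such that \<open>X A\<close> is Hermitian.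
  Any solution \<open>Y\<close> of the Penrose equations is then a right inverse as well. The Hermitian matrices
  \<open>X A\<close> and \<open>Y A\<close> absorb each other, so they are equal, and \<open>Y = Y A Y = X A Y = X\<close>.\<close>

lemma pseudo_inverse_mat_adjoint:
  fixes U :: "complex mat"
  assumes U: "U \<in> carrier_mat N r" and H: "H \<in> carrier_mat r r"
    and GH: "mat_adjoint U * U * H = 1\<^sub>m r" and HG: "H * (mat_adjoint U * U) = 1\<^sub>m r"
  shows "pseudo_inverse (mat_adjoint U) = U * H"
proof -
  let ?A = "mat_adjoint U" and ?X = "U * H"
  have A: "?A \<in> carrier_mat r N" using U by (rule mat_adjoint_carrier)
  have X: "?X \<in> carrier_mat N r" using U H by simp
  have G: "?A * U \<in> carrier_mat r r" using A U by simp
  have adj1: "mat_adjoint (1\<^sub>m r :: complex mat) = 1\<^sub>m r"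
    by (rule eq_matI) (auto simp: mat_adjoint_index)
  have AX: "?A * ?X = 1\<^sub>m r" using GH by (simp add: assoc_mult_mat[OF A U H])
  have Hadj: "mat_adjoint H = H"
  proof -
    have Gadj: "mat_adjoint (?A * U) = ?A * U"
      by (simp add: mat_adjoint_mult[OF A U] mat_adjoint_adjoint)
    have HaG: "mat_adjoint H * (?A * U) = 1\<^sub>m r"
      using arg_cong[OF GH, of mat_adjoint] by (simp add: mat_adjoint_mult[OF G H] Gadj adj1)
    have "mat_adjoint H = mat_adjoint H * (?A * U * H)"
      by (simp only: GH right_mult_one_mat[OF mat_adjoint_carrier[OF H]])
    also have "\<dots> = mat_adjoint H * (?A * U) * H"
      by (rule assoc_mult_mat[OF mat_adjoint_carrier[OF H] G H, symmetric])
    also have "\<dots> = H" using HaG H by simp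
    finally show ?thesis .
  qed
  have XA: "mat_adjoint (?X * ?A) = ?X * ?A"
  proof -
    have "mat_adjoint (?X * ?A) = U * (mat_adjoint ?X)"
      by (simp add: mat_adjoint_mult[OF X A] mat_adjoint_adjoint)
    also have "mat_adjoint ?X = H * ?A" by (simp add: mat_adjoint_mult[OF U H] Hadj)
    also have "U * (H * ?A) = ?X * ?A" by (rule assoc_mult_mat[OF U H A, symmetric])
    finally show ?thesis .
  qed
  have AXA: "?A * ?X * ?A = ?A" by (simp only: AX left_mult_one_mat[OF A])
  have XAX: "?X * ?A * ?X = ?X"
    by (simp only: assoc_mult_mat[OF X A X] AX right_mult_one_mat[OF X])
  show ?thesis
    unfolding pseudo_inverse_def
  proof (rule the_equality)
    show "?X \<in> carrier_mat (dim_col ?A) (dim_row ?A) \<and> ?A * ?X * ?A = ?A \<and> ?X * ?A * ?X = ?X \<and>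
        mat_adjoint (?A * ?X) = ?A * ?X \<and> mat_adjoint (?X * ?A) = ?X * ?A"
      using X U by (simp add: AX AXA XAX XA adj1)
  next
    fix Y assume Y': "Y \<in> carrier_mat (dim_col ?A) (dim_row ?A) \<and> ?A * Y * ?A = ?A \<and> Y * ?A * Y = Y \<and>
        mat_adjoint (?A * Y) = ?A * Y \<and> mat_adjoint (Y * ?A) = Y * ?A"
    then have Y: "Y \<in> carrier_mat N r" and AYA: "?A * Y * ?A = ?A" and YAY: "Y * ?A * Y = Y"
      and YA: "mat_adjoint (Y * ?A) = Y * ?A" using U by auto
    have cYA: "Y * ?A \<in> carrier_mat N N" and cXA: "?X * ?A \<in> carrier_mat N N"
      and cAY: "?A * Y \<in> carrier_mat r r" using Y X A by auto
    have AY: "?A * Y = 1\<^sub>m r"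
    proof -
      have "?A * Y = ?A * Y * (?A * ?X)" by (simp only: AX right_mult_one_mat[OF cAY])
      also have "\<dots> = ?A * Y * ?A * ?X" by (rule assoc_mult_mat[OF cAY A X, symmetric])
      finally show ?thesis by (simp add: AYA AX)
    qed
    have 1: "(Y * ?A) * (?X * ?A) = Y * ?A"
    proof -
      have "(Y * ?A) * (?X * ?A) = Y * (?A * (?X * ?A))"
        by (rule assoc_mult_mat[OF Y A cXA])
      also have "?A * (?X * ?A) = ?A * ?X * ?A" by (rule assoc_mult_mat[OF A X A, symmetric])
      finally show ?thesis by (simp add: AXA)
    qed
    have 2: "(?X * ?A) * (Y * ?A) = ?X * ?A"
    proof -
      have "(?X * ?A) * (Y * ?A) = ?X * (?A * (Y * ?A))"
        by (rule assoc_mult_mat[OF X A cYA])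
      also have "?A * (Y * ?A) = ?A * Y * ?A" by (rule assoc_mult_mat[OF A Y A, symmetric])
      finally show ?thesis by (simp add: AYA)
    qed
    have "?X * ?A = mat_adjoint ((?X * ?A) * (Y * ?A))" by (simp only: 2 XA)
    also have "\<dots> = (Y * ?A) * (?X * ?A)" by (simp only: mat_adjoint_mult[OF cXA cYA] XA YA)
    finally have eq: "?X * ?A = Y * ?A" by (simp only: 1)
    have "Y = Y * ?A * Y" by (simp only: YAY)
    also have "\<dots> = ?X * ?A * Y" by (simp only: eq)
    also have "\<dots> = ?X" by (simp only: assoc_mult_mat[OF X A Y] AY right_mult_one_mat[OF X])
    finally show "Y = ?X" .
  qed
qed

text \<open>The estimator is \<open>A = V\<^sup>* U (U\<^sup>* U)\<^sup>-\<^sup>1\<close>, hence \<open>A U\<^sup>* U = V\<^sup>* U\<close>. Conjugated, these are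
  the normal equations for the least squares fit of the columns of \<open>V\<close> by those of \<open>U\<close>, with
  the conjugated rows of \<open>A\<close> as solutions.\<close>

lemma pseudo_inverse_normal_equations:
  fixes U V :: "complex mat"
  assumes U: "U \<in> carrier_mat N r" and V: "V \<in> carrier_mat N s"
    and ker: "\<And>c. (\<And>k. k < N \<Longrightarrow> (\<Sum>j<r. U $$ (k, j) * c j) = 0) \<Longrightarrow> (\<And>j. j < r \<Longrightarrow> c j = 0)"
    and i: "i < s" and l: "l < r"
  shows "(\<Sum>k<N. (\<Sum>j<r. cnj ((mat_adjoint V * pseudo_inverse (mat_adjoint U)) $$ (i, j)) * U $$ (k, j)) * cnj (U $$ (k, l)))
     = (\<Sum>k<N. V $$ (k, i) * cnj (U $$ (k, l)))"
proof -
  let ?G = "mat_adjoint U * U"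
  have Ua: "mat_adjoint U \<in> carrier_mat r N" and Va: "mat_adjoint V \<in> carrier_mat s N"
    using U V by (auto intro: mat_adjoint_carrier)
  have G: "?G \<in> carrier_mat r r" using Ua U by simp
  have Gij: "?G $$ (i, j) = (\<Sum>k<N. cnj (U $$ (k, i)) * U $$ (k, j))" if "i < r" "j < r" for i j
    unfolding mat_mult_index_sum[OF Ua U that] using U that
    by (intro sum.cong) (auto simp: mat_adjoint_index)
  obtain H where H: "H \<in> carrier_mat r r" "?G * H = 1\<^sub>m r" "H * ?G = 1\<^sub>m r"
  proof (rule mat_inverse_if_kernel_trivial[OF G])
    fix v assume v: "v \<in> carrier_vec r" "?G *\<^sub>v v = 0\<^sub>v r"
    have Gv: "(\<Sum>j<r. ?G $$ (i, j) * vec_index v j) = 0" if "i < r" for i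
    proof -
      have "vec_index (?G *\<^sub>v v) i = (\<Sum>j<r. ?G $$ (i, j) * vec_index v j)"
        using v(1) that G by (simp add: scalar_prod_def atLeast0LessThan del: index_mult_mat)
      then show ?thesis using v(2) that by simp
    qed
    define Uv where "Uv k = (\<Sum>j<r. U $$ (k, j) * vec_index v j)" for k
    have "(\<Sum>k<N. cnj (Uv k) * Uv k) = (\<Sum>k<N. \<Sum>i<r. \<Sum>j<r. cnj (vec_index v i) * (cnj (U $$ (k, i)) * U $$ (k, j) * vec_index v j))"
      unfolding Uv_def cnj_sum sum_product by (intro sum.cong) auto
    also have "\<dots> = (\<Sum>i<r. \<Sum>j<r. \<Sum>k<N. cnj (vec_index v i) * (cnj (U $$ (k, i)) * U $$ (k, j) * vec_index v j))"
      by (subst sum.swap) (intro sum.cong refl sum.swap)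
    also have "\<dots> = (\<Sum>i<r. cnj (vec_index v i) * (\<Sum>j<r. ?G $$ (i, j) * vec_index v j))"
      by (intro sum.cong refl) (simp add: Gij sum_distrib_left sum_distrib_right)
    also have "\<dots> = 0" using Gv by simp
    finally have "(\<Sum>k<N. complex_of_real ((cmod (Uv k))\<^sup>2)) = 0"
      by (simp add: complex_norm_square mult.commute del: of_real_power)
    then have "(\<Sum>k<N. (cmod (Uv k))\<^sup>2) = 0"
      unfolding of_real_sum[symmetric] of_real_eq_0_iff .
    then have "Uv k = 0" if "k < N" for k
      using that by (subst (asm) sum_nonneg_eq_0_iff) auto
    then have "vec_index v j = 0" if "j < r" for j
      using ker[of "vec_index v" j] that by (simp add: Uv_def)
    then show "v = 0\<^sub>v r" using v(1) by (intro eq_vecI) auto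
  qed blast
  define A where "A = mat_adjoint V * pseudo_inverse (mat_adjoint U)"
  have P: "pseudo_inverse (mat_adjoint U) = U * H"
    by (rule pseudo_inverse_mat_adjoint[OF U H])
  have A: "A \<in> carrier_mat s r" unfolding A_def P using Va U H by simp
  have UH: "U * H \<in> carrier_mat N r" using U H by simp
  have "A * ?G = mat_adjoint V * (U * H * ?G)"
    unfolding A_def P by (rule assoc_mult_mat[OF Va UH G])
  also have "U * H * ?G = U * (H * ?G)" by (rule assoc_mult_mat[OF U H(1) G])
  also have "\<dots> = U" using U by (simp add: H(3))
  finally have AG: "(A * ?G) $$ (i, l) = (mat_adjoint V * U) $$ (i, l)" by simp
  have "(\<Sum>j<r. A $$ (i, j) * (\<Sum>k<N. cnj (U $$ (k, j)) * U $$ (k, l))) = (A * ?G) $$ (i, l)"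
    unfolding mat_mult_index_sum[OF A G i l] using l by (intro sum.cong) (auto simp: Gij)
  also have "\<dots> = (\<Sum>k<N. cnj (V $$ (k, i)) * U $$ (k, l))"
    unfolding AG mat_mult_index_sum[OF Va U i l] using V i
    by (intro sum.cong) (auto simp: mat_adjoint_index)
  finally have "(\<Sum>j<r. A $$ (i, j) * (\<Sum>k<N. cnj (U $$ (k, j)) * U $$ (k, l)))
      = (\<Sum>k<N. cnj (V $$ (k, i)) * U $$ (k, l))" .
  from arg_cong[OF this, of cnj]
  have "(\<Sum>j<r. \<Sum>k<N. cnj (A $$ (i, j)) * (U $$ (k, j) * cnj (U $$ (k, l))))
      = (\<Sum>k<N. V $$ (k, i) * cnj (U $$ (k, l)))"
    by (simp add: sum_distrib_left)
  then show ?thesis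
    unfolding A_def[symmetric] sum_distrib_right by (subst sum.swap) (simp add: mult.assoc)
qed

definition mat_apply :: "nat \<Rightarrow> (nat \<Rightarrow> nat \<Rightarrow> complex) \<Rightarrow> (nat \<Rightarrow> complex) \<Rightarrow> nat \<Rightarrow> complex" where
  "mat_apply r B c i = (\<Sum>j<r. B i j * c j)"

definition sqnorm :: "nat \<Rightarrow> (nat \<Rightarrow> complex) \<Rightarrow> real" where
  "sqnorm r c = (\<Sum>i<r. (cmod (c i))\<^sup>2)"

definition quad_form :: "nat \<Rightarrow> (nat \<Rightarrow> nat \<Rightarrow> complex) \<Rightarrow> (nat \<Rightarrow> complex) \<Rightarrow> real" where
  "quad_form r B c = Re (\<Sum>i<r. cnj (c i) * mat_apply r B c i)"

lemma sqnorm_nonneg: "0 \<le> sqnorm r c"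
  by (simp add: sqnorm_def sum_nonneg)

lemma sqnorm_Re: "sqnorm r c = Re (\<Sum>i<r. cnj (c i) * c i)"
  unfolding sqnorm_def Re_sum by (intro sum.cong refl) (simp add: cmod_def power2_eq_square)

lemma quad_form_abs_le:
  "\<bar>quad_form r B c\<bar> \<le> (\<Sum>i<r. \<Sum>j<r. cmod (B i j)) * sqnorm r c"
proof -
  have le: "cmod (c i) \<le> sqrt (sqnorm r c)" if "i < r" for i
  proof -
    have "(cmod (c i))\<^sup>2 \<le> sqnorm r c"
      unfolding sqnorm_def using that by (intro member_le_sum) auto
    then show ?thesis by (rule real_le_rsqrt)
  qed
  have "\<bar>quad_form r B c\<bar> \<le> cmod (\<Sum>i<r. cnj (c i) * mat_apply r B c i)"
    unfolding quad_form_def by (rule abs_Re_le_cmod)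
  also have "\<dots> \<le> (\<Sum>i<r. \<Sum>j<r. cmod (cnj (c i) * (B i j * c j)))"
    unfolding mat_apply_def sum_distrib_left by (intro order_trans[OF norm_sum] sum_mono order_refl)
  also have "\<dots> \<le> (\<Sum>i<r. \<Sum>j<r. cmod (B i j) * sqnorm r c)"
  proof (intro sum_mono)
    fix i j assume ij: "i \<in> {..<r}" "j \<in> {..<r}"
    have "cmod (c i) * cmod (c j) \<le> sqrt (sqnorm r c) * sqrt (sqnorm r c)"
      using ij le by (intro mult_mono) (auto simp: sqnorm_nonneg)
    then have "cmod (B i j) * (cmod (c i) * cmod (c j)) \<le> cmod (B i j) * sqnorm r c"
      by (intro mult_left_mono) (auto simp: sqnorm_nonneg)
    then show "cmod (cnj (c i) * (B i j * c j)) \<le> cmod (B i j) * sqnorm r c"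
      by (simp add: norm_mult mult_ac)
  qed
  finally show ?thesis by (simp add: sum_distrib_right)
qed

text \<open>For a positive semidefinite Hermitian form, \<open>B c\<close> is controlled by the form: expand the
  form at \<open>c - t B c\<close> and choose \<open>t = 1 / M\<close>.\<close>

lemma sqnorm_mat_apply_le_quad_form:
  assumes herm: "\<And>i j. i < r \<Longrightarrow> j < r \<Longrightarrow> B i j = cnj (B j i)"
    and psd: "\<And>c. 0 \<le> quad_form r B c"
    and M: "0 < M" "\<And>c. quad_form r B c \<le> M * sqnorm r c"
  shows "sqnorm r (mat_apply r B c) \<le> M * quad_form r B c"
proof -
  define y where "y = mat_apply r B c"
  define t where "t = 1 / M"
  have lin: "mat_apply r B (\<lambda>i. c i - of_real t * y i) i = y i - of_real t * mat_apply r B y i" for i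
    unfolding y_def mat_apply_def by (simp add: right_diff_distrib sum_subtractf sum_distrib_left mult_ac)
  have sym: "(\<Sum>i<r. cnj (c i) * mat_apply r B y i) = (\<Sum>i<r. cnj (y i) * y i)"
  proof -
    have "(\<Sum>i<r. cnj (c i) * mat_apply r B y i) = (\<Sum>i<r. \<Sum>j<r. cnj (B j i * c i) * y j)"
      unfolding mat_apply_def sum_distrib_left by (intro sum.cong refl) (subst herm, auto)
    also have "\<dots> = (\<Sum>j<r. \<Sum>i<r. cnj (B j i * c i) * y j)" by (rule sum.swap)
    also have "\<dots> = (\<Sum>j<r. cnj (y j) * y j)"
      by (simp add: y_def mat_apply_def sum_distrib_right)
    finally show ?thesis .
  qed
  have "(\<Sum>i<r. cnj (c i - of_real t * y i) * mat_apply r B (\<lambda>i. c i - of_real t * y i) i)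
     = (\<Sum>i<r. cnj (c i) * y i) - of_real t * (\<Sum>i<r. cnj (c i) * mat_apply r B y i)
       - of_real t * (\<Sum>i<r. cnj (y i) * y i) + of_real (t * t) * (\<Sum>i<r. cnj (y i) * mat_apply r B y i)"
    unfolding lin
    by (simp add: algebra_simps sum.distrib sum_subtractf sum_distrib_left)
  from arg_cong[OF this, of Re]
  have "quad_form r B (\<lambda>i. c i - of_real t * y i)
     = quad_form r B c - t * sqnorm r y - t * sqnorm r y + t * t * quad_form r B y"
    unfolding quad_form_def[of r B "\<lambda>i. c i - of_real t * y i"] sym
    by (simp add: quad_form_def sqnorm_Re y_def[symmetric])
  also have "\<dots> \<le> quad_form r B c - t * sqnorm r y - t * sqnorm r y + t * t * (M * sqnorm r y)"
    using M(2)[of y] by (intro add_left_mono mult_left_mono) auto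
  also have "\<dots> = quad_form r B c - t * sqnorm r y" using M(1) by (simp add: t_def)
  finally have "t * sqnorm r y \<le> quad_form r B c"
    using psd[of "\<lambda>i. c i - of_real t * y i"] by linarith
  then show ?thesis using M(1) by (simp add: t_def y_def field_simps)
qed

lemma eigenvalue_iff_mat_apply:
  fixes D :: "complex mat"
  assumes D: "D \<in> carrier_mat r r"
  shows "eigenvalue D e \<longleftrightarrow>
    (\<exists>c. (\<exists>i<r. c i \<noteq> 0) \<and> (\<forall>i<r. mat_apply r (\<lambda>i j. D $$ (i, j)) c i = e * c i))"
proof
  have mv: "vec_index (D *\<^sub>v v) i = mat_apply r (\<lambda>i j. D $$ (i, j)) (vec_index v) i"
    if "v \<in> carrier_vec r" "i < r" for v i
    using that D by (simp add: mat_apply_def scalar_prod_def atLeast0LessThan)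
  {
    assume "eigenvalue D e"
    then obtain v where v: "v \<in> carrier_vec r" "v \<noteq> 0\<^sub>v r" "D *\<^sub>v v = e \<cdot>\<^sub>v v"
      using D by (auto simp: eigenvalue_def eigenvector_def)
    have "\<exists>i<r. vec_index v i \<noteq> 0"
    proof (rule ccontr)
      assume "\<not> (\<exists>i<r. vec_index v i \<noteq> 0)"
      then have "v = 0\<^sub>v r" using v(1) by (intro eq_vecI) auto
      with v(2) show False by simp
    qed
    moreover have "\<forall>i<r. mat_apply r (\<lambda>i j. D $$ (i, j)) (vec_index v) i = e * vec_index v i"
      using v(1) by (auto simp: mv[symmetric] v(3))
    ultimately show "\<exists>c. (\<exists>i<r. c i \<noteq> 0) \<and> (\<forall>i<r. mat_apply r (\<lambda>i j. D $$ (i, j)) c i = e * c i)"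
      by blast
  }
  assume "\<exists>c. (\<exists>i<r. c i \<noteq> 0) \<and> (\<forall>i<r. mat_apply r (\<lambda>i j. D $$ (i, j)) c i = e * c i)"
  then obtain c where c: "\<exists>i<r. c i \<noteq> 0" "\<forall>i<r. mat_apply r (\<lambda>i j. D $$ (i, j)) c i = e * c i" by blast
  let ?v = "Matrix.vec r c"
  have "mat_apply r B (vec_index ?v) i = mat_apply r B c i" for B i
    unfolding mat_apply_def by (intro sum.cong) auto
  then have "D *\<^sub>v ?v = e \<cdot>\<^sub>v ?v"
    using D c(2) by (intro eq_vecI) (simp_all add: mv del: index_mult_mat_vec)
  moreover have "?v \<noteq> 0\<^sub>v r"
  proof
    assume "?v = 0\<^sub>v r"
    then have "vec_index ?v i = 0" if "i < r" for i using that by simp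
    with c(1) show False by auto
  qed
  ultimately show "eigenvalue D e"
    using D unfolding eigenvalue_def eigenvector_def by (intro exI[of _ ?v]) auto
qed

text \<open>Let \<open>m\<close> be the infimum of the form on the unit sphere. If it were not an eigenvalue, then \<open>D\<close>
  minus \<open>m\<close> would be positive semidefinite and invertible, hence bounded below on the unit sphere by a
  positive constant, contrary to the choice of \<open>m\<close>.\<close>

lemma infimum_is_eigenvalue:
  fixes D :: "complex mat"
  assumes D: "D \<in> carrier_mat r r" and r: "0 < r"
    and herm: "\<And>i j. i < r \<Longrightarrow> j < r \<Longrightarrow> D $$ (i, j) = cnj (D $$ (j, i))"
  obtains m where "eigenvalue D (complex_of_real m)"
    "\<And>c. m * sqnorm r c \<le> quad_form r (\<lambda>i j. D $$ (i, j)) c"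
proof -
  let ?D = "\<lambda>i j. D $$ (i, j)"
  define m where "m = Inf {quad_form r ?D c | c. sqnorm r c = 1}"
  have unit: "sqnorm r (\<lambda>i. if i = 0 then 1 else 0) = 1"
    using r by (simp add: sqnorm_def if_distrib[of cmod] if_distrib[of "\<lambda>x. x\<^sup>2"] cong: if_cong)
  have bdd: "bdd_below {quad_form r ?D c | c. sqnorm r c = 1}"
  proof (rule bdd_belowI)
    fix x assume "x \<in> {quad_form r ?D c | c. sqnorm r c = 1}"
    then obtain c where "x = quad_form r ?D c" "sqnorm r c = 1" by blast
    then show "- (\<Sum>i<r. \<Sum>j<r. cmod (?D i j)) \<le> x"
      using quad_form_abs_le[of r ?D c] by simp
  qed
  have m1: "m \<le> quad_form r ?D c" if "sqnorm r c = 1" for c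
    unfolding m_def using that by (intro cInf_lower bdd) auto
  have scale: "quad_form r B (\<lambda>i. of_real s * c i) = s\<^sup>2 * quad_form r B c" for s B c
  proof -
    have "(\<Sum>i<r. cnj (of_real s * c i) * mat_apply r B (\<lambda>i. of_real s * c i) i)
       = of_real (s\<^sup>2) * (\<Sum>i<r. cnj (c i) * mat_apply r B c i)"
      unfolding mat_apply_def sum_distrib_left by (intro sum.cong refl) (simp add: power2_eq_square mult_ac)
    then show ?thesis unfolding quad_form_def by (simp del: of_real_power)
  qed
  have sscale: "sqnorm r (\<lambda>i. of_real s * c i) = s\<^sup>2 * sqnorm r c" for s c
    by (simp add: sqnorm_def norm_mult power_mult_distrib sum_distrib_left)
  have normalize: "\<exists>s. s\<^sup>2 * sqnorm r c = 1" if "sqnorm r c \<noteq> 0" for c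
    using that sqnorm_nonneg[of r c] by (intro exI[of _ "1 / sqrt (sqnorm r c)"]) (simp add: power_divide)
  have q0: "quad_form r B c = 0" if "sqnorm r c = 0" for B c
    using quad_form_abs_le[of r B c] that by simp
  have lower: "l * sqnorm r c \<le> quad_form r B c"
    if "\<And>c. sqnorm r c = 1 \<Longrightarrow> l \<le> quad_form r B c" for l B c
  proof (cases "sqnorm r c = 0")
    case True
    then show ?thesis by (simp add: q0)
  next
    case False
    then obtain s where s: "s\<^sup>2 * sqnorm r c = 1" using normalize by blast
    then have "l \<le> s\<^sup>2 * quad_form r B c"
      using that[of "\<lambda>i. of_real s * c i"] by (simp add: scale sscale)
    then have "l * sqnorm r c \<le> s\<^sup>2 * quad_form r B c * sqnorm r c"
      using sqnorm_nonneg by (rule mult_right_mono)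
    also have "\<dots> = quad_form r B c" using s by (simp add: mult_ac)
    finally show ?thesis .
  qed
  have m: "m * sqnorm r c \<le> quad_form r ?D c" for c using m1 by (rule lower)
  define B where "B i j = D $$ (i, j) - (if i = j then of_real m else 0)" for i j
  have Bapp: "mat_apply r B c i = mat_apply r ?D c i - of_real m * c i" if "i < r" for c i
    using that unfolding mat_apply_def B_def
    by (simp add: left_diff_distrib sum_subtractf if_distrib[of "\<lambda>x. x * _"] cong: if_cong)
  have Bq: "quad_form r B c = quad_form r ?D c - m * sqnorm r c" for c
  proof -
    have "(\<Sum>i<r. cnj (c i) * mat_apply r B c i)
       = (\<Sum>i<r. cnj (c i) * mat_apply r ?D c i) - of_real m * (\<Sum>i<r. cnj (c i) * c i)"
      by (simp add: Bapp right_diff_distrib sum_subtractf sum_distrib_left mult_ac)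
    from arg_cong[OF this, of Re] show ?thesis
      unfolding quad_form_def sqnorm_Re by simp
  qed
  have "eigenvalue D (complex_of_real m)"
  proof (rule ccontr)
    assume no: "\<not> eigenvalue D (complex_of_real m)"
    let ?B = "Matrix.mat r r (\<lambda>(i, j). B i j)"
    have Bc: "?B \<in> carrier_mat r r" by simp
    obtain H where H: "H \<in> carrier_mat r r" "H * ?B = 1\<^sub>m r"
    proof (rule mat_inverse_if_kernel_trivial[OF Bc])
      fix v assume v: "v \<in> carrier_vec r" "?B *\<^sub>v v = 0\<^sub>v r"
      have "mat_apply r ?D (vec_index v) i = of_real m * vec_index v i" if "i < r" for i
      proof -
        have "vec_index (?B *\<^sub>v v) i = mat_apply r B (vec_index v) i"
          using v(1) that by (simp add: mat_apply_def scalar_prod_def atLeast0LessThan)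
        then show ?thesis using v(2) that Bapp[OF that] by simp
      qed
      then have "\<not> (\<exists>i<r. vec_index v i \<noteq> 0)"
        using no unfolding eigenvalue_iff_mat_apply[OF D] by blast
      then show "v = 0\<^sub>v r" using v(1) by (intro eq_vecI) auto
    qed blast
    define h where "h = 1 + (\<Sum>i<r. \<Sum>j<r. (cmod (H $$ (i, j)))\<^sup>2)"
    have h: "0 < h" unfolding h_def by (intro add_pos_nonneg sum_nonneg) auto
    have inv: "sqnorm r c \<le> h * sqnorm r (mat_apply r B c)" for c
    proof -
      have ci: "c i = (\<Sum>j<r. H $$ (i, j) * mat_apply r B c j)" if i: "i < r" for i
      proof -
        have "(\<Sum>j<r. H $$ (i, j) * mat_apply r B c j) = (\<Sum>k<r. (\<Sum>j<r. H $$ (i, j) * B j k) * c k)"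
          unfolding mat_apply_def sum_distrib_left sum_distrib_right by (subst sum.swap) (simp add: mult.assoc)
        also have "\<dots> = (\<Sum>k<r. (H * ?B) $$ (i, k) * c k)"
          using i by (intro sum.cong refl) (simp add: mat_mult_index_sum[OF H(1) Bc] del: index_mult_mat)
        also have "\<dots> = c i" using i by (simp add: H(2) if_distrib[of "\<lambda>x. x * _"] cong: if_cong)
        finally show ?thesis by simp
      qed
      have "sqnorm r c \<le> (\<Sum>i<r. (\<Sum>j<r. (cmod (H $$ (i, j)))\<^sup>2) * sqnorm r (mat_apply r B c))"
        unfolding sqnorm_def[of r c]
      proof (rule sum_mono)
        fix i assume "i \<in> {..<r}"
        then have "cmod (c i) \<le> (\<Sum>j<r. cmod (H $$ (i, j)) * cmod (mat_apply r B c j))"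
          using norm_sum[of "\<lambda>j. H $$ (i, j) * mat_apply r B c j" "{..<r}"] by (simp add: ci[of i] norm_mult)
        then have "(cmod (c i))\<^sup>2 \<le> (\<Sum>j<r. cmod (H $$ (i, j)) * cmod (mat_apply r B c j))\<^sup>2"
          by (intro power_mono) auto
        also have "\<dots> \<le> (\<Sum>j<r. (cmod (H $$ (i, j)))\<^sup>2) * (\<Sum>j<r. (cmod (mat_apply r B c j))\<^sup>2)"
          by (rule Cauchy_Schwarz_ineq_sum)
        finally show "(cmod (c i))\<^sup>2 \<le> (\<Sum>j<r. (cmod (H $$ (i, j)))\<^sup>2) * sqnorm r (mat_apply r B c)"
          by (simp add: sqnorm_def)
      qed
      also have "\<dots> = (h - 1) * sqnorm r (mat_apply r B c)"
        by (simp add: h_def sum_distrib_right)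
      also have "\<dots> \<le> h * sqnorm r (mat_apply r B c)"
        by (intro mult_right_mono sqnorm_nonneg) simp
      finally show ?thesis .
    qed
    define M where "M = 1 + (\<Sum>i<r. \<Sum>j<r. cmod (B i j))"
    have M: "0 < M" unfolding M_def by (intro add_pos_nonneg sum_nonneg) auto
    have Mq: "quad_form r B c \<le> M * sqnorm r c" for c
      using quad_form_abs_le[of r B c] sqnorm_nonneg[of r c] by (simp add: M_def algebra_simps)
    have le: "sqnorm r (mat_apply r B c) \<le> M * quad_form r B c" for c
    proof (rule sqnorm_mat_apply_le_quad_form[OF _ _ M Mq])
      show "B i j = cnj (B j i)" if "i < r" "j < r" for i j
        using herm[OF that] by (simp add: B_def)
      show "0 \<le> quad_form r B c" for c using m[of c] by (simp add: Bq)
    qed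
    have "m + 1 / (h * M) \<le> quad_form r ?D c" if "sqnorm r c = 1" for c
    proof -
      have "1 \<le> h * (M * quad_form r B c)"
        using inv[of c] mult_left_mono[OF le[of c], of h] h that by linarith
      then have "1 \<le> (quad_form r ?D c - m) * (h * M)" using that by (simp add: Bq mult_ac)
      then have "1 / (h * M) \<le> quad_form r ?D c - m" using h M by (simp add: pos_divide_le_eq)
      then show ?thesis by simp
    qed
    then have "m + 1 / (h * M) \<le> m"
      using unit unfolding m_def by (intro cInf_greatest) auto
    moreover have "0 < 1 / (h * M)" using h M by simp
    ultimately show False by linarith
  qed
  with m show ?thesis using that by blast
qed

text \<open>The minimum of the spectrum is at most the infimum of the form on the unit sphere, which is itself
  an eigenvalue; and it is positive because it is the value of the form at a unit eigenvector.\<close>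

theorem smallest_eigenvalue_bound:
  fixes D :: "complex mat"
  assumes D: "D \<in> carrier_mat r r" and r: "0 < r"
    and herm: "\<And>i j. i < r \<Longrightarrow> j < r \<Longrightarrow> D $$ (i, j) = cnj (D $$ (j, i))"
    and pd: "\<And>c i. i < r \<Longrightarrow> c i \<noteq> 0 \<Longrightarrow> 0 < quad_form r (\<lambda>i j. D $$ (i, j)) c"
  shows "0 < smallest_eigenvalue D"
    and "smallest_eigenvalue D * sqnorm r c \<le> quad_form r (\<lambda>i j. D $$ (i, j)) c"
proof -
  let ?S = "{l. eigenvalue D (complex_of_real l)}"
  have "finite {e. poly (char_poly D) e = 0}"
    using degree_monic_char_poly[OF D] by (intro poly_roots_finite) auto
  then have "finite (complex_of_real -` {e. poly (char_poly D) e = 0})"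
    by (rule finite_vimageI) (simp add: inj_of_real)
  then have fin: "finite ?S" by (simp add: eigenvalue_root_char_poly[OF D] vimage_def)
  obtain m where m: "eigenvalue D (complex_of_real m)"
    and lb: "\<And>c. m * sqnorm r c \<le> quad_form r (\<lambda>i j. D $$ (i, j)) c"
    using infimum_is_eigenvalue[OF D r herm] by blast
  have "smallest_eigenvalue D \<in> ?S"
    unfolding smallest_eigenvalue_def using fin m by (intro Min_in) auto
  then obtain v i where v: "i < r" "v i \<noteq> 0"
    and ev: "\<And>i. i < r \<Longrightarrow> mat_apply r (\<lambda>i j. D $$ (i, j)) v i = of_real (smallest_eigenvalue D) * v i"
    by (auto simp: eigenvalue_iff_mat_apply[OF D])
  have "quad_form r (\<lambda>i j. D $$ (i, j)) v = smallest_eigenvalue D * sqnorm r v"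
  proof -
    have "(\<Sum>i<r. cnj (v i) * mat_apply r (\<lambda>i j. D $$ (i, j)) v i)
       = of_real (smallest_eigenvalue D) * (\<Sum>i<r. cnj (v i) * v i)"
      unfolding sum_distrib_left by (intro sum.cong refl) (simp add: ev)
    then show ?thesis by (simp add: quad_form_def sqnorm_Re)
  qed
  with pd[where c = v and i = i, OF v] have "0 < smallest_eigenvalue D * sqnorm r v" by simp
  then show "0 < smallest_eigenvalue D"
    using sqnorm_nonneg[of r v] by (simp add: zero_less_mult_iff)
  have "smallest_eigenvalue D \<le> m"
    unfolding smallest_eigenvalue_def using fin m by (intro Min_le) auto
  then show "smallest_eigenvalue D * sqnorm r c \<le> quad_form r (\<lambda>i j. D $$ (i, j)) c"
    using lb[of c] mult_right_mono[OF \<open>smallest_eigenvalue D \<le> m\<close> sqnorm_nonneg[of r c]] by linarith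
qed

section \<open>Zero sets of polynomials are null sets\<close>

definition real_mono :: "('n::finite \<Rightarrow> nat) \<Rightarrow> real ^ 'n \<Rightarrow> real" where
  "real_mono \<gamma> y = (\<Prod>i\<in>UNIV. (y $ i) ^ \<gamma> i)"

lemma mpow_cvec: "mpow (cvec y) \<gamma> = complex_of_real (real_mono \<gamma> y)"
  by (simp add: mpow_def cvec_def real_mono_def)

lemma continuous_on_real_mono [continuous_intros]: "continuous_on S (real_mono \<gamma>)"
  unfolding real_mono_def[abs_def] by (intro continuous_intros)

lemma borel_measurable_real_mono [measurable]: "real_mono \<gamma> \<in> borel_measurable borel"
  by (intro borel_measurable_continuous_onI continuous_on_real_mono)

lemma polynomial_line_poly:
  fixes a x :: "real ^ 'n::finite"
  obtains q :: "complex poly" where "degree q \<le> n"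
    "\<And>s. poly q (complex_of_real s) = (\<Sum>\<gamma> | mdeg \<gamma> \<le> n. c \<gamma> * of_real (real_mono \<gamma> (a + s *\<^sub>R x)))"
proof
  let ?l = "\<lambda>i. [:complex_of_real (a $ i), complex_of_real (x $ i):]"
  let ?q = "\<Sum>\<gamma> | mdeg \<gamma> \<le> n. Polynomial.smult (c \<gamma>) (\<Prod>i\<in>UNIV. ?l i ^ \<gamma> i)"
  show "degree ?q \<le> n"
  proof (intro degree_sum_le finite_mdeg_le)
    fix \<gamma> :: "'n \<Rightarrow> nat" assume "\<gamma> \<in> {\<gamma>. mdeg \<gamma> \<le> n}"
    have "degree (?l i ^ \<gamma> i) \<le> \<gamma> i" for i
    proof -
      have "degree (?l i ^ \<gamma> i) \<le> degree (?l i) * \<gamma> i" by (rule degree_power_le)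
      also have "\<dots> \<le> 1 * \<gamma> i" by (intro mult_right_mono) (auto simp: degree_pCons_eq_if)
      finally show ?thesis by simp
    qed
    then have "sum (degree \<circ> (\<lambda>i. ?l i ^ \<gamma> i)) UNIV \<le> mdeg \<gamma>"
      unfolding mdeg_def o_def by (intro sum_mono) auto
    moreover have "degree (\<Prod>i\<in>UNIV. ?l i ^ \<gamma> i) \<le> sum (degree \<circ> (\<lambda>i. ?l i ^ \<gamma> i)) UNIV"
      by (rule degree_prod_sum_le) simp
    ultimately have "degree (\<Prod>i\<in>UNIV. ?l i ^ \<gamma> i) \<le> n"
      using \<open>\<gamma> \<in> _\<close> by simp
    then show "degree (Polynomial.smult (c \<gamma>) (\<Prod>i\<in>UNIV. ?l i ^ \<gamma> i)) \<le> n"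
      using degree_smult_le order_trans by blast
  qed
  show "poly ?q (complex_of_real s) = (\<Sum>\<gamma> | mdeg \<gamma> \<le> n. c \<gamma> * of_real (real_mono \<gamma> (a + s *\<^sub>R x)))" for s
    by (simp add: poly_sum poly_prod real_mono_def)
qed

text \<open>Centre at a point \<open>a\<close> where the polynomial does not vanish. Each ray from \<open>a\<close> contains at most
  \<open>n\<close> zeros, so a point lies in at most \<open>n\<close> of the dilates of the zero set by pairwise different
  factors \<open>1 + 1 / (j + 1)\<close>. Each of the dilates of a bounded part of the zero set is at least as
  large as this part, and they all lie in one ball. So the part has measure zero.\<close>

lemma polynomial_zero_set_null:
  fixes c :: "('n::finite \<Rightarrow> nat) \<Rightarrow> complex"
  assumes \<delta>: "mdeg \<delta> \<le> n" "c \<delta> \<noteq> 0"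
  shows "{x :: real ^ 'n. (\<Sum>\<gamma> | mdeg \<gamma> \<le> n. c \<gamma> * of_real (real_mono \<gamma> x)) = 0} \<in> null_sets lborel"
proof -
  define P where "P x = (\<Sum>\<gamma> | mdeg \<gamma> \<le> n. c \<gamma> * of_real (real_mono \<gamma> x))" for x :: "real ^ 'n"
  have contP: "continuous_on S P" for S
    unfolding P_def by (intro continuous_intros)
  have "\<exists>a. P a \<noteq> 0"
  proof (rule ccontr)
    assume "\<not> (\<exists>a. P a \<noteq> 0)"
    then have P0: "P x = 0" for x by simp
    have "c \<delta> = 0"
    proof (rule real_zero_polynomial_coeff[OF finite_mdeg_le])
      show "(\<Sum>\<gamma> | mdeg \<gamma> \<le> n. c \<gamma> * mpow (cvec x) \<gamma>) = 0" for x
        using P0[of x] by (simp add: P_def mpow_cvec)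
    qed (use \<delta>(1) in simp)
    with \<delta>(2) show False by simp
  qed
  then obtain a where a: "P a \<noteq> 0" by blast
  define W where "W R = {x \<in> cball 0 R. P (a + x) = 0}" for R :: real
  have closedW: "closed (W R)" for R
  proof -
    have "W R = cball 0 R \<inter> (\<lambda>x. P (a + x)) -` {0}" by (auto simp: W_def)
    moreover have "closed ((\<lambda>x. P (a + x)) -` {0})"
      by (intro closed_vimage continuous_on_compose2[OF contP[of UNIV]] continuous_intros) auto
    ultimately show ?thesis by (simp add: closed_Int)
  qed
  then have Wb [measurable]: "W R \<in> sets borel" for R by simp
  have nullW: "emeasure lborel (W R) = 0" if R: "0 < R" for R
  proof -
    define s where "s j = 1 + 1 / real (Suc j)" for j
    have s: "1 \<le> s j" "s j \<le> 2" for j by (simp_all add: s_def field_simps)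
    have s_inj: "inj s" by (auto simp: s_def inj_def)
    define V where "V j = {x. (1 / s j) *\<^sub>R x \<in> W R}" for j
    have V_eq: "V j = (\<lambda>x. 0 + (1 / s j) *\<^sub>R x) -` W R" for j by (auto simp: V_def)
    have Vb [measurable]: "V j \<in> sets borel" for j
      unfolding V_eq by (intro borel_closed closed_vimage closedW continuous_intros)
    have WV: "emeasure lborel (W R) \<le> emeasure lborel (V j)" for j
    proof -
      have "1 / s j \<noteq> 0" using s[of j] by auto
      from lborel_affine[OF this, of "0 :: real ^ 'n"]
      have "emeasure lborel (W R) = emeasure (density (distr lborel borel (\<lambda>x. 0 + (1 / s j) *\<^sub>R x))
          (\<lambda>_. ennreal (\<bar>1 / s j\<bar> ^ DIM(real ^ 'n)))) (W R)" by simp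
      also have "\<dots> = ennreal (\<bar>1 / s j\<bar> ^ DIM(real ^ 'n)) * emeasure (distr lborel borel (\<lambda>x. 0 + (1 / s j) *\<^sub>R x)) (W R)"
        by (subst emeasure_density) (auto simp: nn_integral_cmult_indicator)
      also have "emeasure (distr lborel borel (\<lambda>x. 0 + (1 / s j) *\<^sub>R x)) (W R) = emeasure lborel (V j)"
        unfolding V_eq by (subst emeasure_distr) auto
      also have "ennreal (\<bar>1 / s j\<bar> ^ DIM(real ^ 'n)) * emeasure lborel (V j) \<le> 1 * emeasure lborel (V j)"
        using s[of j] by (intro mult_right_mono) (auto intro!: power_le_one)
      finally show ?thesis by simp
    qed
    have cnt: "(\<Sum>j<N. indicator (V j) x) \<le> (of_nat n * indicator (cball 0 (2 * R)) x :: ennreal)" for N x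
    proof -
      let ?J = "{j \<in> {..<N}. x \<in> V j}"
      have sum: "(\<Sum>j<N. indicator (V j) x) = (of_nat (card ?J) :: ennreal)"
        by (simp add: indicator_def sum.If_cases Int_def)
      obtain q where q: "degree q \<le> n" "\<And>t. poly q (complex_of_real t) = P (a + t *\<^sub>R x)"
        unfolding P_def by (rule polynomial_line_poly[of n c a x]) blast
      have "q \<noteq> 0" using q(2)[of 0] a by auto
      have "card ?J = card ((\<lambda>j. complex_of_real (1 / s j)) ` ?J)"
        using s_inj by (intro card_image[symmetric] inj_onI) (auto simp: inj_eq)
      also have "\<dots> \<le> card {t. poly q t = 0}"
        using poly_roots_finite[OF \<open>q \<noteq> 0\<close>] q(2)
        by (intro card_mono) (auto simp: V_def W_def simp del: of_real_divide)
      also have "\<dots> \<le> n" using card_poly_roots_bound[OF \<open>q \<noteq> 0\<close>] q(1) by simp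
      finally have card: "card ?J \<le> n" .
      show ?thesis
      proof (cases "x \<in> cball 0 (2 * R)")
        case True
        then show ?thesis using card by (simp add: sum)
      next
        case False
        have "x \<notin> V j" for j
        proof
          assume "x \<in> V j"
          then have "norm x \<le> R * s j" using s[of j] by (simp add: V_def W_def field_simps)
          also have "\<dots> \<le> R * 2" using s[of j] R by (intro mult_left_mono) auto
          finally show False using False by simp
        qed
        then show ?thesis by simp
      qed
    qed
    have bound: "of_nat N * emeasure lborel (W R) \<le> of_nat n * emeasure lborel (cball (0 :: real ^ 'n) (2 * R))" for N
    proof -
      have "of_nat N * emeasure lborel (W R) = (\<Sum>j<N. emeasure lborel (W R))" by simp
      also have "\<dots> \<le> (\<Sum>j<N. emeasure lborel (V j))" by (intro sum_mono WV)
      also have "\<dots> = (\<integral>\<^sup>+x. (\<Sum>j<N. indicator (V j) x) \<partial>lborel)"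
        by (subst nn_integral_sum) auto
      also have "\<dots> \<le> (\<integral>\<^sup>+x. of_nat n * indicator (cball 0 (2 * R)) x \<partial>(lborel :: (real ^ 'n) measure))"
        by (intro nn_integral_mono cnt)
      also have "\<dots> = of_nat n * emeasure lborel (cball (0 :: real ^ 'n) (2 * R))"
        by (subst nn_integral_cmult_indicator) auto
      finally show ?thesis .
    qed
    have fin: "emeasure lborel (cball (0 :: real ^ 'n) r) < \<infinity>" for r by (rule emeasure_lborel_cball_finite)
    have "emeasure lborel (W R) \<le> emeasure lborel (cball (0 :: real ^ 'n) R)"
      by (intro emeasure_mono) (auto simp: W_def)
    then have "emeasure lborel (W R) < \<infinity>" using fin[of R] by (rule le_less_trans)
    then obtain w where w: "0 \<le> w" "emeasure lborel (W R) = ennreal w"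
      by (cases "emeasure lborel (W R)") auto
    obtain b where b: "0 \<le> b" "emeasure lborel (cball (0 :: real ^ 'n) (2 * R)) = ennreal b"
      using fin[of "2 * R"] by (cases "emeasure lborel (cball (0 :: real ^ 'n) (2 * R))") auto
    have le: "real N * w \<le> real n * b" for N
    proof -
      have "ennreal (real N * w) \<le> ennreal (real n * b)"
        using bound[of N] w b by (simp add: ennreal_mult ennreal_of_nat_eq_real_of_nat)
      then show ?thesis using b by (subst (asm) ennreal_le_iff) auto
    qed
    have "w = 0"
    proof (rule ccontr)
      assume "w \<noteq> 0"
      then obtain N where "real n * b < real N * w" using w reals_Archimedean3[of w] by auto
      with le[of N] show False by simp
    qed
    then show ?thesis by (simp add: w)
  qed
  have "{x. P x = 0} = (\<Union>k. (\<lambda>x. - a + 1 *\<^sub>R x) -` W (real (Suc k)))"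
  proof (intro Set.set_eqI iffI)
    fix x assume "x \<in> {x. P x = 0}"
    moreover obtain k where "norm (x - a) \<le> real k" using real_arch_simple by blast
    ultimately have "x \<in> (\<lambda>x. - a + 1 *\<^sub>R x) -` W (real (Suc k))"
      by (auto simp: W_def algebra_simps)
    then show "x \<in> (\<Union>k. (\<lambda>x. - a + 1 *\<^sub>R x) -` W (real (Suc k)))" by blast
  qed (auto simp: W_def)
  moreover have "(\<lambda>x. - a + 1 *\<^sub>R x) -` W (real (Suc k)) \<in> null_sets lborel" for k
  proof -
    have b: "(\<lambda>x. - a + 1 *\<^sub>R x) -` W (real (Suc k)) \<in> sets borel"
      by (intro borel_closed closed_vimage closedW continuous_intros)
    have "emeasure lborel (W (real (Suc k))) = emeasure (density (distr lborel borel (\<lambda>x. - a + 1 *\<^sub>R x))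
          (\<lambda>_. ennreal (\<bar>1\<bar> ^ DIM(real ^ 'n)))) (W (real (Suc k)))"
      using lborel_affine[of 1 "- a"] by simp
    also have "\<dots> = emeasure lborel ((\<lambda>x. - a + 1 *\<^sub>R x) -` W (real (Suc k)))"
      by (simp add: density_1 emeasure_distr)
    finally show ?thesis using nullW[of "real (Suc k)"] b by (simp add: null_sets_def)
  qed
  ultimately show ?thesis unfolding P_def[symmetric] by (auto intro: null_sets_UN)
qed

section \<open>Moments\<close>

lemma continuous_on_cvec [continuous_intros]: "continuous_on S cvec"
  unfolding cvec_def[abs_def] by (intro continuous_intros)

lemma borel_measurable_cvec [measurable]: "cvec \<in> borel_measurable borel"
  by (intro borel_measurable_continuous_onI continuous_on_cvec)

lemma measure_support_subset:
  assumes sets: "sets \<mu> = sets borel" and C: "closed C" "AE y in \<mu>. y \<in> C"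
  shows "measure_support \<mu> \<subseteq> C"
proof
  fix x assume x: "x \<in> measure_support \<mu>"
  show "x \<in> C"
  proof (rule ccontr)
    assume "x \<notin> C"
    then have "0 < emeasure \<mu> (- C)" using x C(1) by (auto simp: measure_support_def)
    moreover have "emeasure \<mu> (- C) = 0"
    proof -
      have "- C \<in> sets \<mu>" using C(1) sets by simp
      moreover have "{x \<in> space \<mu>. x \<notin> C} = - C" using sets_eq_imp_space_eq[OF sets] by auto
      ultimately show ?thesis using C(2) AE_iff_measurable[of "- C" \<mu> "\<lambda>x. x \<in> C"] by blast
    qed
    ultimately show False by simp
  qed
qed

lemma integral_empirical_measure:
  fixes g :: "'a::topological_space \<Rightarrow> real"
  assumes g: "g \<in> borel_measurable borel"
  shows "(\<integral>y. g y \<partial>empirical_measure x N) = (\<Sum>k<N. g (x k)) / real N"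
proof -
  have "x \<in> measurable (uniform_count_measure {..<N}) borel"
    by (simp add: measurable_def sets_uniform_count_measure space_uniform_count_measure Pi_def)
  then show ?thesis
    unfolding empirical_measure_def using g
    by (simp add: integral_distr integral_uniform_count_measure)
qed

text \<open>Weak convergence only speaks about bounded test functions; a test function that is bounded on
  the set which carries all the measures may be truncated.\<close>

lemma empirical_average_tendsto:
  fixes g :: "real ^ 'd::finite \<Rightarrow> real"
  assumes weak: "converges_weakly (empirical_measure x) \<mu>"
    and sets: "sets \<mu> = sets borel" and S: "AE y in \<mu>. y \<in> S" "range x \<subseteq> S"
    and g: "continuous_on UNIV g" and B: "\<And>y. y \<in> S \<Longrightarrow> \<bar>g y\<bar> \<le> B"
  shows "(\<lambda>N. (\<Sum>k<N. g (x k)) / real N) \<longlonglongrightarrow> (\<integral>y. g y \<partial>\<mu>)"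
proof -
  define h where "h y = max (- \<bar>B\<bar>) (min \<bar>B\<bar> (g y))" for y
  have hg: "h y = g y" if "y \<in> S" for y using B[OF that] by (auto simp: h_def)
  have hc: "continuous_on UNIV h" unfolding h_def by (intro continuous_intros g)
  have "\<bar>h y\<bar> \<le> \<bar>B\<bar>" for y by (auto simp: h_def)
  then have "bounded (range h)" by (auto simp: bounded_iff)
  then have "(\<lambda>N. \<integral>y. h y \<partial>empirical_measure x N) \<longlonglongrightarrow> (\<integral>y. h y \<partial>\<mu>)"
    using weak hc by (simp add: converges_weakly_def)
  moreover have "(\<integral>y. h y \<partial>empirical_measure x N) = (\<Sum>k<N. g (x k)) / real N" for N
    using S(2) by (simp add: integral_empirical_measure[OF borel_measurable_continuous_onI[OF hc]] hg image_subset_iff)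
  moreover have "(\<integral>y. h y \<partial>\<mu>) = (\<integral>y. g y \<partial>\<mu>)"
  proof (rule integral_cong_AE)
    show "h \<in> borel_measurable \<mu>" "g \<in> borel_measurable \<mu>"
      using borel_measurable_continuous_onI[OF hc] borel_measurable_continuous_onI[OF g] sets
      by (simp_all cong: measurable_cong_sets)
    show "AE y in \<mu>. h y = g y" using S(1) hg by auto
  qed
  ultimately show ?thesis by simp
qed

lemma quad_form_real:
  "quad_form r (\<lambda>i j. complex_of_real (M i j)) c = (\<Sum>i<r. \<Sum>j<r. Re (cnj (c i) * c j) * M i j)"
  unfolding quad_form_def mat_apply_def sum_distrib_left Re_sum
  by (intro sum.cong refl) (simp add: algebra_simps)

lemma cmod_sum_square:
  "(cmod (\<Sum>j<r. c j * complex_of_real (t j)))\<^sup>2 = (\<Sum>i<r. \<Sum>j<r. Re (cnj (c i) * c j) * (t i * t j))"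
proof -
  have "complex_of_real ((cmod (\<Sum>j<r. c j * complex_of_real (t j)))\<^sup>2)
      = (\<Sum>i<r. \<Sum>j<r. (cnj (c i) * of_real (t i)) * (c j * of_real (t j)))"
    unfolding complex_norm_square mult.commute[of _ "cnj _"] cnj_sum sum_product by simp (rule sum.swap)
  from arg_cong[OF this, of Re] show ?thesis
    by (simp add: Re_sum algebra_simps del: of_real_power)
qed

locale moment_setup =
  fixes \<mu> :: "(real ^ 'd::finite) measure" and S :: "(real ^ 'd) set" and \<alpha> :: "nat \<Rightarrow> 'd \<Rightarrow> nat"
  assumes sets_mu: "sets \<mu> = sets borel" and prob: "prob_space \<mu>"
    and S: "compact S" "AE y in \<mu>. y \<in> S"
    and ac: "absolutely_continuous lborel \<mu>" and numbering: "graded_numbering \<alpha>"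
begin

definition moment :: "nat \<Rightarrow> nat \<Rightarrow> real" where
  "moment i j = (\<integral>y. real_mono (\<alpha> i) y * real_mono (\<alpha> j) y \<partial>\<mu>)"

lemma meas: "g \<in> borel_measurable borel \<Longrightarrow> g \<in> borel_measurable \<mu>"
  using sets_mu by (simp cong: measurable_cong_sets)

lemma integrable_continuous:
  fixes g :: "real ^ 'd \<Rightarrow> real"
  assumes g: "continuous_on UNIV g"
  shows "integrable \<mu> g"
proof -
  interpret prob_space \<mu> by (rule prob)
  have "bounded (g ` S)"
    using S(1) g by (intro compact_imp_bounded compact_continuous_image) (auto intro: continuous_on_subset)
  then obtain B where B: "\<And>y. y \<in> S \<Longrightarrow> norm (g y) \<le> B" by (auto simp: bounded_iff)
  show ?thesis
    using S(2) B by (intro integrable_const_bound[of _ B] meas borel_measurable_continuous_onI g) auto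
qed

lemma moment_matrix_entry:
  assumes "i < jet_dim CARD('d) n" "j < jet_dim CARD('d) n"
  shows "moment_matrix \<alpha> n (distr \<mu> borel cvec) $$ (i, j) = complex_of_real (moment i j)"
proof -
  have mp: "continuous_on UNIV (\<lambda>z. mpow z \<gamma>)" for \<gamma> :: "'d \<Rightarrow> nat"
    unfolding mpow_def by (intro continuous_intros)
  have "(\<integral>z. cnj (mpow z (\<alpha> i)) * mpow z (\<alpha> j) \<partial>distr \<mu> borel cvec)
     = (\<integral>y. cnj (mpow (cvec y) (\<alpha> i)) * mpow (cvec y) (\<alpha> j) \<partial>\<mu>)"
  proof (rule integral_distr)
    show "cvec \<in> measurable \<mu> borel" using sets_mu by (simp cong: measurable_cong_sets)
    show "(\<lambda>z. cnj (mpow z (\<alpha> i)) * mpow z (\<alpha> j)) \<in> borel_measurable borel"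
      by (intro borel_measurable_continuous_onI continuous_intros mp)
  qed
  also have "\<dots> = (\<integral>y. complex_of_real (real_mono (\<alpha> i) y * real_mono (\<alpha> j) y) \<partial>\<mu>)"
    by (simp add: mpow_cvec)
  also have "\<dots> = complex_of_real (moment i j)"
    unfolding moment_def by (rule integral_complex_of_real)
  finally show ?thesis using assms by (simp add: moment_matrix_def)
qed

lemma quad_form_moment:
  "quad_form r (\<lambda>i j. complex_of_real (moment i j)) c
     = (\<integral>y. (cmod (\<Sum>j<r. c j * complex_of_real (real_mono (\<alpha> j) y)))\<^sup>2 \<partial>\<mu>)"
proof -
  have int: "integrable \<mu> (\<lambda>y. real_mono (\<alpha> i) y * real_mono (\<alpha> j) y)" for i j
    by (intro integrable_continuous continuous_intros)
  have "(\<integral>y. (\<Sum>i<r. \<Sum>j<r. Re (cnj (c i) * c j) * (real_mono (\<alpha> i) y * real_mono (\<alpha> j) y)) \<partial>\<mu>)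
     = (\<Sum>i<r. \<integral>y. (\<Sum>j<r. Re (cnj (c i) * c j) * (real_mono (\<alpha> i) y * real_mono (\<alpha> j) y)) \<partial>\<mu>)"
    by (intro Bochner_Integration.integral_sum Bochner_Integration.integrable_sum integrable_mult_right int)
  also have "\<dots> = (\<Sum>i<r. \<Sum>j<r. \<integral>y. Re (cnj (c i) * c j) * (real_mono (\<alpha> i) y * real_mono (\<alpha> j) y) \<partial>\<mu>)"
    by (intro sum.cong refl Bochner_Integration.integral_sum integrable_mult_right int)
  also have "\<dots> = (\<Sum>i<r. \<Sum>j<r. Re (cnj (c i) * c j) * moment i j)"
    unfolding moment_def by (intro sum.cong refl integral_mult_right_zero)
  finally show ?thesis
    unfolding quad_form_real cmod_sum_square by (rule sym)
qed

text \<open>If the integral of the squared modulus of the polynomial were zero, then the polynomial would vanish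
  almost everywhere with respect to \<open>\<mu>\<close>, but by absolute continuity its zero set is a null set.\<close>

lemma quad_form_moment_pos:
  assumes i: "i < jet_dim CARD('d) n" "c i \<noteq> 0"
  shows "0 < quad_form (jet_dim CARD('d) n) (\<lambda>i j. complex_of_real (moment i j)) c"
proof -
  let ?r = "jet_dim CARD('d) n"
  interpret prob_space \<mu> by (rule prob)
  let ?P = "\<lambda>y. \<Sum>j<?r. c j * complex_of_real (real_mono (\<alpha> j) y)"
  have int: "integrable \<mu> (\<lambda>y. (cmod (?P y))\<^sup>2)"
    by (intro integrable_continuous continuous_intros)
  have inj: "inj \<alpha>" using numbering by (simp add: graded_numbering_def bij_def)
  let ?c = "\<lambda>\<gamma>. c (inv_into UNIV \<alpha> \<gamma>)"
  have P: "?P y = (\<Sum>\<gamma> | mdeg \<gamma> \<le> n. ?c \<gamma> * of_real (real_mono \<gamma> y))" for y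
    using sum.reindex_bij_betw[OF graded_numbering_bij_betw[OF numbering], of "\<lambda>\<gamma>. ?c \<gamma> * of_real (real_mono \<gamma> y)" n]
    by (simp add: inv_f_f[OF inj])
  have "{y. ?P y = 0} \<in> null_sets lborel"
    unfolding P using i
    by (intro polynomial_zero_set_null[of "\<alpha> i"]) (auto simp: inv_f_f[OF inj] graded_numbering_less_iff[OF numbering])
  then have null: "{y. ?P y = 0} \<in> null_sets \<mu>" using ac by (auto simp: absolutely_continuous_def)
  have "(\<integral>y. (cmod (?P y))\<^sup>2 \<partial>\<mu>) \<noteq> 0"
  proof
    assume "(\<integral>y. (cmod (?P y))\<^sup>2 \<partial>\<mu>) = 0"
    then have "AE y in \<mu>. (cmod (?P y))\<^sup>2 = 0"
      using integral_nonneg_eq_0_iff_AE[OF int] by simp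
    moreover have "AE y in \<mu>. y \<notin> {y. ?P y = 0}" using null by (rule AE_not_in)
    ultimately have "AE y in \<mu>. False" by eventually_elim simp
    then show False by simp
  qed
  moreover have "0 \<le> (\<integral>y. (cmod (?P y))\<^sup>2 \<partial>\<mu>)" by (rule integral_nonneg_AE) simp
  ultimately show ?thesis by (simp add: quad_form_moment less_le)
qed

lemma moment_lower_bound:
  defines "\<Lambda> n \<equiv> smallest_eigenvalue (moment_matrix \<alpha> n (distr \<mu> borel cvec))"
  shows "0 < \<Lambda> n"
    and "\<Lambda> n * sqnorm (jet_dim CARD('d) n) c
      \<le> quad_form (jet_dim CARD('d) n) (\<lambda>i j. complex_of_real (moment i j)) c"
proof -
  let ?r = "jet_dim CARD('d) n" and ?D = "moment_matrix \<alpha> n (distr \<mu> borel cvec)"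
  have D: "?D \<in> carrier_mat ?r ?r" by (simp add: moment_matrix_def)
  have qf: "quad_form ?r (\<lambda>i j. ?D $$ (i, j)) c = quad_form ?r (\<lambda>i j. complex_of_real (moment i j)) c" for c
    unfolding quad_form_def mat_apply_def by (intro arg_cong[of _ _ Re] sum.cong refl) (auto simp: moment_matrix_entry)
  have sym: "?D $$ (i, j) = cnj (?D $$ (j, i))" if "i < ?r" "j < ?r" for i j
    using that by (simp add: moment_matrix_entry) (simp add: moment_def mult.commute)
  have pd: "0 < quad_form ?r (\<lambda>i j. ?D $$ (i, j)) c" if "i < ?r" "c i \<noteq> 0" for c i
    unfolding qf using that by (rule quad_form_moment_pos)
  show "0 < \<Lambda> n" unfolding \<Lambda>_def
    by (rule smallest_eigenvalue_bound(1)[OF D jet_dim_pos sym pd])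
  show "\<Lambda> n * sqnorm ?r c \<le> quad_form ?r (\<lambda>i j. complex_of_real (moment i j)) c"
    unfolding \<Lambda>_def qf[symmetric]
    by (rule smallest_eigenvalue_bound(2)[OF D jet_dim_pos sym pd])
qed

text \<open>Since the empirical moments converge, the lower bound by the smallest eigenvalue survives for
  the empirical quadratic forms up to a factor \<open>1 / 2\<close>.\<close>

lemma eventually_empirical_lower_bound:
  assumes weak: "converges_weakly (empirical_measure x) \<mu>" and x: "range x \<subseteq> S"
  defines "\<Lambda> n \<equiv> smallest_eigenvalue (moment_matrix \<alpha> n (distr \<mu> borel cvec))"
  shows "eventually (\<lambda>N. \<forall>c. \<Lambda> n / 2 * sqnorm (jet_dim CARD('d) n) c * real N
      \<le> (\<Sum>k<N. (cmod (\<Sum>j<jet_dim CARD('d) n. c j * complex_of_real (real_mono (\<alpha> j) (x k))))\<^sup>2)) sequentially"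
proof -
  let ?r = "jet_dim CARD('d) n"
  define emp where "emp N i j = (\<Sum>k<N. real_mono (\<alpha> i) (x k) * real_mono (\<alpha> j) (x k)) / real N" for N i j
  have lim: "(\<lambda>N. emp N i j) \<longlonglongrightarrow> moment i j" for i j
  proof -
    let ?g = "\<lambda>y. real_mono (\<alpha> i) y * real_mono (\<alpha> j) y"
    have g: "continuous_on UNIV ?g" by (intro continuous_intros)
    have "bounded (?g ` S)"
      using S(1) g by (intro compact_imp_bounded compact_continuous_image) (auto intro: continuous_on_subset)
    then obtain B where "\<And>y. y \<in> S \<Longrightarrow> \<bar>?g y\<bar> \<le> B" by (auto simp: bounded_iff)
    from empirical_average_tendsto[OF weak sets_mu S(2) x g this]
    show ?thesis by (simp add: emp_def moment_def)
  qed
  have "(\<lambda>N. \<Sum>i<?r. \<Sum>j<?r. cmod (complex_of_real (emp N i j - moment i j)))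
      \<longlonglongrightarrow> (\<Sum>i<?r. \<Sum>j<?r. cmod (complex_of_real (moment i j - moment i j)))"
    by (intro tendsto_intros lim)
  then have "(\<lambda>N. \<Sum>i<?r. \<Sum>j<?r. cmod (complex_of_real (emp N i j - moment i j))) \<longlonglongrightarrow> 0" by simp
  moreover have "0 < \<Lambda> n / 2" unfolding \<Lambda>_def using moment_lower_bound(1)[of n] by simp
  ultimately have "eventually (\<lambda>N. (\<Sum>i<?r. \<Sum>j<?r. cmod (complex_of_real (emp N i j - moment i j))) < \<Lambda> n / 2) sequentially"
    by (rule order_tendstoD(2))
  then show ?thesis
    using eventually_gt_at_top[of 0]
  proof eventually_elim
    case (elim N)
    show ?case
    proof
      fix c
      have "quad_form ?r (\<lambda>i j. complex_of_real (emp N i j)) c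
         = quad_form ?r (\<lambda>i j. complex_of_real (moment i j)) c + quad_form ?r (\<lambda>i j. complex_of_real (emp N i j - moment i j)) c"
        unfolding quad_form_real sum.distrib[symmetric] right_diff_distrib by simp
      moreover have "\<bar>quad_form ?r (\<lambda>i j. complex_of_real (emp N i j - moment i j)) c\<bar> \<le> \<Lambda> n / 2 * sqnorm ?r c"
        using elim(1) sqnorm_nonneg[of ?r c]
        by (intro order_trans[OF quad_form_abs_le] mult_right_mono) auto
      moreover have "\<Lambda> n * sqnorm ?r c \<le> quad_form ?r (\<lambda>i j. complex_of_real (moment i j)) c"
        unfolding \<Lambda>_def by (rule moment_lower_bound(2))
      ultimately have "\<Lambda> n / 2 * sqnorm ?r c \<le> quad_form ?r (\<lambda>i j. complex_of_real (emp N i j)) c"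
        by (simp add: field_simps abs_le_iff)
      also have "\<dots> = (\<Sum>k<N. (cmod (\<Sum>j<?r. c j * complex_of_real (real_mono (\<alpha> j) (x k))))\<^sup>2) / real N"
      proof -
        have e: "(\<Sum>k<N. (cmod (\<Sum>j<?r. c j * complex_of_real (real_mono (\<alpha> j) (x k))))\<^sup>2)
           = (\<Sum>i<?r. \<Sum>j<?r. Re (cnj (c i) * c j) * (\<Sum>k<N. real_mono (\<alpha> i) (x k) * real_mono (\<alpha> j) (x k)))"
          unfolding cmod_sum_square sum_distrib_left
          by (subst sum.swap) (intro sum.cong refl sum.swap)
        show ?thesis
          unfolding quad_form_real emp_def times_divide_eq_right sum_divide_distrib[symmetric]
          by (simp only: e)
      qed
      finally show "\<Lambda> n / 2 * sqnorm ?r c * real N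
        \<le> (\<Sum>k<N. (cmod (\<Sum>j<?r. c j * complex_of_real (real_mono (\<alpha> j) (x k))))\<^sup>2)"
        using elim(2) by (simp add: field_simps)
    qed
  qed
qed

end

section \<open>Expansion error and least squares error\<close>

lemma exp_partial_sum_le:
  fixes a :: real
  assumes "0 \<le> a"
  shows "(\<Sum>b\<le>m. a ^ b / fact b) \<le> exp a"
proof -
  have "(\<lambda>n. a ^ n / fact n) sums exp a"
    using exp_converges[of a] by (simp add: scaleR_conv_of_real divide_inverse mult.commute)
  then have "summable (\<lambda>n. a ^ n / fact n)" "exp a = (\<Sum>n. a ^ n / fact n)"
    by (simp_all add: sums_iff)
  then show ?thesis
    using assms sum_le_suminf[of "\<lambda>n. a ^ n / fact n" "{..m}"] by simp
qed

text \<open>The basis functions are square summable at each point, with a sum that depends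
  continuously on the point. This bounds the vector of the first \<open>l\<close> basis functions uniformly
  in \<open>l\<close>.\<close>

definition jet_basis_bound :: "complex ^ 'n::finite \<Rightarrow> complex ^ 'n \<Rightarrow> real" where
  "jet_basis_bound q w = exp (- (norm q)\<^sup>2) * exp (\<Sum>i\<in>UNIV. (cmod (w $ i - q $ i))\<^sup>2) * (cmod (exp (herm w q)))\<^sup>2"

lemma sum_jet_basis_le:
  assumes b: "graded_numbering b"
  shows "(\<Sum>i<jet_dim CARD('n) m. (cmod (jet_basis b q i w))\<^sup>2) \<le> jet_basis_bound q (w :: complex ^ 'n::finite)"
proof -
  define a where "a i = (cmod (w $ i - q $ i))\<^sup>2" for i
  have a0: "0 \<le> a i" for i by (simp add: a_def)
  have sq: "(cmod (jet_basis b q i w))\<^sup>2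
     = exp (- (norm q)\<^sup>2) * (cmod (exp (herm w q)))\<^sup>2 * (\<Prod>l\<in>UNIV. a l ^ b i l / fact (b i l))" for i
  proof -
    have "(exp (- (norm q)\<^sup>2 / 2))\<^sup>2 = exp (- (norm q)\<^sup>2)"
      by (simp add: power2_eq_square exp_add[symmetric])
    moreover have "(cmod (mpow (w - q) (b i)))\<^sup>2 = (\<Prod>l\<in>UNIV. a l ^ b i l)"
      by (simp add: mpow_def a_def prod_norm[symmetric] prod_power_distrib norm_power power_mult[symmetric] mult.commute)
    moreover have "real (mfact (b i)) = (\<Prod>l\<in>UNIV. fact (b i l))" by (simp add: mfact_def)
    ultimately show ?thesis
      by (simp add: jet_basis_def norm_mult norm_divide power_mult_distrib power_divide prod_dividef)
  qed
  have "(\<Sum>i<jet_dim CARD('n) m. \<Prod>l\<in>UNIV. a l ^ b i l / fact (b i l))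
     = (\<Sum>\<gamma> | mdeg \<gamma> \<le> m. \<Prod>l\<in>UNIV. a l ^ \<gamma> l / fact (\<gamma> l))"
    by (rule sum.reindex_bij_betw[OF graded_numbering_bij_betw[OF b]])
  also have "\<dots> \<le> (\<Sum>\<gamma>\<in>Pi\<^sub>E UNIV (\<lambda>_. {..m}). \<Prod>l\<in>UNIV. a l ^ \<gamma> l / fact (\<gamma> l))"
  proof (rule sum_mono2)
    show "finite (Pi\<^sub>E (UNIV :: 'n set) (\<lambda>_. {..m}))" by (intro finite_PiE) auto
    show "{\<gamma> :: 'n \<Rightarrow> nat. mdeg \<gamma> \<le> m} \<subseteq> Pi\<^sub>E UNIV (\<lambda>_. {..m})" by (rule mdeg_le_subset_PiE)
  qed (use a0 in \<open>auto intro!: prod_nonneg\<close>)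
  also have "\<dots> = (\<Prod>l\<in>UNIV. \<Sum>k\<le>m. a l ^ k / fact k)"
    by (rule prod_sum_PiE[symmetric]) auto
  also have "\<dots> \<le> (\<Prod>l\<in>UNIV. exp (a l))"
    by (intro prod_mono conjI exp_partial_sum_le sum_nonneg) (use a0 in auto)
  also have "\<dots> = exp (\<Sum>l\<in>UNIV. a l)" by (simp add: exp_sum)
  finally have "(\<Sum>i<jet_dim CARD('n) m. (cmod (jet_basis b q i w))\<^sup>2)
     \<le> exp (- (norm q)\<^sup>2) * (cmod (exp (herm w q)))\<^sup>2 * exp (\<Sum>l\<in>UNIV. a l)"
    unfolding sq sum_distrib_left[symmetric] by (intro mult_left_mono) auto
  then show ?thesis by (simp add: jet_basis_bound_def a_def mult_ac)
qed

lemma taylor_poly_linear: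
  fixes l :: nat
  assumes V: "open V" and p: "p \<in> V" and H: "\<And>i. i < l \<Longrightarrow> holo_on V (H i)"
  shows "taylor_poly n (\<lambda>z. \<Sum>i<l. d i * H i z) p w = (\<Sum>i<l. d i * taylor_poly n (H i) p w)"
proof -
  have "mderiv \<gamma> (\<lambda>z. \<Sum>i<l. d i * H i z) p = (\<Sum>i<l. d i * mderiv \<gamma> (H i) p)" for \<gamma>
  proof -
    have "mderiv \<gamma> (\<lambda>z. \<Sum>i<l. d i * H i z) p = (\<Sum>i<l. word_deriv (sorted_word \<gamma>) (\<lambda>z. d i * H i z) p)"
      unfolding mderiv_word using H
      by (intro word_deriv_sum[OF V _ p] finite_lessThan holo_on_mult holo_on_const) auto
    also have "\<dots> = (\<Sum>i<l. d i * mderiv \<gamma> (H i) p)"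
      unfolding mderiv_word using H by (intro sum.cong refl word_deriv_cmult[OF V _ p]) auto
    finally show ?thesis .
  qed
  then show ?thesis
    unfolding taylor_poly_def sum_distrib_left
    by (subst sum.swap) (simp add: sum_divide_distrib sum_distrib_right mult.assoc)
qed

text \<open>The remainder of a vector of functions, by duality: the estimate for scalar functions is
  applied to the linear combination whose coefficients are the conjugated remainders.\<close>

lemma taylor_poly_remainder_vector:
  fixes p :: "complex ^ 'n::finite" and l :: nat
  assumes V: "open V" and H: "\<And>i. i < l \<Longrightarrow> holo_on V (H i)" and \<rho>: "1 < \<rho>"
    and M: "0 \<le> M" "\<And>t. t \<in> ball 0 \<rho> \<Longrightarrow> p + t *s w \<in> V \<and> (\<Sum>i<l. (cmod (H i (p + t *s w)))\<^sup>2) \<le> M\<^sup>2"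
  shows "sqrt (\<Sum>i<l. (cmod (H i (p + w) - taylor_poly n (H i) p w))\<^sup>2) \<le> M * (1 / \<rho>) ^ Suc n / (1 - 1 / \<rho>)"
proof -
  define e where "e i = H i (p + w) - taylor_poly n (H i) p w" for i
  define N where "N = sqrt (\<Sum>i<l. (cmod (e i))\<^sup>2)"
  define Q where "Q = M * (1 / \<rho>) ^ Suc n / (1 - 1 / \<rho>)"
  have N0: "0 \<le> N" by (simp add: N_def sum_nonneg)
  have N2: "N * N = (\<Sum>i<l. (cmod (e i))\<^sup>2)" by (simp add: N_def sum_nonneg)
  let ?G = "\<lambda>z. \<Sum>i<l. cnj (e i) * H i z"
  have p: "p \<in> V" using M(2)[of 0] \<rho> by simp
  have "cmod (?G (p + w) - taylor_poly n ?G p w) \<le> (N * M) * (1 / \<rho>) ^ Suc n / (1 - 1 / \<rho>)"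
  proof (rule taylor_poly_remainder[OF V _ \<rho>])
    show "holo_on V ?G" using H by (intro holo_on_sum holo_on_mult holo_on_const) auto
    fix t :: complex assume t: "t \<in> ball 0 \<rho>"
    have "cmod (?G (p + t *s w)) \<le> (\<Sum>i<l. cmod (e i) * cmod (H i (p + t *s w)))"
      by (rule order_trans[OF norm_sum]) (simp add: norm_mult)
    also have "\<dots> \<le> sqrt ((\<Sum>i<l. (cmod (e i))\<^sup>2) * (\<Sum>i<l. (cmod (H i (p + t *s w)))\<^sup>2))"
      by (rule real_le_rsqrt[OF Cauchy_Schwarz_ineq_sum])
    also have "\<dots> \<le> sqrt ((N * N) * M\<^sup>2)"
      unfolding N2[symmetric] using M(2)[OF t] N0 by (intro real_sqrt_le_mono mult_left_mono) auto
    also have "\<dots> = N * M" using N0 M(1) by (simp add: real_sqrt_mult)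
    finally show "p + t *s w \<in> V \<and> cmod (?G (p + t *s w)) \<le> N * M" using M(2)[OF t] by simp
  qed
  moreover have "?G (p + w) - taylor_poly n ?G p w = of_real (N * N)"
  proof -
    have "?G (p + w) - taylor_poly n ?G p w = (\<Sum>i<l. cnj (e i) * e i)"
    proof -
      have "taylor_poly n ?G p w = (\<Sum>i<l. cnj (e i) * taylor_poly n (H i) p w)"
        by (rule taylor_poly_linear[OF V p H])
      then show ?thesis
        by (simp only: sum_subtractf[symmetric] right_diff_distrib[symmetric]) (simp only: e_def)
    qed
    also have "\<dots> = of_real (\<Sum>i<l. (cmod (e i))\<^sup>2)"
      by (simp add: complex_norm_square mult.commute del: of_real_power)
    finally show ?thesis by (simp only: N2)
  qed
  ultimately have "N * N \<le> N * Q"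
    using N0 by (simp only: norm_of_real abs_of_nonneg mult_nonneg_nonneg) (simp add: Q_def)
  moreover have "0 \<le> Q" using M(1) \<rho> by (simp add: Q_def)
  ultimately have "N \<le> Q" using N0 by (cases "N = 0") auto
  then show ?thesis by (simp add: N_def Q_def e_def)
qed

text \<open>Pythagoras for the least squares problem: the residual of the solution \<open>c\<close> is orthogonal to
  the range of \<open>U\<close>, so the error in the range is at most the distance of the data to \<open>U a\<close>.\<close>

lemma least_squares_error:
  fixes U :: "nat \<Rightarrow> nat \<Rightarrow> complex"
  assumes normal: "\<And>l. l < r \<Longrightarrow>
      (\<Sum>k<N. (\<Sum>j<r. c j * U k j) * cnj (U k l)) = (\<Sum>k<N. y k * cnj (U k l))"
  shows "(\<Sum>k<N. (cmod (\<Sum>j<r. (a j - c j) * U k j))\<^sup>2) \<le> (\<Sum>k<N. (cmod (y k - (\<Sum>j<r. a j * U k j)))\<^sup>2)"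
proof -
  define e where "e k = (\<Sum>j<r. (a j - c j) * U k j)" for k
  define s where "s k = (\<Sum>j<r. c j * U k j) - y k" for k
  have orth: "(\<Sum>k<N. s k * cnj (e k)) = 0"
  proof -
    have "(\<Sum>k<N. s k * cnj (e k)) = (\<Sum>l<r. \<Sum>k<N. cnj (a l - c l) * (s k * cnj (U k l)))"
      unfolding e_def cnj_sum sum_distrib_left by (subst sum.swap) (simp add: mult_ac)
    also have "\<dots> = (\<Sum>l<r. cnj (a l - c l) * ((\<Sum>k<N. (\<Sum>j<r. c j * U k j) * cnj (U k l)) - (\<Sum>k<N. y k * cnj (U k l))))"
      by (simp add: s_def left_diff_distrib sum_subtractf sum_distrib_left[symmetric])
    also have "\<dots> = 0" using normal by simp
    finally show ?thesis .
  qed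
  have dec: "y k - (\<Sum>j<r. a j * U k j) = - (s k + e k)" for k
    by (simp add: s_def e_def left_diff_distrib sum_subtractf)
  have "(cmod (y k - (\<Sum>j<r. a j * U k j)))\<^sup>2 = (cmod (s k))\<^sup>2 + (cmod (e k))\<^sup>2 + 2 * Re (s k * cnj (e k))" for k
    unfolding dec norm_minus_cancel cmod_power2 by (simp add: power2_eq_square algebra_simps)
  then have "(\<Sum>k<N. (cmod (y k - (\<Sum>j<r. a j * U k j)))\<^sup>2)
      = (\<Sum>k<N. (cmod (s k))\<^sup>2) + (\<Sum>k<N. (cmod (e k))\<^sup>2) + 2 * Re (\<Sum>k<N. s k * cnj (e k))"
    by (simp only: sum.distrib Re_sum sum_distrib_left)
  then show ?thesis
    unfolding orth by (simp add: e_def[symmetric] sum_nonneg)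
qed

section \<open>The Minkowski gauge\<close>

text \<open>Some factor below \<open>g\<close> already scales \<open>K0\<close> to a set that contains \<open>z\<close>, and an absolutely convex
  set contains its shrunk copies.\<close>

lemma minkowski_gauge_less:
  assumes K0: "absolutely_convex K0" and z: "z \<in> K0" and g: "minkowski_gauge K0 z < g"
  obtains z' where "z' \<in> K0" "z = g *\<^sub>R z'"
proof -
  let ?T = "{t. 0 < t \<and> z \<in> (\<lambda>w. t *\<^sub>R w) ` K0}"
  have "1 \<in> ?T" using z by simp
  then have "?T \<noteq> {}" by blast
  from cInf_lessD[OF this g[unfolded minkowski_gauge_def]]
  obtain t w where t: "0 < t" "t < g" and w: "w \<in> K0" "z = t *\<^sub>R w" by auto
  have "complex_of_real (t / g) *s w \<in> K0"
    using t by (intro absolutely_convex_smult[OF K0 w(1)]) (simp add: norm_divide)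
  then have "(t / g) *\<^sub>R w \<in> K0" by (simp only: smult_real)
  moreover have "z = g *\<^sub>R ((t / g) *\<^sub>R w)" using t w by simp
  ultimately show ?thesis using that by blast
qed

lemma minkowski_gauge_bounds:
  assumes "z \<in> K0"
  shows "0 \<le> minkowski_gauge K0 z" "minkowski_gauge K0 z \<le> 1"
proof -
  let ?T = "{t. 0 < t \<and> z \<in> (\<lambda>w. t *\<^sub>R w) ` K0}"
  have 1: "1 \<in> ?T" using assms by simp
  show "0 \<le> minkowski_gauge K0 z"
    unfolding minkowski_gauge_def
  proof (rule cInf_greatest)
    show "?T \<noteq> {}" using 1 by blast
  qed auto
  show "minkowski_gauge K0 z \<le> 1"
    unfolding minkowski_gauge_def using 1 by (intro cInf_lower bdd_belowI[of _ 0]) auto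
qed

lemma norm_cvec: "norm (cvec y) = norm y"
  by (simp add: norm_vec_def cvec_def L2_set_def)

lemma compact_cvec_vimage:
  assumes "compact K0"
  shows "compact (cvec -` K0)"
  unfolding compact_eq_bounded_closed
proof
  obtain B where "\<And>z. z \<in> K0 \<Longrightarrow> norm z \<le> B"
    using compact_imp_bounded[OF assms] by (auto simp: bounded_iff)
  then show "bounded (cvec -` K0)" by (auto simp: bounded_iff norm_cvec[symmetric])
  show "closed (cvec -` K0)"
    by (rule closed_vimage[OF compact_imp_closed[OF assms] continuous_on_cvec])
qed

section \<open>The estimate\<close>

text \<open>The rows of \<open>U\<close> carry weights \<open>\<omega>\<close> that are bounded away from zero, and the columns are scaled by
  \<open>D\<close>. So the lower bound for the unweighted matrix \<open>t\<close> controls the scaled coefficient errors.\<close>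

lemma weighted_least_squares_error:
  fixes U :: "nat \<Rightarrow> nat \<Rightarrow> complex"
  assumes low: "\<And>c. \<Lambda> * sqnorm r c \<le> (\<Sum>k<N. (cmod (\<Sum>j<r. c j * t k j))\<^sup>2)"
    and U: "\<And>k j. k < N \<Longrightarrow> j < r \<Longrightarrow> U k j = D j * t k j * \<omega> k"
    and \<omega>: "0 \<le> B" "\<And>k. k < N \<Longrightarrow> 1 \<le> B * cmod (\<omega> k)"
    and normal: "\<And>l. l < r \<Longrightarrow>
      (\<Sum>k<N. (\<Sum>j<r. c j * U k j) * cnj (U k l)) = (\<Sum>k<N. y k * cnj (U k l))"
  shows "\<Lambda> * sqnorm r (\<lambda>j. D j * (a j - c j)) \<le> B\<^sup>2 * (\<Sum>k<N. (cmod (y k - (\<Sum>j<r. a j * U k j)))\<^sup>2)"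
proof -
  have row: "(cmod (\<Sum>j<r. (D j * (a j - c j)) * t k j))\<^sup>2 \<le> B\<^sup>2 * (cmod (\<Sum>j<r. (a j - c j) * U k j))\<^sup>2"
    if k: "k < N" for k
  proof -
    have "(\<Sum>j<r. (a j - c j) * U k j) = (\<Sum>j<r. (D j * (a j - c j)) * t k j) * \<omega> k"
      unfolding sum_distrib_right by (intro sum.cong refl) (simp add: U[OF k] mult_ac)
    then have "B * cmod (\<Sum>j<r. (a j - c j) * U k j)
        = (B * cmod (\<omega> k)) * cmod (\<Sum>j<r. (D j * (a j - c j)) * t k j)"
      by (simp only: norm_mult mult_ac)
    moreover have "1 * cmod (\<Sum>j<r. (D j * (a j - c j)) * t k j) \<le> \<dots>"
      using \<omega>(2)[OF k] by (intro mult_right_mono) auto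
    ultimately have "cmod (\<Sum>j<r. (D j * (a j - c j)) * t k j) \<le> B * cmod (\<Sum>j<r. (a j - c j) * U k j)"
      by linarith
    from power_mono[OF this norm_ge_zero, of 2] show ?thesis
      by (simp only: power_mult_distrib)
  qed
  have "\<Lambda> * sqnorm r (\<lambda>j. D j * (a j - c j)) \<le> (\<Sum>k<N. (cmod (\<Sum>j<r. (D j * (a j - c j)) * t k j))\<^sup>2)"
    by (rule low)
  also have "\<dots> \<le> (\<Sum>k<N. B\<^sup>2 * (cmod (\<Sum>j<r. (a j - c j) * U k j))\<^sup>2)"
    by (intro sum_mono row) auto
  also have "\<dots> = B\<^sup>2 * (\<Sum>k<N. (cmod (\<Sum>j<r. (a j - c j) * U k j))\<^sup>2)"
    by (simp add: sum_distrib_left)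
  also have "\<dots> \<le> B\<^sup>2 * (\<Sum>k<N. (cmod (y k - (\<Sum>j<r. a j * U k j)))\<^sup>2)"
    by (intro mult_left_mono least_squares_error normal) auto
  finally show ?thesis .
qed

text \<open>After multiplication by \<open>exp (herm (z - p) (- p))\<close> the expansion is a Taylor polynomial, so that the
  remainder estimate for vectors applies; \<open>M2\<close> accounts for dividing by this factor again.\<close>

lemma jet_expansion_remainder:
  fixes f :: "complex ^ 'd::finite \<Rightarrow> complex ^ 'r::finite" and p w :: "complex ^ 'd"
  assumes a: "graded_numbering a" and b: "graded_numbering b"
    and V: "open V" "S \<subseteq> V" "holo_map_on V f" and \<rho>: "1 < \<rho>"
    and disc: "\<And>t. t \<in> ball 0 \<rho> \<Longrightarrow> p + t *s w \<in> L" and L: "L \<subseteq> V"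
    and M: "0 \<le> M" "\<And>z. z \<in> L \<Longrightarrow> jet_basis_bound q (f z) * (cmod (exp (herm (z - p) (- p))))\<^sup>2 \<le> M\<^sup>2"
    and M2: "0 \<le> M2" "cmod (exp (herm w p)) \<le> M2"
  defines "h \<equiv> \<lambda>i z. jet_basis b q i (f z)"
  shows "sqrt (\<Sum>i<jet_dim CARD('r) m. (cmod (h i (p + w) -
      (\<Sum>j<jet_dim CARD('d) n. jet_coeff S a p j (h i) * jet_basis a p j (p + w))))\<^sup>2)
    \<le> M2 * (M * (1 / \<rho>) ^ Suc n / (1 - 1 / \<rho>))"
proof -
  let ?E = "\<lambda>z. exp (herm (z - p) (- p))" and ?l = "jet_dim CARD('r) m"
  define H where "H i z = h i z * ?E z" for i z
  have hV: "holo_on V (h i)" for i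
    unfolding h_def by (rule holo_on_compose[OF V(3) holo_on_jet_basis[of UNIV]]) simp
  have HV: "holo_on V (H i)" for i
    unfolding H_def by (intro holo_on_mult hV holo_on_exp_herm)
  have near: "h i \<in> holo_near S" for i
    using V(1,2) hV by (auto simp: holo_near_def)
  have T: "sqrt (\<Sum>i<?l. (cmod (H i (p + w) - taylor_poly n (H i) p w))\<^sup>2) \<le> M * (1 / \<rho>) ^ Suc n / (1 - 1 / \<rho>)"
  proof (rule taylor_poly_remainder_vector[OF V(1) HV \<rho> M(1)])
    fix t :: complex assume "t \<in> ball 0 \<rho>"
    then have z: "p + t *s w \<in> L" by (rule disc)
    have "(\<Sum>i<?l. (cmod (H i (p + t *s w)))\<^sup>2)
        = (\<Sum>i<?l. (cmod (jet_basis b q i (f (p + t *s w))))\<^sup>2) * (cmod (?E (p + t *s w)))\<^sup>2"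
      by (simp only: H_def h_def norm_mult power_mult_distrib sum_distrib_right)
    also have "\<dots> \<le> jet_basis_bound q (f (p + t *s w)) * (cmod (?E (p + t *s w)))\<^sup>2"
      by (intro mult_right_mono sum_jet_basis_le[OF b]) simp
    also have "\<dots> \<le> M\<^sup>2" by (rule M(2)[OF z])
    finally show "p + t *s w \<in> V \<and> (\<Sum>i<?l. (cmod (H i (p + t *s w)))\<^sup>2) \<le> M\<^sup>2" using z L by auto
  qed
  have eq: "h i (p + w) - (\<Sum>j<jet_dim CARD('d) n. jet_coeff S a p j (h i) * jet_basis a p j (p + w))
     = (H i (p + w) - taylor_poly n (H i) p w) * exp (herm w p)" for i
  proof -
    have "h i (p + w) = H i (p + w) * exp (herm w p)"
      by (simp add: H_def herm_minus_right mult.assoc exp_add[symmetric])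
    moreover have "H i = (\<lambda>z. h i z * ?E z)" by (simp add: H_def fun_eq_iff)
    ultimately show ?thesis
      by (simp only: jet_expansion[OF graded_numbering_bij_betw[OF a] near] left_diff_distrib)
  qed
  have "sqrt (\<Sum>i<?l. (cmod (h i (p + w) - (\<Sum>j<jet_dim CARD('d) n. jet_coeff S a p j (h i) * jet_basis a p j (p + w))))\<^sup>2)
     = cmod (exp (herm w p)) * sqrt (\<Sum>i<?l. (cmod (H i (p + w) - taylor_poly n (H i) p w))\<^sup>2)"
    unfolding eq norm_mult power_mult_distrib sum_distrib_right[symmetric] real_sqrt_mult
    by (simp only: real_sqrt_abs abs_norm_cancel mult.commute)
  also have "\<dots> \<le> M2 * (M * (1 / \<rho>) ^ Suc n / (1 - 1 / \<rho>))"
    using T M2 by (intro mult_mono) (auto intro!: real_sqrt_ge_zero sum_nonneg)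
  finally show ?thesis .
qed

lemma continuous_on_jet_basis_bound:
  assumes "holo_map_on V f"
  shows "continuous_on V (\<lambda>z. jet_basis_bound q (f z))"
proof -
  have c: "continuous_on V (\<lambda>z. f z $ i)" for i
    using assms by (auto simp: holo_map_on_def intro: holo_on_continuous)
  have "continuous_on V (\<lambda>z. herm (f z) q)"
    unfolding herm_def by (intro continuous_on_sum continuous_on_mult c continuous_on_const)
  then show ?thesis
    unfolding jet_basis_bound_def
    by (intro continuous_on_mult continuous_on_exp continuous_on_sum continuous_on_power
        continuous_on_norm continuous_on_diff continuous_on_const c)
qed

lemma cmod_jet_scale_square:
  "(cmod (jet_scale \<gamma> p))\<^sup>2 = exp (- (norm p)\<^sup>2) / real (mfact \<gamma>)"
proof -
  have "(exp (- (norm p)\<^sup>2 / 2))\<^sup>2 = exp (- (norm p)\<^sup>2)"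
    by (simp add: power2_eq_square exp_add[symmetric])
  then show ?thesis by (simp add: jet_scale_def norm_divide power_divide)
qed

theorem theorem1p1:
  fixes K0 K :: "(complex ^ 'd::finite) set"
    and p :: "real ^ 'd"
    and f :: "complex ^ 'd \<Rightarrow> complex ^ 'r::finite"
    and \<mu> :: "(real ^ 'd) measure"
    and x :: "nat \<Rightarrow> real ^ 'd"
    and \<alpha> :: "nat \<Rightarrow> 'd \<Rightarrow> nat"
    and \<beta> :: "nat \<Rightarrow> 'r \<Rightarrow> nat"
    and C :: "nat \<Rightarrow> complex mat"
  assumes numberings: "graded_numbering \<alpha>" "graded_numbering \<beta>"
    and K0: "compact K0" "absolutely_convex K0" "0 \<in> interior K0"
    and K: "K = (\<lambda>z. cvec p + z) ` K0"
    and f: "\<exists>U. open U \<and> K \<subseteq> U \<and> holo_map_on U f"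
    and \<mu>: "sets \<mu> = sets borel" "prob_space \<mu>" "AE y in \<mu>. cvec y \<in> K0"
      "absolutely_continuous lborel \<mu>"
    and x: "range x \<subseteq> measure_support \<mu>"
    and C: "\<And>m. representation_matrix
          (restrict (push_forward f) (jet_functionals K (cvec p) m))
          (jet_dim CARD('d) m) (\<lambda>i. FB_bar_inv K (jet_basis \<alpha> (cvec p) i))
          (jet_dim CARD('r) m) (\<lambda>i. FB_bar_inv UNIV (jet_basis \<beta> (f (cvec p)) i))
          (C m)"
    and weak: "converges_weakly (empirical_measure x) \<mu>"
  shows "\<exists>c>0. \<forall>m n. m \<le> n \<longrightarrow>
    limsup (\<lambda>N. ereal (frobenius_norm
        (C m - map_mat cnj (C_hat \<alpha> \<beta> f (cvec p) m n N (\<lambda>i. cvec (p + x i))))))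
    \<le> ereal (c * sqrt (fact m) *
        (SUP y\<in>measure_support \<mu>. minkowski_gauge K0 (cvec y)) ^ n /
        sqrt (smallest_eigenvalue (moment_matrix \<alpha> n (distr \<mu> borel cvec))))"
proof -
  define P where "P = cvec p"
  define q where "q = f P"
  define h where "h i z = jet_basis \<beta> q i (f z)" for i z
  define R where "R = (SUP y\<in>measure_support \<mu>. minkowski_gauge K0 (cvec y))"
  define \<Lambda> where "\<Lambda> n = smallest_eigenvalue (moment_matrix \<alpha> n (distr \<mu> borel cvec))" for n

  (* A compact set L that contains p + s K0 with s > 1, and bounds on it that depend neither on m nor on n. *)
  have circ: "circled_base P K" unfolding K P_def by (rule circled_base_translate[OF K0(1,2)])
  have zK0: "0 \<in> K0" using K0(3) interior_subset by blast
  have PK: "P \<in> K" unfolding K P_def using zK0 by force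
  obtain U where U: "open U" "K \<subseteq> U" "holo_map_on U f" using f by auto
  obtain V where V: "open V" "K \<subseteq> V" "V \<subseteq> U" "circled_about P V"
    using circ[unfolded circled_base_def, rule_format, of U] U by auto
  have fV: "holo_map_on V f"
    using U(3) V(3) holo_on_subset unfolding holo_map_on_def by metis
  have Kc: "compact K" unfolding K by (intro compact_continuous_image continuous_intros K0(1))
  obtain s L where s: "1 < s" and L: "compact L" "L \<subseteq> V"
    and in_L0: "\<And>z t. z \<in> K \<Longrightarrow> cmod t \<le> s \<Longrightarrow> P + t *s (z - P) \<in> L"
    by (rule circled_enlarge[OF V(1,4) Kc V(2)]) blast
  have in_L: "P + t *s z \<in> L" if "z \<in> K0" "cmod t \<le> s" for z t
    using in_L0[of "P + z" t] that by (simp add: K P_def)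
  have contE: "continuous_on W (\<lambda>z. exp (herm (z - P) \<zeta>))" for W \<zeta>
    by (rule holo_on_continuous[OF holo_on_exp_herm])
  obtain M0 where M0: "0 \<le> M0" "\<And>z. z \<in> L \<Longrightarrow>
      cmod (complex_of_real (jet_basis_bound q (f z) * (cmod (exp (herm (z - P) (- P))))\<^sup>2)) \<le> M0"
  proof (rule continuous_on_compact_bound[OF _ L(1)])
    show "continuous_on L (\<lambda>z. complex_of_real (jet_basis_bound q (f z) * (cmod (exp (herm (z - P) (- P))))\<^sup>2))"
      by (intro continuous_intros contE continuous_on_subset[OF continuous_on_jet_basis_bound[OF fV] L(2)])
  qed blast
  define M where "M = sqrt M0"
  have M: "0 \<le> M" using M0(1) by (simp add: M_def)
  have MB: "jet_basis_bound q (f z) * (cmod (exp (herm (z - P) (- P))))\<^sup>2 \<le> M\<^sup>2" if "z \<in> L" for z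
    using M0(2)[OF that, unfolded norm_of_real, THEN abs_le_D1] M0(1) by (simp only: M_def real_sqrt_pow2)
  obtain M2 where M2: "0 \<le> M2" "\<And>z. z \<in> L \<Longrightarrow> cmod (exp (herm (z - P) P)) \<le> M2"
    by (rule continuous_on_compact_bound[OF contE L(1)]) (rule that)
  obtain B where B: "0 \<le> B" "\<And>z. z \<in> L \<Longrightarrow> cmod (exp (herm (z - 0) (- P))) \<le> B"
    by (rule continuous_on_compact_bound[OF holo_on_continuous[OF holo_on_exp_herm] L(1)]) (rule that)

  (* The support lies in K0, so the test functions below are bounded on it and R is at most 1. *)
  let ?S = "cvec -` K0 :: (real ^ 'd) set"
  interpret moment_setup \<mu> ?S \<alpha>
  proof (rule moment_setup.intro)
    show "AE y in \<mu>. y \<in> ?S" using \<mu>(3) by simp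
  qed (fact \<mu> numberings compact_cvec_vimage[OF K0(1)])+
  have supp: "measure_support \<mu> \<subseteq> ?S"
    by (rule measure_support_subset[OF \<mu>(1) compact_imp_closed[OF S(1)] S(2)])
  have xS: "range x \<subseteq> ?S" using x supp by blast
  have xK: "cvec (x k) \<in> K0" for k using xS rangeI[of x k] by blast
  have bdd: "bdd_above ((\<lambda>y. minkowski_gauge K0 (cvec y)) ` measure_support \<mu>)"
    using supp minkowski_gauge_bounds(2)[of _ K0] by (intro bdd_aboveI2[where M = 1]) auto
  have gauge_le: "minkowski_gauge K0 (cvec (x k)) \<le> R" for k
    unfolding R_def using x by (intro cSUP_upper bdd) auto
  have R0: "0 \<le> R"
    by (rule order_trans[OF minkowski_gauge_bounds(1)[OF xK[of 0]] gauge_le])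
  have R1: "R \<le> 1"
    unfolding R_def using x supp minkowski_gauge_bounds(2)[of _ K0] by (intro cSUP_least) auto
  have xk: "cvec (p + x k) = P + cvec (x k)" for k
    by (simp add: P_def cvec_def Finite_Cartesian_Product.vec_eq_iff)
  have xL: "P + cvec (x k) \<in> L" for k
    using in_L[OF xK[of k], of 1] s by simp

  define c1 where "c1 = M2 * (M / (1 - 1 / s))"
  have c1: "0 \<le> c1" using M M2(1) s by (simp add: c1_def)
  (* Every g > R scales K0 to a set that contains the sample vector, so the line through it stays in L up
     to the parameter s / g. Letting g tend to R, and using R <= 1 < s, gives the power of R. *)
  have remainder: "(\<Sum>i<jet_dim CARD('r) m. (cmod (h i (P + cvec (x k)) -
      (\<Sum>j<jet_dim CARD('d) n. jet_coeff K \<alpha> P j (h i) * jet_basis \<alpha> P j (P + cvec (x k)))))\<^sup>2)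
      \<le> (c1 * R ^ n)\<^sup>2" for m n k
  proof -
    let ?A = "\<Sum>i<jet_dim CARD('r) m. (cmod (h i (P + cvec (x k)) -
      (\<Sum>j<jet_dim CARD('d) n. jet_coeff K \<alpha> P j (h i) * jet_basis \<alpha> P j (P + cvec (x k)))))\<^sup>2"
    let ?T = "\<lambda>g. M2 * (M * (g / s) ^ Suc n / (1 - g / s))"
    have Tg: "sqrt ?A \<le> ?T g" if g: "R < g" "g < s" for g
    proof -
      have g0: "0 < g" using g R0 by simp
      have "minkowski_gauge K0 (cvec (x k)) < g" using gauge_le[of k] g by simp
      from minkowski_gauge_less[OF K0(2) xK this]
      obtain z' where z': "z' \<in> K0" "cvec (x k) = g *\<^sub>R z'" by blast
      have "sqrt ?A \<le> M2 * (M * (1 / (s / g)) ^ Suc n / (1 - 1 / (s / g)))"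
        unfolding h_def
      proof (rule jet_expansion_remainder[OF numberings V(1,2) fV _ _ L(2) M MB M2(1)])
        show "1 < s / g" using g g0 by simp
        show "cmod (exp (herm (cvec (x k)) P)) \<le> M2" using M2(2)[OF xL[of k]] by simp
        fix t :: complex assume t: "t \<in> ball 0 (s / g)"
        have "t *s cvec (x k) = (t * complex_of_real g) *s z'"
          unfolding z'(2) smult_real[symmetric] by simp
        moreover have "cmod (t * complex_of_real g) \<le> s" using t g0 by (simp add: norm_mult field_simps)
        ultimately show "P + t *s cvec (x k) \<in> L" using in_L[OF z'(1)] by simp
      qed
      then show ?thesis by simp
    qed
    have "sqrt ?A \<le> ?T R"
    proof (rule tendsto_lowerbound)
      show "(?T \<longlongrightarrow> ?T R) (at_right R)"
        using s R1 by (intro tendsto_intros) auto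
      have "R < s" using R1 s by simp
      from eventually_at_right_real[OF this]
      show "eventually (\<lambda>g. sqrt ?A \<le> ?T g) (at_right R)"
      proof eventually_elim
        case (elim g)
        then show ?case by (intro Tg) (simp_all only: greaterThanLessThan_iff)
      qed
    qed simp
    also have "?T R \<le> M2 * (M * R ^ n / (1 - 1 / s))"
    proof -
      have "R / s \<le> R" using R0 s mult_left_mono[of 1 s R] by (simp add: divide_le_eq)
      then have "(R / s) ^ Suc n \<le> R ^ Suc n" using R0 s by (intro power_mono) auto
      also have "\<dots> \<le> R ^ n" using R0 R1 by (intro power_decreasing) auto
      finally have num: "M * (R / s) ^ Suc n \<le> M * R ^ n" using M by (rule mult_left_mono)
      have den: "1 - 1 / s \<le> 1 - R / s" using R1 s by (simp add: divide_right_mono)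
      have "0 \<le> M * R ^ n" "0 < 1 - 1 / s" using M R0 s by simp_all
      from frac_le[OF this(1) num this(2) den] show ?thesis
        using M2(1) by (rule mult_left_mono)
    qed
    also have "\<dots> = c1 * R ^ n" by (simp add: c1_def)
    finally have "sqrt ?A \<le> c1 * R ^ n" .
    then have "(sqrt ?A)\<^sup>2 \<le> (c1 * R ^ n)\<^sup>2" by (intro power_mono) (auto intro: sum_nonneg)
    then show ?thesis by (simp add: sum_nonneg)
  qed

  (* The added 1 only makes the constant positive. *)
  define c where "c = sqrt (2 * exp ((norm P)\<^sup>2)) * B * c1 + 1"
  have c0: "0 < c" unfolding c_def using B(1) c1 by (intro add_nonneg_pos) auto
  have main: "eventually (\<lambda>N. frobenius_norm (C m - map_mat cnj (C_hat \<alpha> \<beta> f P m n N (\<lambda>i. cvec (p + x i))))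
      \<le> c * sqrt (fact m) * R ^ n / sqrt (\<Lambda> n)) sequentially" if mn: "m \<le> n" for m n
  proof -
    let ?rn = "jet_dim CARD('d) n" and ?rm = "jet_dim CARD('d) m" and ?l = "jet_dim CARD('r) m"
    have \<Lambda>: "0 < \<Lambda> n" unfolding \<Lambda>_def by (rule moment_lower_bound(1))
    have rmn: "?rm \<le> ?rn" by (rule jet_dim_mono[OF mn])
    show ?thesis
      using eventually_empirical_lower_bound[OF weak xS, of n] eventually_gt_at_top[of 0]
    proof eventually_elim
      case (elim N)
      have N: "0 < real N" using elim(2) by simp
      define t where "t k j = complex_of_real (real_mono (\<alpha> j) (x k))" for k j
      have low: "(\<Lambda> n / 2 * real N) * sqnorm ?rn e \<le> (\<Sum>k<N. (cmod (\<Sum>j<?rn. e j * t k j))\<^sup>2)" for e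
        using elim(1)[rule_format, of e] by (simp add: \<Lambda>_def t_def mult_ac)
      let ?U = "jet_matrix \<alpha> P n N (\<lambda>i. cvec (p + x i))"
      let ?V = "jet_matrix \<beta> q m N (\<lambda>i. f (cvec (p + x i)))"
      define A where "A = mat_adjoint ?V * pseudo_inverse (mat_adjoint ?U)"
      define D where "D j = jet_scale (\<alpha> j) P" for j
      define \<omega> where "\<omega> k = exp (herm (P + cvec (x k)) P)" for k
      have D2: "(cmod (D j))\<^sup>2 = exp (- (norm P)\<^sup>2) / real (mfact (\<alpha> j))" for j
        unfolding D_def by (rule cmod_jet_scale_square)
      have D0: "D j \<noteq> 0" for j
        using D2[of j] mfact_pos[of "\<alpha> j"] by auto
      have Uc: "?U \<in> carrier_mat N ?rn" and Vc: "?V \<in> carrier_mat N ?l"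
        by (simp_all add: jet_matrix_def)
      have Ue: "?U $$ (k, j) = jet_basis \<alpha> P j (P + cvec (x k))" if "k < N" "j < ?rn" for k j
        using that by (simp add: jet_matrix_def xk)
      have Ve: "?V $$ (k, i) = h i (P + cvec (x k))" if "k < N" "i < ?l" for k i
        using that by (simp add: jet_matrix_def xk h_def)
      have Ut: "?U $$ (k, j) = D j * t k j * \<omega> k" if "k < N" "j < ?rn" for k j
        using that by (simp add: Ue jet_basis_scale D_def t_def \<omega>_def mpow_cvec)
      have \<omega>: "1 \<le> B * cmod (\<omega> k)" for k
      proof -
        have "1 = cmod (exp (herm (P + cvec (x k) - 0) (- P)) * \<omega> k)"
          by (simp add: \<omega>_def herm_minus_right exp_add[symmetric] del: norm_exp_eq_Re)
        also have "\<dots> \<le> B * cmod (\<omega> k)"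
          unfolding norm_mult by (intro mult_right_mono B(2) xL) auto
        finally show ?thesis .
      qed
      have ker: "e j = 0" if e: "\<And>k. k < N \<Longrightarrow> (\<Sum>j<?rn. ?U $$ (k, j) * e j) = 0" and j: "j < ?rn" for e j
      proof -
        have "(\<Sum>j<?rn. (D j * e j) * t k j) = 0" if k: "k < N" for k
        proof -
          have "(\<Sum>j<?rn. (D j * e j) * t k j) * \<omega> k = (\<Sum>j<?rn. ?U $$ (k, j) * e j)"
            unfolding sum_distrib_right by (intro sum.cong refl) (simp add: Ut[OF k])
          then show ?thesis using e[OF k] by (simp add: \<omega>_def)
        qed
        then have "(\<Lambda> n / 2 * real N) * sqnorm ?rn (\<lambda>j. D j * e j) \<le> 0"
          using low[of "\<lambda>j. D j * e j"] by simp
        then have "sqnorm ?rn (\<lambda>j. D j * e j) \<le> 0"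
          using \<Lambda> N by (simp add: mult_le_0_iff)
        moreover have "(cmod (D j * e j))\<^sup>2 \<le> sqnorm ?rn (\<lambda>j. D j * e j)"
          unfolding sqnorm_def using j by (intro member_le_sum) auto
        ultimately have "(cmod (D j * e j))\<^sup>2 \<le> 0" by linarith
        then show ?thesis using D0[of j] by simp
      qed
      let ?E = "C m - map_mat cnj (C_hat \<alpha> \<beta> f P m n N (\<lambda>i. cvec (p + x i)))"
      have Ehat: "?E $$ (i, j) = jet_coeff K \<alpha> P j (h i) - cnj (A $$ (i, j))" if "i < ?l" "j < ?rm" for i j
      proof -
        have "C m $$ (i, j) = jet_coeff K \<alpha> P j (h i)"
          unfolding h_def q_def using that graded_numbering_less_iff[OF numberings(1)]
          by (intro representation_matrix_entry[OF circ PK _ C[of m, folded P_def]])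
             (use numberings(2) in \<open>auto simp: graded_numbering_def bij_def\<close>)
        then show ?thesis
          using that by (simp add: C_hat_def Let_def A_def q_def)
      qed
      have Edim: "dim_row ?E = ?l" "dim_col ?E = ?rm" by (simp_all add: C_hat_def Let_def)
      (* The factor sqrt (fact m): up to a constant, its inverse bounds the scalings D j of degree at most m
         from below. *)
      have scale: "1 \<le> exp ((norm P)\<^sup>2) * fact m * (cmod (D j))\<^sup>2" if "j < ?rm" for j
      proof -
        have "mfact (\<alpha> j) \<le> fact (mdeg (\<alpha> j))" by (rule mfact_le_fact_mdeg)
        also have "\<dots> \<le> fact m"
          using that graded_numbering_less_iff[OF numberings(1), of j m] by (intro fact_mono) auto
        finally have "real (mfact (\<alpha> j)) \<le> fact m" by (metis of_nat_fact of_nat_le_iff)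
        moreover have "exp ((norm P)\<^sup>2) * exp (- (norm P)\<^sup>2) = 1" by (simp add: exp_add[symmetric])
        ultimately show ?thesis using mfact_pos[of "\<alpha> j"] by (simp add: D2 field_simps)
      qed
      let ?\<rho> = "\<lambda>k i. h i (P + cvec (x k)) -
          (\<Sum>j<?rn. jet_coeff K \<alpha> P j (h i) * jet_basis \<alpha> P j (P + cvec (x k)))"
      have row: "(\<Lambda> n / 2 * real N) * (\<Sum>j<?rm. (cmod (?E $$ (i, j)))\<^sup>2)
          \<le> exp ((norm P)\<^sup>2) * fact m * (B\<^sup>2 * (\<Sum>k<N. (cmod (?\<rho> k i))\<^sup>2))" if i: "i < ?l" for i
      proof -
        let ?e = "\<lambda>j. D j * (jet_coeff K \<alpha> P j (h i) - cnj (A $$ (i, j)))"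
        have "(\<Sum>j<?rm. (cmod (?E $$ (i, j)))\<^sup>2) \<le> (\<Sum>j<?rm. exp ((norm P)\<^sup>2) * fact m * (cmod (?e j))\<^sup>2)"
        proof (rule sum_mono)
          fix j assume "j \<in> {..<?rm}"
          then have j: "j < ?rm" by simp
          have "1 * (cmod (?E $$ (i, j)))\<^sup>2 \<le> (exp ((norm P)\<^sup>2) * fact m * (cmod (D j))\<^sup>2) * (cmod (?E $$ (i, j)))\<^sup>2"
            by (intro mult_right_mono scale[OF j]) simp
          then show "(cmod (?E $$ (i, j)))\<^sup>2 \<le> exp ((norm P)\<^sup>2) * fact m * (cmod (?e j))\<^sup>2"
            unfolding Ehat[OF i j] by (simp add: norm_mult power_mult_distrib mult_ac)
        qed
        also have "\<dots> = exp ((norm P)\<^sup>2) * fact m * (\<Sum>j<?rm. (cmod (?e j))\<^sup>2)"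
          by (simp add: sum_distrib_left)
        also have "\<dots> \<le> exp ((norm P)\<^sup>2) * fact m * sqnorm ?rn ?e"
          unfolding sqnorm_def using rmn by (intro mult_left_mono sum_mono2) auto
        finally have "(\<Lambda> n / 2 * real N) * (\<Sum>j<?rm. (cmod (?E $$ (i, j)))\<^sup>2)
            \<le> (\<Lambda> n / 2 * real N) * (exp ((norm P)\<^sup>2) * fact m * sqnorm ?rn ?e)"
          using \<Lambda> N by (intro mult_left_mono) auto
        also have "\<dots> = exp ((norm P)\<^sup>2) * fact m * ((\<Lambda> n / 2 * real N) * sqnorm ?rn ?e)"
          by (simp only: mult_ac)
        also have "(\<Lambda> n / 2 * real N) * sqnorm ?rn ?e \<le> B\<^sup>2 * (\<Sum>k<N. (cmod (?V $$ (k, i) -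
            (\<Sum>j<?rn. jet_coeff K \<alpha> P j (h i) * ?U $$ (k, j))))\<^sup>2)"
        proof (rule weighted_least_squares_error[OF low Ut B(1) \<omega>])
          show "(\<Sum>k<N. (\<Sum>j<?rn. cnj (A $$ (i, j)) * ?U $$ (k, j)) * cnj (?U $$ (k, l)))
              = (\<Sum>k<N. ?V $$ (k, i) * cnj (?U $$ (k, l)))" if "l < ?rn" for l
            unfolding A_def
          proof (rule pseudo_inverse_normal_equations[OF Uc Vc _ i that])
            show "e j = 0" if "\<And>k. k < N \<Longrightarrow> (\<Sum>j<?rn. ?U $$ (k, j) * e j) = 0" "j < ?rn" for e j
              by (rule ker[of e j, OF that])
          qed
        qed
        also have "(\<Sum>k<N. (cmod (?V $$ (k, i) - (\<Sum>j<?rn. jet_coeff K \<alpha> P j (h i) * ?U $$ (k, j))))\<^sup>2)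
            = (\<Sum>k<N. (cmod (?\<rho> k i))\<^sup>2)"
          using i by (intro sum.cong refl) (simp add: Ue Ve)
        finally show ?thesis by (simp add: mult_left_mono)
      qed
      define F where "F = (\<Sum>i<?l. \<Sum>j<?rm. (cmod (?E $$ (i, j)))\<^sup>2)"
      have "(\<Lambda> n / 2 * real N) * F
          \<le> (\<Sum>i<?l. exp ((norm P)\<^sup>2) * fact m * (B\<^sup>2 * (\<Sum>k<N. (cmod (?\<rho> k i))\<^sup>2)))"
        unfolding F_def sum_distrib_left[of _ _ "{..<?l}"] by (intro sum_mono row) simp
      also have "\<dots> = exp ((norm P)\<^sup>2) * fact m * (B\<^sup>2 * (\<Sum>k<N. \<Sum>i<?l. (cmod (?\<rho> k i))\<^sup>2))"
        by (subst sum.swap) (simp only: sum_distrib_left)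
      also have "\<dots> \<le> exp ((norm P)\<^sup>2) * fact m * (B\<^sup>2 * (\<Sum>k<N. (c1 * R ^ n)\<^sup>2))"
        by (intro mult_left_mono sum_mono remainder) auto
      also have "\<dots> = (exp ((norm P)\<^sup>2) * fact m * (B\<^sup>2 * (c1 * R ^ n)\<^sup>2)) * real N"
        by simp
      finally have "\<Lambda> n / 2 * F \<le> exp ((norm P)\<^sup>2) * fact m * (B\<^sup>2 * (c1 * R ^ n)\<^sup>2)"
        using N by (simp add: mult.assoc mult.left_commute[of _ "real N"] mult.commute[of _ "real N"])
      then have "F \<le> 2 * (exp ((norm P)\<^sup>2) * fact m * (B\<^sup>2 * (c1 * R ^ n)\<^sup>2)) / \<Lambda> n"
        using \<Lambda> by (simp add: field_simps)
      also have "\<dots> = (sqrt (2 * exp ((norm P)\<^sup>2)) * B * c1 * sqrt (fact m) * R ^ n / sqrt (\<Lambda> n))\<^sup>2"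
        using \<Lambda> by (simp add: power_mult_distrib power_divide)
      finally have "sqrt F \<le> sqrt (2 * exp ((norm P)\<^sup>2)) * B * c1 * sqrt (fact m) * R ^ n / sqrt (\<Lambda> n)"
        using B(1) c1 R0 \<Lambda> by (intro real_le_lsqrt) (auto simp: F_def intro!: sum_nonneg)
      also have "\<dots> \<le> c * sqrt (fact m) * R ^ n / sqrt (\<Lambda> n)"
        using R0 \<Lambda> unfolding c_def by (intro divide_right_mono mult_right_mono) auto
      finally show ?case
        unfolding frobenius_norm_def Edim F_def .
    qed
  qed
  show ?thesis
  proof (intro exI[of _ c] conjI c0 allI impI)
    fix m n :: nat assume "m \<le> n"
    from main[OF this] show "limsup (\<lambda>N. ereal (frobenius_norm
        (C m - map_mat cnj (C_hat \<alpha> \<beta> f (cvec p) m n N (\<lambda>i. cvec (p + x i))))))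
      \<le> ereal (c * sqrt (fact m) *
        (SUP y\<in>measure_support \<mu>. minkowski_gauge K0 (cvec y)) ^ n /
        sqrt (smallest_eigenvalue (moment_matrix \<alpha> n (distr \<mu> borel cvec))))"
      unfolding P_def[symmetric] R_def[symmetric] \<Lambda>_def[symmetric]
      by (intro Limsup_bounded) (auto elim: eventually_mono)
  qed
qed

end
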